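(* Let $k$ be a field, let $G$ be a finite group of order $n$ and let $\mathcal{B}$ be a $G$-graded $k$-category. Then the $k$-categories $(\mathcal{B}\# k^G)\# kG$ and $M_n(\mathcal{B})$ are isomorphic.
   Context: A $k$-category is a category whose objects form a set, whose morphism sets ${}_y\mathcal{B}_x$ (from $x$ to $y$) are $k$-vector spaces, and whose composition is $k$-bilinear. Functors and isomorphisms between $k$-categories are understood to be $k$-linear. A $G$-grading of $\mathcal{B}$ is a decomposition ${}_y\mathcal{B}_x=\bigoplus_{s\in G}{}_y\mathcal{B}_x^{s}$ of each morphism space such that ${}_z\mathcal{B}_y^{t}\,{}_y\mathcal{B}_x^{s}\subseteq{}_z\mathcal{B}_x^{ts}$. If $H$ is a Hopf algebra and $\mathcal{D}$ is an $H$-module category (each morphism space is an $H$-module, composition maps are $H$-module maps for the diagonal action, and $h\,1_x=\epsilon(h)1_x$ for each object $x$), then the smash category $\mathcal{D}\# H$ has the same objects as $\mathcal{D}$, morphisms ${}_y(\mathcal{D}\# H)_x={}_y\mathcal{D}_x\otimes_k H$, and composition $(\varphi\otimes h)(\psi\otimes h')=\sum\varphi\,(h_1\psi)\otimes h_2h'$. The $G$-graded category $\mathcal{B}$ is a $k^G$-module category, where $k^G=(kG)^*$ is the Hopf algebra of functions on $G$ with basis $(\delta_s)_{s\in G}$ dual to $G$, and $\delta_s$ acts as projection onto the degree $s$ component; this defines $\mathcal{B}\# k^G$. In turn $\mathcal{B}\# k^G$ is a $kG$-module category via $t(f\otimes\delta_s)=f\otimes\delta_{st^{-1}}$ for $s,t\in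 G$; this defines $(\mathcal{B}\# k^G)\# kG$. The matrix category $M_n(\mathcal{B})$ has the same objects as $\mathcal{B}$; the morphisms from $x$ to $y$ are the $n\times n$ matrices with entries in ${}_y\mathcal{B}_x$, and composition is the matrix product combined with the composition of $\mathcal{B}$. *)

theory Defs
  imports
    "HOL-Algebra.Module"
    "HOL-Algebra.AbelCoset"
begin

section \<open>Linear and bilinear maps\<close>

definition linear_map ::
  "('k, 'r) ring_scheme \<Rightarrow> ('k, 'v, 'x) module_scheme \<Rightarrow> ('k, 'w, 'y) module_scheme \<Rightarrow> ('v \<Rightarrow> 'w) \<Rightarrow> bool"
  where "linear_map K V W f \<longleftrightarrow>
    f \<in> carrier V \<rightarrow> carrier W \<and>
    (\<forall>u\<in>carrier V. \<forall>v\<in>carrier V. f (u \<oplus>\<^bsub>V\<^esub> v) = f u \<oplus>\<^bsub>W\<^esub> f v) \<and>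
    (\<forall>a\<in>carrier K. \<forall>v\<in>carrier V. f (a \<odot>\<^bsub>V\<^esub> v) = a \<odot>\<^bsub>W\<^esub> f v)"

definition bilinear_map ::
  "('k, 'r) ring_scheme \<Rightarrow> ('k, 'u, 'x) module_scheme \<Rightarrow> ('k, 'v, 'y) module_scheme \<Rightarrow>
    ('k, 'w, 'z) module_scheme \<Rightarrow> ('u \<Rightarrow> 'v \<Rightarrow> 'w) \<Rightarrow> bool"
  where "bilinear_map K U V W b \<longleftrightarrow>
    (\<forall>u\<in>carrier U. linear_map K V W (b u)) \<and>
    (\<forall>v\<in>carrier V. linear_map K U W (\<lambda>u. b u v))"


section \<open>Tensor products\<close>

text \<open>
  The tensor product is the free module on the pairs, modulo the submodule generated by the
  bilinearity relations. The ring fields \<open>mult\<close> and \<open>one\<close> of a \<open>module\<close> record play no role for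
  the library's locale \<open>module\<close>; they are left \<open>undefined\<close> for spaces that are not algebras.
\<close>

definition free_module :: "('k, 'r) ring_scheme \<Rightarrow> 'a set \<Rightarrow> ('k, 'a \<Rightarrow> 'k) module"
  where "free_module K X = \<lparr>
    carrier = {u. range u \<subseteq> carrier K \<and> finite {p. u p \<noteq> \<zero>\<^bsub>K\<^esub>} \<and> {p. u p \<noteq> \<zero>\<^bsub>K\<^esub>} \<subseteq> X},
    mult = undefined,
    one = undefined,
    zero = (\<lambda>p. \<zero>\<^bsub>K\<^esub>),
    add = (\<lambda>u v p. u p \<oplus>\<^bsub>K\<^esub> v p),
    smult = (\<lambda>a u p. a \<otimes>\<^bsub>K\<^esub> u p)\<rparr>"

definition single :: "('k, 'r) ring_scheme \<Rightarrow> 'a \<Rightarrow> 'a \<Rightarrow> 'k"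
  where "single K q = (\<lambda>p. if p = q then \<one>\<^bsub>K\<^esub> else \<zero>\<^bsub>K\<^esub>)"

definition quotient_module ::
  "('k, 'r) ring_scheme \<Rightarrow> ('k, 'v, 'x) module_scheme \<Rightarrow> 'v set \<Rightarrow> ('k, 'v set) module"
  where "quotient_module K V N = \<lparr>
    carrier = a_rcosets\<^bsub>V\<^esub> N,
    mult = undefined,
    one = undefined,
    zero = N,
    add = (\<lambda>S T. S <+>\<^bsub>V\<^esub> T),
    smult = (\<lambda>a S. \<Union>u\<in>S. N +>\<^bsub>V\<^esub> (a \<odot>\<^bsub>V\<^esub> u))\<rparr>"

definition tensor_generators ::
  "('k, 'r) ring_scheme \<Rightarrow> ('k, 'v, 'x) module_scheme \<Rightarrow> ('k, 'w, 'y) module_scheme \<Rightarrow> ('v \<times> 'w \<Rightarrow> 'k) set"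
  where "tensor_generators K V W =
    (let F = free_module K (carrier V \<times> carrier W); e = (\<lambda>v w. single K (v, w)) in
      {e (v \<oplus>\<^bsub>V\<^esub> v') w \<ominus>\<^bsub>F\<^esub> (e v w \<oplus>\<^bsub>F\<^esub> e v' w) | v v' w.
          v \<in> carrier V \<and> v' \<in> carrier V \<and> w \<in> carrier W} \<union>
      {e v (w \<oplus>\<^bsub>W\<^esub> w') \<ominus>\<^bsub>F\<^esub> (e v w \<oplus>\<^bsub>F\<^esub> e v w') | v w w'.
          v \<in> carrier V \<and> w \<in> carrier W \<and> w' \<in> carrier W} \<union>
      {e (a \<odot>\<^bsub>V\<^esub> v) w \<ominus>\<^bsub>F\<^esub> a \<odot>\<^bsub>F\<^esub> e v w | a v w.
          a \<in> carrier K \<and> v \<in> carrier V \<and> w \<in> carrier W} \<union>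
      {e v (a \<odot>\<^bsub>W\<^esub> w) \<ominus>\<^bsub>F\<^esub> a \<odot>\<^bsub>F\<^esub> e v w | a v w.
          a \<in> carrier K \<and> v \<in> carrier V \<and> w \<in> carrier W})"

definition tensor_relations ::
  "('k, 'r) ring_scheme \<Rightarrow> ('k, 'v, 'x) module_scheme \<Rightarrow> ('k, 'w, 'y) module_scheme \<Rightarrow> ('v \<times> 'w \<Rightarrow> 'k) set"
  where "tensor_relations K V W =
    \<Inter>{N. submodule N K (free_module K (carrier V \<times> carrier W)) \<and> tensor_generators K V W \<subseteq> N}"

definition tensor_product ::
  "('k, 'r) ring_scheme \<Rightarrow> ('k, 'v, 'x) module_scheme \<Rightarrow> ('k, 'w, 'y) module_scheme \<Rightarrow>
    ('k, ('v \<times> 'w \<Rightarrow> 'k) set) module"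
  where "tensor_product K V W =
    quotient_module K (free_module K (carrier V \<times> carrier W)) (tensor_relations K V W)"

definition pure_tensor ::
  "('k, 'r) ring_scheme \<Rightarrow> ('k, 'v, 'x) module_scheme \<Rightarrow> ('k, 'w, 'y) module_scheme \<Rightarrow>
    'v \<Rightarrow> 'w \<Rightarrow> ('v \<times> 'w \<Rightarrow> 'k) set"
  where "pure_tensor K V W v w =
    tensor_relations K V W +>\<^bsub>free_module K (carrier V \<times> carrier W)\<^esub> single K (v, w)"

text \<open>
  \<open>tensor_lift K P b\<close> sends a tensor \<open>\<Sum> v \<otimes> w\<close> to \<open>\<Sum> b v w \<in> P\<close>. For bilinear \<open>b\<close> this does not
  depend on the chosen representative, and it is the linear map given by the universal property.
\<close>

definition tensor_lift ::
  "('k, 'r) ring_scheme \<Rightarrow> ('k, 'p, 'z) module_scheme \<Rightarrow> ('v \<Rightarrow> 'w \<Rightarrow> 'p) \<Rightarrow> ('v \<times> 'w \<Rightarrow> 'k) set \<Rightarrow> 'p"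
  where "tensor_lift K P b t =
    (let u = (SOME u. u \<in> t) in
      finsum P (\<lambda>p. u p \<odot>\<^bsub>P\<^esub> b (fst p) (snd p)) {p. u p \<noteq> \<zero>\<^bsub>K\<^esub>})"


section \<open>Hopf algebras\<close>

record ('k, 'h) hopf = "('k, 'h) module" +
  comult :: "'h \<Rightarrow> ('h \<times> 'h \<Rightarrow> 'k) set"
  counit :: "'h \<Rightarrow> 'k"
  antipode :: "'h \<Rightarrow> 'h"

text \<open>The library's locale \<open>algebra\<close> is for commutative algebras only.\<close>

locale assoc_algebra = field K + module K A + ring A
  for K (structure) and A (structure) +
  assumes mult_bilinear: "bilinear_map K A A A (\<lambda>x y. x \<otimes>\<^bsub>A\<^esub> y)"

text \<open>
  Sweedler sums \<open>\<Sum> b h\<^sub>1 h\<^sub>2\<close> are written \<open>tensor_lift K P b (comult H h)\<close>. Coassociativity is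
  stated in \<open>H \<otimes> (H \<otimes> H)\<close>.
\<close>

locale hopf_algebra = assoc_algebra K H
  for K (structure) and H :: "('k, 'h, 'z) hopf_scheme" (structure) +
  assumes comult_linear: "linear_map K H (tensor_product K H H) (comult H)"
    and counit_linear: "h \<in> carrier H \<Longrightarrow> counit H h \<in> carrier K"
      "\<lbrakk>h \<in> carrier H; h' \<in> carrier H\<rbrakk> \<Longrightarrow> counit H (h \<oplus>\<^bsub>H\<^esub> h') = counit H h \<oplus>\<^bsub>K\<^esub> counit H h'"
      "\<lbrakk>a \<in> carrier K; h \<in> carrier H\<rbrakk> \<Longrightarrow> counit H (a \<odot>\<^bsub>H\<^esub> h) = a \<otimes>\<^bsub>K\<^esub> counit H h"
    and coassoc: "h \<in> carrier H \<Longrightarrow>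
      tensor_lift K (tensor_product K H (tensor_product K H H))
        (\<lambda>x y. tensor_lift K (tensor_product K H (tensor_product K H H))
          (\<lambda>x\<^sub>1 x\<^sub>2. pure_tensor K H (tensor_product K H H) x\<^sub>1 (pure_tensor K H H x\<^sub>2 y)) (comult H x))
        (comult H h) =
      tensor_lift K (tensor_product K H (tensor_product K H H))
        (\<lambda>x y. pure_tensor K H (tensor_product K H H) x (comult H y)) (comult H h)"
    and counit_left: "h \<in> carrier H \<Longrightarrow>
      tensor_lift K H (\<lambda>x y. counit H x \<odot>\<^bsub>H\<^esub> y) (comult H h) = h"
    and counit_right: "h \<in> carrier H \<Longrightarrow>
      tensor_lift K H (\<lambda>x y. counit H y \<odot>\<^bsub>H\<^esub> x) (comult H h) = h"
    and comult_one: "comult H \<one>\<^bsub>H\<^esub> = pure_tensor K H H \<one>\<^bsub>H\<^esub> \<one>\<^bsub>H\<^esub>"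
    and comult_mult: "\<lbrakk>h \<in> carrier H; h' \<in> carrier H\<rbrakk> \<Longrightarrow>
      comult H (h \<otimes>\<^bsub>H\<^esub> h') =
      tensor_lift K (tensor_product K H H)
        (\<lambda>x y. tensor_lift K (tensor_product K H H)
          (\<lambda>x' y'. pure_tensor K H H (x \<otimes>\<^bsub>H\<^esub> x') (y \<otimes>\<^bsub>H\<^esub> y')) (comult H h'))
        (comult H h)"
    and counit_one: "counit H \<one>\<^bsub>H\<^esub> = \<one>\<^bsub>K\<^esub>"
    and counit_mult: "\<lbrakk>h \<in> carrier H; h' \<in> carrier H\<rbrakk> \<Longrightarrow>
      counit H (h \<otimes>\<^bsub>H\<^esub> h') = counit H h \<otimes>\<^bsub>K\<^esub> counit H h'"
    and antipode_linear: "linear_map K H H (antipode H)"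
    and antipode_left: "h \<in> carrier H \<Longrightarrow>
      tensor_lift K H (\<lambda>x y. antipode H x \<otimes>\<^bsub>H\<^esub> y) (comult H h) = counit H h \<odot>\<^bsub>H\<^esub> \<one>\<^bsub>H\<^esub>"
    and antipode_right: "h \<in> carrier H \<Longrightarrow>
      tensor_lift K H (\<lambda>x y. x \<otimes>\<^bsub>H\<^esub> antipode H y) (comult H h) = counit H h \<odot>\<^bsub>H\<^esub> \<one>\<^bsub>H\<^esub>"

definition delta :: "('k, 'r) ring_scheme \<Rightarrow> ('g, 's) monoid_scheme \<Rightarrow> 'g \<Rightarrow> 'g \<Rightarrow> 'k"
  where "delta K G s = (\<lambda>u\<in>carrier G. if u = s then \<one>\<^bsub>K\<^esub> else \<zero>\<^bsub>K\<^esub>)"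

definition function_algebra ::
  "('k, 'r) ring_scheme \<Rightarrow> ('g, 's) monoid_scheme \<Rightarrow> ('k, 'g \<Rightarrow> 'k) module"
  where "function_algebra K G = \<lparr>
    carrier = carrier G \<rightarrow>\<^sub>E carrier K,
    mult = (\<lambda>a b. \<lambda>s\<in>carrier G. a s \<otimes>\<^bsub>K\<^esub> b s),
    one = (\<lambda>s\<in>carrier G. \<one>\<^bsub>K\<^esub>),
    zero = (\<lambda>s\<in>carrier G. \<zero>\<^bsub>K\<^esub>),
    add = (\<lambda>a b. \<lambda>s\<in>carrier G. a s \<oplus>\<^bsub>K\<^esub> b s),
    smult = (\<lambda>c a. \<lambda>s\<in>carrier G. c \<otimes>\<^bsub>K\<^esub> a s)\<rparr>"

text \<open>
  \<open>k\<^sup>G\<close> for finite \<open>G\<close>: the comultiplication is dual to the product of \<open>kG\<close>, i.e. it sends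
  \<open>\<delta>\<^sub>s\<close> to the sum of \<open>\<delta>\<^sub>u \<otimes> \<delta>\<^sub>v\<close> over \<open>uv = s\<close>.
\<close>

definition function_hopf ::
  "('k, 'r) ring_scheme \<Rightarrow> ('g, 's) monoid_scheme \<Rightarrow> ('k, 'g \<Rightarrow> 'k) hopf"
  where "function_hopf K G = (let A = function_algebra K G; T = tensor_product K A A in
    module.extend A (hopf.fields
      (\<lambda>a. \<Oplus>\<^bsub>T\<^esub>p\<in>carrier G \<times> carrier G.
        a (fst p \<otimes>\<^bsub>G\<^esub> snd p) \<odot>\<^bsub>T\<^esub> pure_tensor K A A (delta K G (fst p)) (delta K G (snd p)))
      (\<lambda>a. a \<one>\<^bsub>G\<^esub>)
      (\<lambda>a. \<lambda>s\<in>carrier G. a (inv\<^bsub>G\<^esub> s))))"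

text \<open>\<open>kG\<close> for finite \<open>G\<close>; the group element \<open>s\<close> is \<open>delta K G s\<close>.\<close>

definition group_algebra ::
  "('k, 'r) ring_scheme \<Rightarrow> ('g, 's) monoid_scheme \<Rightarrow> ('k, 'g \<Rightarrow> 'k) module"
  where "group_algebra K G = (function_algebra K G)\<lparr>
    mult := (\<lambda>a b. \<lambda>s\<in>carrier G. \<Oplus>\<^bsub>K\<^esub>u\<in>carrier G. a u \<otimes>\<^bsub>K\<^esub> b (inv\<^bsub>G\<^esub> u \<otimes>\<^bsub>G\<^esub> s)),
    one := delta K G \<one>\<^bsub>G\<^esub>\<rparr>"

definition group_hopf ::
  "('k, 'r) ring_scheme \<Rightarrow> ('g, 's) monoid_scheme \<Rightarrow> ('k, 'g \<Rightarrow> 'k) hopf"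
  where "group_hopf K G = (let A = group_algebra K G; T = tensor_product K A A in
    module.extend A (hopf.fields
      (\<lambda>a. \<Oplus>\<^bsub>T\<^esub>s\<in>carrier G. a s \<odot>\<^bsub>T\<^esub> pure_tensor K A A (delta K G s) (delta K G s))
      (\<lambda>a. \<Oplus>\<^bsub>K\<^esub>s\<in>carrier G. a s)
      (\<lambda>a. \<lambda>s\<in>carrier G. a (inv\<^bsub>G\<^esub> s))))"


section \<open>\<open>k\<close>-categories\<close>

text \<open>
  \<open>Mor C y x\<close> is the space of morphisms from \<open>x\<close> to \<open>y\<close>, and \<open>Comp C z y x g f\<close> is the composite
  of \<open>f \<in> Mor C y x\<close> with \<open>g \<in> Mor C z y\<close>. Different morphism spaces need not be disjoint.
\<close>

record ('o, 'k, 'm) kcat =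
  Obj :: "'o set"
  Mor :: "'o \<Rightarrow> 'o \<Rightarrow> ('k, 'm) module"
  Comp :: "'o \<Rightarrow> 'o \<Rightarrow> 'o \<Rightarrow> 'm \<Rightarrow> 'm \<Rightarrow> 'm"
  Ident :: "'o \<Rightarrow> 'm"

locale k_category = field K
  for K (structure) and C :: "('o, 'k, 'm) kcat" +
  assumes Mor_module: "\<lbrakk>x \<in> Obj C; y \<in> Obj C\<rbrakk> \<Longrightarrow> module K (Mor C y x)"
    and Comp_bilinear: "\<lbrakk>x \<in> Obj C; y \<in> Obj C; z \<in> Obj C\<rbrakk> \<Longrightarrow>
      bilinear_map K (Mor C z y) (Mor C y x) (Mor C z x) (Comp C z y x)"
    and Comp_assoc: "\<lbrakk>w \<in> Obj C; x \<in> Obj C; y \<in> Obj C; z \<in> Obj C;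
        h \<in> carrier (Mor C z y); g \<in> carrier (Mor C y x); f \<in> carrier (Mor C x w)\<rbrakk> \<Longrightarrow>
      Comp C z x w (Comp C z y x h g) f = Comp C z y w h (Comp C y x w g f)"
    and Ident_closed: "x \<in> Obj C \<Longrightarrow> Ident C x \<in> carrier (Mor C x x)"
    and Ident_left: "\<lbrakk>x \<in> Obj C; y \<in> Obj C; f \<in> carrier (Mor C y x)\<rbrakk> \<Longrightarrow>
      Comp C y y x (Ident C y) f = f"
    and Ident_right: "\<lbrakk>x \<in> Obj C; y \<in> Obj C; f \<in> carrier (Mor C y x)\<rbrakk> \<Longrightarrow>
      Comp C y x x f (Ident C x) = f"

locale k_functor = source: k_category K C + target: k_category K D
  for K :: "('k, 'r) ring_scheme" and C :: "('o, 'k, 'm) kcat" and D :: "('p, 'k, 'n) kcat"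
    and FO :: "'o \<Rightarrow> 'p" and FM :: "'o \<Rightarrow> 'o \<Rightarrow> 'm \<Rightarrow> 'n" +
  assumes FO_closed: "x \<in> Obj C \<Longrightarrow> FO x \<in> Obj D"
    and FM_linear: "\<lbrakk>x \<in> Obj C; y \<in> Obj C\<rbrakk> \<Longrightarrow>
      linear_map K (Mor C y x) (Mor D (FO y) (FO x)) (FM y x)"
    and FM_Comp: "\<lbrakk>x \<in> Obj C; y \<in> Obj C; z \<in> Obj C;
        g \<in> carrier (Mor C z y); f \<in> carrier (Mor C y x)\<rbrakk> \<Longrightarrow>
      FM z x (Comp C z y x g f) = Comp D (FO z) (FO y) (FO x) (FM z y g) (FM y x f)"
    and FM_Ident: "x \<in> Obj C \<Longrightarrow> FM x x (Ident C x) = Ident D (FO x)"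

definition isomorphic_k_categories ::
  "('k, 'r) ring_scheme \<Rightarrow> ('o, 'k, 'm) kcat \<Rightarrow> ('p, 'k, 'n) kcat \<Rightarrow> bool"
  where "isomorphic_k_categories K C D \<longleftrightarrow>
    (\<exists>FO FM IO IM. k_functor K C D FO FM \<and> k_functor K D C IO IM \<and>
      (\<forall>x\<in>Obj C. IO (FO x) = x) \<and>
      (\<forall>x\<in>Obj D. FO (IO x) = x) \<and>
      (\<forall>x\<in>Obj C. \<forall>y\<in>Obj C. \<forall>f\<in>carrier (Mor C y x). IM (FO y) (FO x) (FM y x f) = f) \<and>
      (\<forall>x\<in>Obj D. \<forall>y\<in>Obj D. \<forall>f\<in>carrier (Mor D y x). FM (IO y) (IO x) (IM y x f) = f))"


section \<open>Graded categories\<close>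

definition is_decomposition ::
  "('k, 'v, 'x) module_scheme \<Rightarrow> 'i set \<Rightarrow> ('i \<Rightarrow> 'v set) \<Rightarrow> 'v \<Rightarrow> ('i \<Rightarrow> 'v) \<Rightarrow> bool"
  where "is_decomposition V I N v c \<longleftrightarrow>
    c \<in> (\<Pi>\<^sub>E i\<in>I. N i) \<and> finite {i\<in>I. c i \<noteq> \<zero>\<^bsub>V\<^esub>} \<and>
    v = (\<Oplus>\<^bsub>V\<^esub>i\<in>{i\<in>I. c i \<noteq> \<zero>\<^bsub>V\<^esub>}. c i)"

definition internal_direct_sum ::
  "('k, 'r) ring_scheme \<Rightarrow> ('k, 'v, 'x) module_scheme \<Rightarrow> 'i set \<Rightarrow> ('i \<Rightarrow> 'v set) \<Rightarrow> bool"
  where "internal_direct_sum K V I N \<longleftrightarrow>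
    (\<forall>i\<in>I. submodule (N i) K V) \<and> (\<forall>v\<in>carrier V. \<exists>!c. is_decomposition V I N v c)"

definition projection ::
  "('k, 'v, 'x) module_scheme \<Rightarrow> 'i set \<Rightarrow> ('i \<Rightarrow> 'v set) \<Rightarrow> 'i \<Rightarrow> 'v \<Rightarrow> 'v"
  where "projection V I N i v = (THE c. is_decomposition V I N v c) i"

text \<open>\<open>E y x s\<close> is the homogeneous component of degree \<open>s\<close> of \<open>Mor B y x\<close>.\<close>

locale graded_k_category = k_category K B + group G
  for K (structure) and G (structure) and B :: "('o, 'k, 'm) kcat"
    and E :: "'o \<Rightarrow> 'o \<Rightarrow> 'g \<Rightarrow> 'm set" +
  assumes grading: "\<lbrakk>x \<in> Obj B; y \<in> Obj B\<rbrakk> \<Longrightarrow>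
      internal_direct_sum K (Mor B y x) (carrier G) (E y x)"
    and grading_Comp: "\<lbrakk>x \<in> Obj B; y \<in> Obj B; z \<in> Obj B; s \<in> carrier G; t \<in> carrier G;
        g \<in> E z y t; f \<in> E y x s\<rbrakk> \<Longrightarrow>
      Comp B z y x g f \<in> E z x (t \<otimes>\<^bsub>G\<^esub> s)"


section \<open>Module categories and smash categories\<close>

locale hopf_module_category = k_category K C + hopf_algebra K H
  for K (structure) and H :: "('k, 'h, 'z) hopf_scheme" (structure) and C :: "('o, 'k, 'm) kcat"
    and act :: "'o \<Rightarrow> 'o \<Rightarrow> 'h \<Rightarrow> 'm \<Rightarrow> 'm" +
  assumes act_bilinear: "\<lbrakk>x \<in> Obj C; y \<in> Obj C\<rbrakk> \<Longrightarrow>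
      bilinear_map K H (Mor C y x) (Mor C y x) (act y x)"
    and act_one: "\<lbrakk>x \<in> Obj C; y \<in> Obj C; f \<in> carrier (Mor C y x)\<rbrakk> \<Longrightarrow>
      act y x \<one>\<^bsub>H\<^esub> f = f"
    and act_mult: "\<lbrakk>x \<in> Obj C; y \<in> Obj C; h \<in> carrier H; h' \<in> carrier H;
        f \<in> carrier (Mor C y x)\<rbrakk> \<Longrightarrow>
      act y x (h \<otimes>\<^bsub>H\<^esub> h') f = act y x h (act y x h' f)"
    and act_Comp: "\<lbrakk>x \<in> Obj C; y \<in> Obj C; z \<in> Obj C; h \<in> carrier H;
        g \<in> carrier (Mor C z y); f \<in> carrier (Mor C y x)\<rbrakk> \<Longrightarrow>
      act z x h (Comp C z y x g f) =
      tensor_lift K (Mor C z x) (\<lambda>h\<^sub>1 h\<^sub>2. Comp C z y x (act z y h\<^sub>1 g) (act y x h\<^sub>2 f)) (comult H h)"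
    and act_Ident: "\<lbrakk>x \<in> Obj C; h \<in> carrier H\<rbrakk> \<Longrightarrow>
      act x x h (Ident C x) = counit H h \<odot>\<^bsub>Mor C x x\<^esub> Ident C x"

text \<open>
  On pure tensors the composition below is
  \<open>(\<phi> \<otimes> h)(\<psi> \<otimes> h') = \<Sum> \<phi> (h\<^sub>1 \<psi>) \<otimes> h\<^sub>2 h'\<close>.
\<close>

definition smash ::
  "('k, 'r) ring_scheme \<Rightarrow> ('k, 'h, 'z) hopf_scheme \<Rightarrow> ('o, 'k, 'm) kcat \<Rightarrow>
    ('o \<Rightarrow> 'o \<Rightarrow> 'h \<Rightarrow> 'm \<Rightarrow> 'm) \<Rightarrow> ('o, 'k, ('m \<times> 'h \<Rightarrow> 'k) set) kcat"
  where "smash K H C act = \<lparr>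
    Obj = Obj C,
    Mor = (\<lambda>y x. tensor_product K (Mor C y x) H),
    Comp = (\<lambda>z y x S T.
      let P = tensor_product K (Mor C z x) H in
      tensor_lift K P (\<lambda>\<phi> h. tensor_lift K P (\<lambda>\<psi> h'.
        tensor_lift K P (\<lambda>h\<^sub>1 h\<^sub>2.
          pure_tensor K (Mor C z x) H (Comp C z y x \<phi> (act y x h\<^sub>1 \<psi>)) (h\<^sub>2 \<otimes>\<^bsub>H\<^esub> h'))
        (comult H h)) T) S),
    Ident = (\<lambda>x. pure_tensor K (Mor C x x) H (Ident C x) \<one>\<^bsub>H\<^esub>)\<rparr>"

text \<open>The linear extension of \<open>\<delta>\<^sub>s f = f\<^sub>s\<close>, as \<open>a = \<Sum> a(s) \<delta>\<^sub>s\<close>.\<close>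

definition grading_action ::
  "('g, 's) monoid_scheme \<Rightarrow> ('o, 'k, 'm) kcat \<Rightarrow> ('o \<Rightarrow> 'o \<Rightarrow> 'g \<Rightarrow> 'm set) \<Rightarrow>
    'o \<Rightarrow> 'o \<Rightarrow> ('g \<Rightarrow> 'k) \<Rightarrow> 'm \<Rightarrow> 'm"
  where "grading_action G B E y x a f =
    (\<Oplus>\<^bsub>Mor B y x\<^esub>s\<in>carrier G. a s \<odot>\<^bsub>Mor B y x\<^esub> projection (Mor B y x) (carrier G) (E y x) s f)"

definition graded_smash ::
  "('k, 'r) ring_scheme \<Rightarrow> ('g, 's) monoid_scheme \<Rightarrow> ('o, 'k, 'm) kcat \<Rightarrow>
    ('o \<Rightarrow> 'o \<Rightarrow> 'g \<Rightarrow> 'm set) \<Rightarrow> ('o, 'k, ('m \<times> ('g \<Rightarrow> 'k) \<Rightarrow> 'k) set) kcat"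
  where "graded_smash K G B E = smash K (function_hopf K G) B (grading_action G B E)"

text \<open>The bilinear extension of \<open>t (f \<otimes> \<delta>\<^sub>s) = f \<otimes> \<delta>\<^sub>r\<close> with \<open>r = st\<^sup>-\<^sup>1\<close>.\<close>

definition translation_action ::
  "('k, 'r) ring_scheme \<Rightarrow> ('g, 's) monoid_scheme \<Rightarrow> ('o, 'k, 'm) kcat \<Rightarrow>
    'o \<Rightarrow> 'o \<Rightarrow> ('g \<Rightarrow> 'k) \<Rightarrow> ('m \<times> ('g \<Rightarrow> 'k) \<Rightarrow> 'k) set \<Rightarrow> ('m \<times> ('g \<Rightarrow> 'k) \<Rightarrow> 'k) set"
  where "translation_action K G B y x a T =
    (let H = function_hopf K G; P = tensor_product K (Mor B y x) H in
      \<Oplus>\<^bsub>P\<^esub>t\<in>carrier G. a t \<odot>\<^bsub>P\<^esub>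
        tensor_lift K P
          (\<lambda>f b. \<Oplus>\<^bsub>P\<^esub>s\<in>carrier G. b s \<odot>\<^bsub>P\<^esub>
            pure_tensor K (Mor B y x) H f (delta K G (s \<otimes>\<^bsub>G\<^esub> inv\<^bsub>G\<^esub> t)))
          T)"


section \<open>Matrix categories\<close>

definition matrix_category :: "nat \<Rightarrow> ('o, 'k, 'm) kcat \<Rightarrow> ('o, 'k, nat \<times> nat \<Rightarrow> 'm) kcat"
  where "matrix_category n B = (let I = {..<n} \<times> {..<n} in \<lparr>
    Obj = Obj B,
    Mor = (\<lambda>y x. \<lparr>
      carrier = I \<rightarrow>\<^sub>E carrier (Mor B y x),
      mult = undefined,
      one = undefined,
      zero = (\<lambda>p\<in>I. \<zero>\<^bsub>Mor B y x\<^esub>),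
      add = (\<lambda>M N. \<lambda>p\<in>I. M p \<oplus>\<^bsub>Mor B y x\<^esub> N p),
      smult = (\<lambda>a M. \<lambda>p\<in>I. a \<odot>\<^bsub>Mor B y x\<^esub> M p)\<rparr>),
    Comp = (\<lambda>z y x M N. \<lambda>p\<in>I. \<Oplus>\<^bsub>Mor B z x\<^esub>l\<in>{..<n}. Comp B z y x (M (fst p, l)) (N (l, snd p))),
    Ident = (\<lambda>x. \<lambda>p\<in>I. if fst p = snd p then Ident B x else \<zero>\<^bsub>Mor B x x\<^esub>)\<rparr>)"

end

theory Submission
  imports Defs
begin

text \<open>
  In \<open>(\<B> # k\<^sup>G) # kG\<close> one computes
  \<open>(f \<otimes> \<delta>\<^sub>s \<otimes> u)(g \<otimes> \<delta>\<^sub>t \<otimes> v) = f g\<^sub>w \<otimes> \<delta>\<^sub>r \<otimes> uv\<close> with \<open>w = sut\<^sup>-\<^sup>1\<close> and \<open>r = tu\<^sup>-\<^sup>1\<close>. If \<open>f\<close> and \<open>g\<close> are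
  homogeneous of degrees \<open>d\<close> and \<open>e\<close>, this is zero unless \<open>su = et\<close>, which is the rule for
  multiplying matrix units: \<open>f \<otimes> \<delta>\<^sub>s \<otimes> u\<close> corresponds to the matrix, with rows and columns
  indexed by \<open>G\<close>, whose only entry is \<open>f\<close> in row \<open>ds\<close> and column \<open>su\<close>. The triple
  \<open>(d, s, u)\<close> is recovered from \<open>d\<close>, \<open>ds\<close> and \<open>su\<close>, so this is a linear bijection on morphism
  spaces; the category axioms for the double smash category are transported along it.
\<close>

section \<open>Finite sums\<close>

context abelian_monoid
begin

lemma finsum_eq_single:
  assumes "finite A" "i \<in> A" "f i \<in> carrier G" "\<And>j. \<lbrakk>j \<in> A; j \<noteq> i\<rbrakk> \<Longrightarrow> f j = \<zero>"
  shows "finsum G f A = f i"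
proof -
  have "finsum G f A = (\<Oplus>j\<in>A. if i = j then f j else \<zero>)"
    using assms by (intro finsum_cong') auto
  also have "\<dots> = f i"
    using assms by (intro finsum_singleton) (auto dest: assms(4))
  finally show ?thesis .
qed

lemma finsum_swap:
  assumes "finite A" "finite B" "\<And>i j. \<lbrakk>i \<in> A; j \<in> B\<rbrakk> \<Longrightarrow> f i j \<in> carrier G"
  shows "(\<Oplus>i\<in>A. \<Oplus>j\<in>B. f i j) = (\<Oplus>j\<in>B. \<Oplus>i\<in>A. f i j)"
  using assms(1,3)
proof (induction A rule: finite_induct)
  case (insert i A)
  have "(\<Oplus>k\<in>insert i A. \<Oplus>j\<in>B. f k j) = (\<Oplus>j\<in>B. f i j) \<oplus> (\<Oplus>k\<in>A. \<Oplus>j\<in>B. f k j)"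
    using insert by (intro finsum_insert) (auto intro!: finsum_closed)
  also have "\<dots> = (\<Oplus>j\<in>B. f i j \<oplus> (\<Oplus>k\<in>A. f k j))"
    using insert by (subst finsum_addf) (auto intro!: finsum_closed)
  also have "\<dots> = (\<Oplus>j\<in>B. \<Oplus>k\<in>insert i A. f k j)"
    using insert by (intro finsum_cong' finsum_insert[symmetric]) (auto intro!: finsum_closed)
  finally show ?case .
qed simp

end

section \<open>Linear and bilinear maps\<close>

lemma linear_mapI:
  assumes "\<And>v. v \<in> carrier V \<Longrightarrow> f v \<in> carrier W"
    and "\<And>u v. \<lbrakk>u \<in> carrier V; v \<in> carrier V\<rbrakk> \<Longrightarrow> f (u \<oplus>\<^bsub>V\<^esub> v) = f u \<oplus>\<^bsub>W\<^esub> f v"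
    and "\<And>a v. \<lbrakk>a \<in> carrier K; v \<in> carrier V\<rbrakk> \<Longrightarrow> f (a \<odot>\<^bsub>V\<^esub> v) = a \<odot>\<^bsub>W\<^esub> f v"
  shows "linear_map K V W f"
  using assms by (simp add: linear_map_def Pi_def)

lemma
  assumes "linear_map K V W f"
  shows linear_map_closed: "v \<in> carrier V \<Longrightarrow> f v \<in> carrier W"
    and linear_map_add: "\<lbrakk>u \<in> carrier V; v \<in> carrier V\<rbrakk> \<Longrightarrow> f (u \<oplus>\<^bsub>V\<^esub> v) = f u \<oplus>\<^bsub>W\<^esub> f v"
    and linear_map_smult: "\<lbrakk>a \<in> carrier K; v \<in> carrier V\<rbrakk> \<Longrightarrow> f (a \<odot>\<^bsub>V\<^esub> v) = a \<odot>\<^bsub>W\<^esub> f v"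
  using assms by (auto simp: linear_map_def)

lemmas linear_mapD = linear_map_closed linear_map_add linear_map_smult

lemma linear_map_cong:
  assumes "module K V" and "\<And>v. v \<in> carrier V \<Longrightarrow> f v = g v"
  shows "linear_map K V W f \<longleftrightarrow> linear_map K V W g"
proof -
  interpret module K V by fact
  show ?thesis using assms(2) by (simp add: linear_map_def Pi_def)
qed

lemma linear_map_ident: "linear_map K V V (\<lambda>v. v)"
  by (rule linear_mapI) auto

lemma linear_map_compose:
  assumes "linear_map K U V f" and "linear_map K V W g"
  shows "linear_map K U W (\<lambda>u. g (f u))"
  using assms by (intro linear_mapI) (simp_all add: linear_mapD)

lemma linear_map_inv_into:
  assumes "module K V" and lin: "linear_map K V W f" and bij: "bij_betw f (carrier V) (carrier W)"
  shows "linear_map K W V (inv_into (carrier V) f)"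
proof -
  interpret V: module K V by fact
  let ?g = "inv_into (carrier V) f"
  have g: "?g w \<in> carrier V" "f (?g w) = w" if "w \<in> carrier W" for w
    using bij that by (auto simp: bij_betw_def inv_into_into f_inv_into_f)
  have g_eqI: "?g w = v" if "v \<in> carrier V" "f v = w" for v w
    using bij that by (auto simp: bij_betw_def inv_into_f_f)
  show ?thesis
    by (intro linear_mapI g_eqI) (auto simp: g linear_mapD[OF lin])
qed

context
  fixes K :: "('k, 'r) ring_scheme" and V :: "('k, 'v, 'x) module_scheme"
    and W :: "('k, 'w, 'y) module_scheme"
  assumes V: "module K V" and W: "module K W"
begin

interpretation V: module K V by (rule V)
interpretation W: module K W by (rule W)

lemma linear_map_zero:
  assumes "linear_map K V W f"
  shows "f \<zero>\<^bsub>V\<^esub> = \<zero>\<^bsub>W\<^esub>"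
proof -
  have "f (\<zero>\<^bsub>K\<^esub> \<odot>\<^bsub>V\<^esub> \<zero>\<^bsub>V\<^esub>) = \<zero>\<^bsub>K\<^esub> \<odot>\<^bsub>W\<^esub> f \<zero>\<^bsub>V\<^esub>"
    by (rule linear_map_smult[OF assms]) auto
  then show ?thesis
    using linear_map_closed[OF assms] by simp
qed

lemma linear_map_minus:
  assumes "linear_map K V W f" "u \<in> carrier V" "v \<in> carrier V"
  shows "f (u \<ominus>\<^bsub>V\<^esub> v) = f u \<ominus>\<^bsub>W\<^esub> f v"
proof -
  have "f (\<ominus>\<^bsub>V\<^esub> v) \<oplus>\<^bsub>W\<^esub> f v = \<zero>\<^bsub>W\<^esub>"
    using assms linear_map_add[OF assms(1), of "\<ominus>\<^bsub>V\<^esub> v" v]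
    by (simp add: V.l_neg linear_map_zero)
  then have "\<ominus>\<^bsub>W\<^esub> f v = f (\<ominus>\<^bsub>V\<^esub> v)"
    using assms by (intro W.minus_equality) (simp_all add: linear_mapD)
  then show ?thesis
    using assms by (simp add: a_minus_def linear_mapD)
qed

lemma linear_map_finsum:
  assumes "linear_map K V W f" "g \<in> A \<rightarrow> carrier V"
  shows "f (finsum V g A) = (\<Oplus>\<^bsub>W\<^esub>i\<in>A. f (g i))"
  using assms(2)
proof (induction A rule: infinite_finite_induct)
  case (insert i A)
  then have "g i \<in> carrier V" "g \<in> A \<rightarrow> carrier V" by auto
  moreover from this have "(\<lambda>i. f (g i)) \<in> A \<rightarrow> carrier W"
    using linear_map_closed[OF assms(1)] by auto
  ultimately show ?case
    using insert linear_mapD[OF assms(1)] by (simp add: Pi_def)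
qed (simp_all add: linear_map_zero[OF assms(1)])

lemma linear_map_eq_on_finsum:
  assumes "linear_map K V W f" "linear_map K V W f'" "g \<in> A \<rightarrow> carrier V"
    and "\<And>i. i \<in> A \<Longrightarrow> f (g i) = f' (g i)"
  shows "f (finsum V g A) = f' (finsum V g A)"
  using assms linear_map_closed[OF assms(2)]
  by (auto simp: linear_map_finsum intro!: W.finsum_cong')

end

context module
begin

lemma linear_map_finsumI:
  assumes "\<And>i. i \<in> A \<Longrightarrow> linear_map R V M (\<lambda>v. f v i)" and "finite A"
  shows "linear_map R V M (\<lambda>v. \<Oplus>\<^bsub>M\<^esub>i\<in>A. f v i)"
proof (rule linear_mapI)
  show "(\<Oplus>\<^bsub>M\<^esub>i\<in>A. f v i) \<in> carrier M" if "v \<in> carrier V" for v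
    using that linear_map_closed[OF assms(1)] by (intro finsum_closed) auto
  show "(\<Oplus>\<^bsub>M\<^esub>i\<in>A. f (u \<oplus>\<^bsub>V\<^esub> v) i) = (\<Oplus>\<^bsub>M\<^esub>i\<in>A. f u i) \<oplus>\<^bsub>M\<^esub> (\<Oplus>\<^bsub>M\<^esub>i\<in>A. f v i)"
    if "u \<in> carrier V" "v \<in> carrier V" for u v
  proof -
    have "(\<Oplus>\<^bsub>M\<^esub>i\<in>A. f (u \<oplus>\<^bsub>V\<^esub> v) i) = (\<Oplus>\<^bsub>M\<^esub>i\<in>A. f u i \<oplus>\<^bsub>M\<^esub> f v i)"
      using that linear_mapD[OF assms(1)] by (intro finsum_cong') auto
    also have "\<dots> = (\<Oplus>\<^bsub>M\<^esub>i\<in>A. f u i) \<oplus>\<^bsub>M\<^esub> (\<Oplus>\<^bsub>M\<^esub>i\<in>A. f v i)"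
      using that linear_map_closed[OF assms(1)] by (intro finsum_addf) auto
    finally show ?thesis .
  qed
  show "(\<Oplus>\<^bsub>M\<^esub>i\<in>A. f (a \<odot>\<^bsub>V\<^esub> v) i) = a \<odot>\<^bsub>M\<^esub> (\<Oplus>\<^bsub>M\<^esub>i\<in>A. f v i)"
    if "a \<in> carrier R" "v \<in> carrier V" for a v
  proof -
    have "(\<Oplus>\<^bsub>M\<^esub>i\<in>A. f (a \<odot>\<^bsub>V\<^esub> v) i) = (\<Oplus>\<^bsub>M\<^esub>i\<in>A. a \<odot>\<^bsub>M\<^esub> f v i)"
      using that linear_mapD[OF assms(1)] by (intro finsum_cong') auto
    also have "\<dots> = a \<odot>\<^bsub>M\<^esub> (\<Oplus>\<^bsub>M\<^esub>i\<in>A. f v i)"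
      using that linear_map_closed[OF assms(1)] assms(2)
      by (intro finsum_smult_ldistr[symmetric]) auto
    finally show ?thesis .
  qed
qed

lemma linear_map_smultI:
  assumes "linear_map R V M f" and "a \<in> carrier R"
  shows "linear_map R V M (\<lambda>v. a \<odot>\<^bsub>M\<^esub> f v)"
  using assms
  by (intro linear_mapI) (simp_all add: linear_mapD smult_r_distr smult_assoc1[symmetric] m_comm)

end

lemma bilinear_mapI:
  assumes "\<And>u. u \<in> carrier U \<Longrightarrow> linear_map K V W (b u)"
    and "\<And>v. v \<in> carrier V \<Longrightarrow> linear_map K U W (\<lambda>u. b u v)"
  shows "bilinear_map K U V W b"
  using assms by (simp add: bilinear_map_def)

lemma
  assumes "bilinear_map K U V W b"
  shows bilinear_map_linear_right: "u \<in> carrier U \<Longrightarrow> linear_map K V W (b u)"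
    and bilinear_map_linear_left: "v \<in> carrier V \<Longrightarrow> linear_map K U W (\<lambda>u. b u v)"
  using assms by (auto simp: bilinear_map_def)

lemma bilinear_map_flip: "bilinear_map K U V W b \<Longrightarrow> bilinear_map K V U W (\<lambda>v u. b u v)"
  by (auto simp: bilinear_map_def)

lemma bilinear_map_compose_right:
  assumes "bilinear_map K U V W b" "linear_map K V' V f"
  shows "bilinear_map K U V' W (\<lambda>u v. b u (f v))"
  using assms linear_map_compose[OF assms(2)] linear_map_closed[OF assms(2)]
  by (intro bilinear_mapI) (auto intro: bilinear_map_linear_left bilinear_map_linear_right)

lemma
  assumes "bilinear_map K U V W b" "u \<in> carrier U" "v \<in> carrier V"
  shows bilinear_map_closed: "b u v \<in> carrier W"
    and bilinear_map_smult_left: "a \<in> carrier K \<Longrightarrow> b (a \<odot>\<^bsub>U\<^esub> u) v = a \<odot>\<^bsub>W\<^esub> b u v"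
    and bilinear_map_smult_right: "a \<in> carrier K \<Longrightarrow> b u (a \<odot>\<^bsub>V\<^esub> v) = a \<odot>\<^bsub>W\<^esub> b u v"
    and bilinear_map_add_left: "u' \<in> carrier U \<Longrightarrow> b (u \<oplus>\<^bsub>U\<^esub> u') v = b u v \<oplus>\<^bsub>W\<^esub> b u' v"
    and bilinear_map_add_right: "v' \<in> carrier V \<Longrightarrow> b u (v \<oplus>\<^bsub>V\<^esub> v') = b u v \<oplus>\<^bsub>W\<^esub> b u v'"
  using linear_mapD[OF bilinear_map_linear_left[OF assms(1,3)]]
    linear_mapD[OF bilinear_map_linear_right[OF assms(1,2)]] assms(2,3) by auto

lemma
  assumes "module K U" "module K V" "module K W" "bilinear_map K U V W b"
  shows bilinear_map_zero_left: "v \<in> carrier V \<Longrightarrow> b \<zero>\<^bsub>U\<^esub> v = \<zero>\<^bsub>W\<^esub>"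
    and bilinear_map_zero_right: "u \<in> carrier U \<Longrightarrow> b u \<zero>\<^bsub>V\<^esub> = \<zero>\<^bsub>W\<^esub>"
  using linear_map_zero[OF assms(1,3) bilinear_map_linear_left[OF assms(4)]]
    linear_map_zero[OF assms(2,3) bilinear_map_linear_right[OF assms(4)]] by auto

section \<open>Constructions of modules\<close>

lemma module_surjective_image:
  assumes "module K V"
    and carrier: "carrier W = \<pi> ` carrier V"
    and add: "\<And>u v. \<lbrakk>u \<in> carrier V; v \<in> carrier V\<rbrakk> \<Longrightarrow> \<pi> u \<oplus>\<^bsub>W\<^esub> \<pi> v = \<pi> (u \<oplus>\<^bsub>V\<^esub> v)"
    and zero: "\<zero>\<^bsub>W\<^esub> = \<pi> \<zero>\<^bsub>V\<^esub>"
    and smult: "\<And>a v. \<lbrakk>a \<in> carrier K; v \<in> carrier V\<rbrakk> \<Longrightarrow> a \<odot>\<^bsub>W\<^esub> \<pi> v = \<pi> (a \<odot>\<^bsub>V\<^esub> v)"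
  shows "module K W"
proof -
  interpret V: module K V by fact
  have "abelian_group W"
  proof (rule abelian_groupI)
    fix w assume "w \<in> carrier W"
    then obtain v where v: "v \<in> carrier V" "w = \<pi> v" using carrier by auto
    then have "\<pi> (\<ominus>\<^bsub>V\<^esub> v) \<oplus>\<^bsub>W\<^esub> w = \<zero>\<^bsub>W\<^esub>" by (simp add: add zero V.l_neg)
    moreover have "\<pi> (\<ominus>\<^bsub>V\<^esub> v) \<in> carrier W" using v carrier by auto
    ultimately show "\<exists>w'\<in>carrier W. w' \<oplus>\<^bsub>W\<^esub> w = \<zero>\<^bsub>W\<^esub>" by blast
  qed (auto simp: carrier add zero V.a_ac)
  then show ?thesis
    by (intro moduleI)
      (auto simp: carrier add smult V.R.cring_axioms V.smult_l_distr V.smult_r_distr V.smult_assoc1)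
qed

definition regular_module :: "('k, 'r) ring_scheme \<Rightarrow> ('k, 'k) module"
  where "regular_module K = \<lparr>carrier = carrier K, mult = mult K, one = one K, zero = zero K,
    add = add K, smult = mult K\<rparr>"

lemma regular_module_simps [simp]:
  "carrier (regular_module K) = carrier K"
  "zero (regular_module K) = zero K"
  "add (regular_module K) = add K"
  "smult (regular_module K) = mult K"
  by (simp_all add: regular_module_def)

lemma regular_module_finsum: "finsum (regular_module K) = finsum K"
  by (simp add: fun_eq_iff finsum_def finprod_def)

lemma (in cring) regular_module: "module R (regular_module R)"
proof (rule moduleI)
  show "abelian_group (regular_module R)"
    by (rule abelian_groupI) (auto simp: a_ac intro: bexI[of _ "\<ominus> x" for x] l_neg)
qed (auto simp: cring_axioms l_distr r_distr m_assoc)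

lemma (in module) smult_scalar_linear:
  assumes "x \<in> carrier M"
  shows "linear_map R (regular_module R) M (\<lambda>a. a \<odot>\<^bsub>M\<^esub> x)"
  using assms by (intro linear_mapI) (simp_all add: smult_l_distr smult_assoc1)

locale pointwise_module = V: module K V
  for K :: "('k, 'r) ring_scheme" and V :: "('k, 'v, 'x) module_scheme" +
  fixes W :: "('k, 'i \<Rightarrow> 'v, 'y) module_scheme" and I :: "'i set"
  assumes apply_closed: "\<lbrakk>u \<in> carrier W; i \<in> I\<rbrakk> \<Longrightarrow> u i \<in> carrier V"
    and pointwise_eqI: "\<lbrakk>u \<in> carrier W; v \<in> carrier W; \<And>i. i \<in> I \<Longrightarrow> u i = v i\<rbrakk> \<Longrightarrow> u = v"
    and pointwise_zero_closed: "\<zero>\<^bsub>W\<^esub> \<in> carrier W"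
    and pointwise_add_closed: "\<lbrakk>u \<in> carrier W; v \<in> carrier W\<rbrakk> \<Longrightarrow> u \<oplus>\<^bsub>W\<^esub> v \<in> carrier W"
    and pointwise_smult_closed: "\<lbrakk>a \<in> carrier K; u \<in> carrier W\<rbrakk> \<Longrightarrow> a \<odot>\<^bsub>W\<^esub> u \<in> carrier W"
    and zero_apply: "i \<in> I \<Longrightarrow> \<zero>\<^bsub>W\<^esub> i = \<zero>\<^bsub>V\<^esub>"
    and add_apply: "\<lbrakk>u \<in> carrier W; v \<in> carrier W; i \<in> I\<rbrakk> \<Longrightarrow> (u \<oplus>\<^bsub>W\<^esub> v) i = u i \<oplus>\<^bsub>V\<^esub> v i"
    and smult_apply: "\<lbrakk>a \<in> carrier K; u \<in> carrier W; i \<in> I\<rbrakk> \<Longrightarrow> (a \<odot>\<^bsub>W\<^esub> u) i = a \<odot>\<^bsub>V\<^esub> u i"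
begin

lemmas pointwise_closed =
  apply_closed pointwise_zero_closed pointwise_add_closed pointwise_smult_closed
lemmas pointwise_apply = zero_apply add_apply smult_apply

lemma pointwise_module: "module K W"
proof -
  have "abelian_group W"
  proof (rule abelian_groupI)
    fix u assume u: "u \<in> carrier W"
    have "\<ominus>\<^bsub>K\<^esub> \<one>\<^bsub>K\<^esub> \<odot>\<^bsub>W\<^esub> u \<oplus>\<^bsub>W\<^esub> u = \<zero>\<^bsub>W\<^esub>"
      using u by (intro pointwise_eqI)
        (simp_all add: pointwise_closed pointwise_apply V.smult_l_minus V.l_neg)
    then show "\<exists>v\<in>carrier W. v \<oplus>\<^bsub>W\<^esub> u = \<zero>\<^bsub>W\<^esub>"
      using u by (intro bexI[of _ "\<ominus>\<^bsub>K\<^esub> \<one>\<^bsub>K\<^esub> \<odot>\<^bsub>W\<^esub> u"]) (simp_all add: pointwise_closed)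
  qed (auto simp: pointwise_closed pointwise_apply V.a_ac intro!: pointwise_eqI)
  then show ?thesis
    by (rule moduleI[OF V.R.cring_axioms])
      (auto simp: pointwise_closed pointwise_apply V.smult_l_distr V.smult_r_distr V.smult_assoc1
        intro!: pointwise_eqI)
qed

sublocale W: module K W by (rule pointwise_module)

lemma apply_linear: "i \<in> I \<Longrightarrow> linear_map K W V (\<lambda>u. u i)"
  by (rule linear_mapI) (simp_all add: pointwise_closed pointwise_apply)

lemma finsum_apply:
  assumes "\<And>j. j \<in> A \<Longrightarrow> f j \<in> carrier W" "i \<in> I"
  shows "(\<Oplus>\<^bsub>W\<^esub>j\<in>A. f j) i = (\<Oplus>\<^bsub>V\<^esub>j\<in>A. f j i)"
  using assms by (intro linear_map_finsum[OF pointwise_module V.module_axioms apply_linear]) auto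

lemma linear_map_pointwiseI:
  assumes "module K U" and closed: "\<And>u. u \<in> carrier U \<Longrightarrow> f u \<in> carrier W"
    and lin: "\<And>i. i \<in> I \<Longrightarrow> linear_map K U V (\<lambda>u. f u i)"
  shows "linear_map K U W f"
proof -
  interpret U: module K U by fact
  show ?thesis
    by (intro linear_mapI pointwise_eqI)
      (simp_all add: closed pointwise_closed pointwise_apply linear_mapD[OF lin])
qed

end

lemma basis_expansion:
  assumes "pointwise_module K (regular_module K) W I"
    and "finite A" "A \<subseteq> I" "u \<in> carrier W"
    and support: "\<And>i. \<lbrakk>i \<in> I; i \<notin> A\<rbrakk> \<Longrightarrow> u i = \<zero>\<^bsub>K\<^esub>"
    and basis_closed: "\<And>j. j \<in> A \<Longrightarrow> e j \<in> carrier W"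
    and basis_apply: "\<And>i j. \<lbrakk>i \<in> I; j \<in> A\<rbrakk> \<Longrightarrow> e j i = (if i = j then \<one>\<^bsub>K\<^esub> else \<zero>\<^bsub>K\<^esub>)"
  shows "(\<Oplus>\<^bsub>W\<^esub>j\<in>A. u j \<odot>\<^bsub>W\<^esub> e j) = u"
proof -
  interpret pointwise_module K "regular_module K" W I by fact
  have u: "u i \<in> carrier K" if "i \<in> I" for i
    using apply_closed[OF \<open>u \<in> carrier W\<close> that] by simp
  have term_closed: "u j \<odot>\<^bsub>W\<^esub> e j \<in> carrier W" if "j \<in> A" for j
    using that u basis_closed \<open>A \<subseteq> I\<close> by auto
  show ?thesis
  proof (rule pointwise_eqI)
    fix i assume i: "i \<in> I"
    have "(\<Oplus>\<^bsub>W\<^esub>j\<in>A. u j \<odot>\<^bsub>W\<^esub> e j) i = (\<Oplus>\<^bsub>K\<^esub>j\<in>A. (u j \<odot>\<^bsub>W\<^esub> e j) i)"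
      using finsum_apply[OF term_closed i] by (simp add: regular_module_finsum)
    also have "\<dots> = (\<Oplus>\<^bsub>K\<^esub>j\<in>A. if i = j then u j else \<zero>\<^bsub>K\<^esub>)"
      using i u \<open>A \<subseteq> I\<close>
      by (intro V.R.finsum_cong') (auto simp: smult_apply basis_closed basis_apply subset_iff)
    also have "\<dots> = u i"
    proof (cases "i \<in> A")
      case True
      then show ?thesis using u \<open>finite A\<close> \<open>A \<subseteq> I\<close> by (intro V.R.finsum_singleton) auto
    next
      case False
      then show ?thesis using i support by (subst V.R.add.finprod_one_eqI) auto
    qed
    finally show "(\<Oplus>\<^bsub>W\<^esub>j\<in>A. u j \<odot>\<^bsub>W\<^esub> e j) i = u i" .
  qed (use term_closed \<open>u \<in> carrier W\<close> in auto)
qed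

section \<open>Composition in \<open>k\<close>-categories\<close>

context k_category
begin

lemma Comp_closed:
  "\<lbrakk>x \<in> Obj C; y \<in> Obj C; z \<in> Obj C; g \<in> carrier (Mor C z y); f \<in> carrier (Mor C y x)\<rbrakk> \<Longrightarrow>
    Comp C z y x g f \<in> carrier (Mor C z x)"
  using bilinear_map_closed[OF Comp_bilinear] .

lemma Comp_finsum_left:
  assumes "x \<in> Obj C" "y \<in> Obj C" "z \<in> Obj C"
    and "g \<in> A \<rightarrow> carrier (Mor C z y)" "f \<in> carrier (Mor C y x)"
  shows "Comp C z y x (\<Oplus>\<^bsub>Mor C z y\<^esub>i\<in>A. g i) f = (\<Oplus>\<^bsub>Mor C z x\<^esub>i\<in>A. Comp C z y x (g i) f)"
  using assms by (intro linear_map_finsum[OF Mor_module Mor_module]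
      bilinear_map_linear_left[OF Comp_bilinear])

lemma Comp_finsum_right:
  assumes "x \<in> Obj C" "y \<in> Obj C" "z \<in> Obj C"
    and "g \<in> carrier (Mor C z y)" "f \<in> A \<rightarrow> carrier (Mor C y x)"
  shows "Comp C z y x g (\<Oplus>\<^bsub>Mor C y x\<^esub>i\<in>A. f i) = (\<Oplus>\<^bsub>Mor C z x\<^esub>i\<in>A. Comp C z y x g (f i))"
  using assms by (intro linear_map_finsum[OF Mor_module Mor_module]
      bilinear_map_linear_right[OF Comp_bilinear])

lemma
  assumes "x \<in> Obj C" "y \<in> Obj C" "z \<in> Obj C"
  shows Comp_zero_left: "f \<in> carrier (Mor C y x) \<Longrightarrow> Comp C z y x \<zero>\<^bsub>Mor C z y\<^esub> f = \<zero>\<^bsub>Mor C z x\<^esub>"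
    and Comp_zero_right: "g \<in> carrier (Mor C z y) \<Longrightarrow> Comp C z y x g \<zero>\<^bsub>Mor C y x\<^esub> = \<zero>\<^bsub>Mor C z x\<^esub>"
  using bilinear_map_zero_left[OF _ _ _ Comp_bilinear[OF assms]]
    bilinear_map_zero_right[OF _ _ _ Comp_bilinear[OF assms]]
    Mor_module[OF assms(2,3)] Mor_module[OF assms(1,2)] Mor_module[OF assms(1,3)]
  by auto

end

section \<open>Transport of a \<open>k\<close>-category structure\<close>

locale k_category_transport = D: k_category K D
  for K :: "('k, 'r) ring_scheme" and C :: "('o, 'k, 'm) kcat" and D :: "('o, 'k, 'n) kcat"
    and F :: "'o \<Rightarrow> 'o \<Rightarrow> 'm \<Rightarrow> 'n" +
  assumes Obj_eq: "Obj C = Obj D"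
    and Mor_module: "\<lbrakk>x \<in> Obj D; y \<in> Obj D\<rbrakk> \<Longrightarrow> module K (Mor C y x)"
    and F_linear: "\<lbrakk>x \<in> Obj D; y \<in> Obj D\<rbrakk> \<Longrightarrow> linear_map K (Mor C y x) (Mor D y x) (F y x)"
    and F_bij: "\<lbrakk>x \<in> Obj D; y \<in> Obj D\<rbrakk> \<Longrightarrow>
      bij_betw (F y x) (carrier (Mor C y x)) (carrier (Mor D y x))"
    and Comp_closed: "\<lbrakk>x \<in> Obj D; y \<in> Obj D; z \<in> Obj D;
        g \<in> carrier (Mor C z y); f \<in> carrier (Mor C y x)\<rbrakk> \<Longrightarrow> Comp C z y x g f \<in> carrier (Mor C z x)"
    and F_Comp: "\<lbrakk>x \<in> Obj D; y \<in> Obj D; z \<in> Obj D;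
        g \<in> carrier (Mor C z y); f \<in> carrier (Mor C y x)\<rbrakk> \<Longrightarrow>
      F z x (Comp C z y x g f) = Comp D z y x (F z y g) (F y x f)"
    and Ident_closed: "x \<in> Obj D \<Longrightarrow> Ident C x \<in> carrier (Mor C x x)"
    and F_Ident: "x \<in> Obj D \<Longrightarrow> F x x (Ident C x) = Ident D x"
begin

lemma F_closed:
  "\<lbrakk>x \<in> Obj D; y \<in> Obj D; f \<in> carrier (Mor C y x)\<rbrakk> \<Longrightarrow> F y x f \<in> carrier (Mor D y x)"
  using linear_map_closed[OF F_linear] .

lemma F_eqI:
  "\<lbrakk>x \<in> Obj D; y \<in> Obj D; f \<in> carrier (Mor C y x); g \<in> carrier (Mor C y x); F y x f = F y x g\<rbrakk> \<Longrightarrow>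
    f = g"
  using F_bij by (auto simp: bij_betw_def inj_on_def)

lemma source_Comp_bilinear:
  assumes obj: "x \<in> Obj D" "y \<in> Obj D" "z \<in> Obj D"
  shows "bilinear_map K (Mor C z y) (Mor C y x) (Mor C z x) (Comp C z y x)"
proof -
  interpret zx: module K "Mor C z x" by (intro Mor_module obj)
  interpret zy: module K "Mor C z y" by (intro Mor_module obj)
  interpret yx: module K "Mor C y x" by (intro Mor_module obj)
  note Comp = D.Comp_bilinear[OF obj]
  note F_linears = linear_map_add[OF F_linear] linear_map_smult[OF F_linear]
  show ?thesis
    by (intro bilinear_mapI linear_mapI F_eqI[OF obj(1,3)])
      (simp_all add: obj Comp_closed F_Comp F_closed F_linears
        bilinear_map_add_left[OF Comp] bilinear_map_add_right[OF Comp]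
        bilinear_map_smult_left[OF Comp] bilinear_map_smult_right[OF Comp])
qed

lemma source_k_category: "k_category K C"
proof (intro k_category.intro k_category_axioms.intro D.field_axioms; (simp only: Obj_eq)?)
  fix w x y z h g f
  assume "w \<in> Obj D" "x \<in> Obj D" "y \<in> Obj D" "z \<in> Obj D"
    "h \<in> carrier (Mor C z y)" "g \<in> carrier (Mor C y x)" "f \<in> carrier (Mor C x w)"
  then show "Comp C z x w (Comp C z y x h g) f = Comp C z y w h (Comp C y x w g f)"
    by (intro F_eqI[of w z]) (simp_all add: Comp_closed F_Comp F_closed D.Comp_assoc)
next
  fix x y f assume "x \<in> Obj D" "y \<in> Obj D" "f \<in> carrier (Mor C y x)"
  then show "Comp C y y x (Ident C y) f = f" "Comp C y x x f (Ident C x) = f"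
    by (intro F_eqI[of x y]; simp add: Comp_closed F_Comp F_closed F_Ident Ident_closed
        D.Ident_left D.Ident_right)+
qed (auto intro: Mor_module Ident_closed source_Comp_bilinear)

abbreviation F_inv where "F_inv y x \<equiv> inv_into (carrier (Mor C y x)) (F y x)"

lemma
  assumes "x \<in> Obj D" "y \<in> Obj D"
  shows F_inv_closed: "f \<in> carrier (Mor D y x) \<Longrightarrow> F_inv y x f \<in> carrier (Mor C y x)"
    and F_F_inv: "f \<in> carrier (Mor D y x) \<Longrightarrow> F y x (F_inv y x f) = f"
    and F_inv_F: "g \<in> carrier (Mor C y x) \<Longrightarrow> F_inv y x (F y x g) = g"
  using F_bij[OF assms] by (auto simp: bij_betw_def inv_into_into f_inv_into_f inv_into_f_f)

lemma F_functor: "k_functor K C D (\<lambda>x. x) F"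
  by (intro k_functor.intro k_functor_axioms.intro source_k_category D.k_category_axioms)
    (auto simp: Obj_eq F_linear F_Comp F_Ident)

lemma F_inv_functor: "k_functor K D C (\<lambda>x. x) F_inv"
proof (intro k_functor.intro k_functor_axioms.intro source_k_category D.k_category_axioms)
  fix x y z g f assume "x \<in> Obj D" "y \<in> Obj D" "z \<in> Obj D"
    "g \<in> carrier (Mor D z y)" "f \<in> carrier (Mor D y x)"
  then show "F_inv z x (Comp D z y x g f) = Comp C z y x (F_inv z y g) (F_inv y x f)"
    by (intro F_eqI[of x z]) (simp_all add: F_inv_closed F_F_inv Comp_closed F_Comp D.Comp_closed)
next
  fix x assume "x \<in> Obj D"
  then show "F_inv x x (Ident D x) = Ident C x"
    by (intro F_eqI[of x x])
      (simp_all add: F_inv_closed F_F_inv F_Ident Ident_closed D.Ident_closed)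
qed (auto simp: Obj_eq intro: linear_map_inv_into Mor_module F_linear F_bij)

lemma isomorphic: "isomorphic_k_categories K C D"
  unfolding isomorphic_k_categories_def
  using F_functor F_inv_functor F_inv_F F_F_inv Obj_eq
  by (intro exI[of _ "\<lambda>x. x"] exI[of _ F] exI[of _ F_inv]) simp

end

section \<open>Matrix categories\<close>

lemma matrix_category_simps:
  "Obj (matrix_category n B) = Obj B"
  "carrier (Mor (matrix_category n B) y x) = {..<n} \<times> {..<n} \<rightarrow>\<^sub>E carrier (Mor B y x)"
  "\<zero>\<^bsub>Mor (matrix_category n B) y x\<^esub> = (\<lambda>p\<in>{..<n} \<times> {..<n}. \<zero>\<^bsub>Mor B y x\<^esub>)"
  "add (Mor (matrix_category n B) y x) = (\<lambda>M N. \<lambda>p\<in>{..<n} \<times> {..<n}. M p \<oplus>\<^bsub>Mor B y x\<^esub> N p)"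
  "smult (Mor (matrix_category n B) y x) = (\<lambda>a M. \<lambda>p\<in>{..<n} \<times> {..<n}. a \<odot>\<^bsub>Mor B y x\<^esub> M p)"
  "Comp (matrix_category n B) z y x M N = (\<lambda>p\<in>{..<n} \<times> {..<n}.
    \<Oplus>\<^bsub>Mor B z x\<^esub>l\<in>{..<n}. Comp B z y x (M (fst p, l)) (N (l, snd p)))"
  "Ident (matrix_category n B) x =
    (\<lambda>p\<in>{..<n} \<times> {..<n}. if fst p = snd p then Ident B x else \<zero>\<^bsub>Mor B x x\<^esub>)"
  by (simp_all add: matrix_category_def Let_def)

lemma
  assumes "i < n" "j < n"
  shows matrix_entry_closed: "M \<in> carrier (Mor (matrix_category n B) y x) \<Longrightarrow>
      M (i, j) \<in> carrier (Mor B y x)"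
    and matrix_Comp_apply: "Comp (matrix_category n B) z y x M N (i, j) =
      (\<Oplus>\<^bsub>Mor B z x\<^esub>l\<in>{..<n}. Comp B z y x (M (i, l)) (N (l, j)))"
    and matrix_Ident_apply: "Ident (matrix_category n B) x (i, j) =
      (if i = j then Ident B x else \<zero>\<^bsub>Mor B x x\<^esub>)"
  using assms by (auto simp: matrix_category_simps)

lemma matrix_closedI:
  "(\<And>i j. \<lbrakk>i < n; j < n\<rbrakk> \<Longrightarrow> f (i, j) \<in> carrier (Mor B y x)) \<Longrightarrow>
    restrict f ({..<n} \<times> {..<n}) \<in> carrier (Mor (matrix_category n B) y x)"
  by (auto simp: matrix_category_simps)

lemma matrix_eqI:
  assumes "M \<in> carrier (Mor (matrix_category n B) y x)"
    and "N \<in> carrier (Mor (matrix_category n B) y x)"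
    and "\<And>i j. \<lbrakk>i < n; j < n\<rbrakk> \<Longrightarrow> M (i, j) = N (i, j)"
  shows "M = N"
  using assms unfolding matrix_category_simps by (intro PiE_ext) auto

context k_category
begin

abbreviation Mat where "Mat n \<equiv> matrix_category n C"

lemma matrix_pointwise:
  assumes "x \<in> Obj C" "y \<in> Obj C"
  shows "pointwise_module K (Mor C y x) (Mor (Mat n) y x) ({..<n} \<times> {..<n})"
proof -
  interpret module K "Mor C y x" by (intro Mor_module assms)
  show ?thesis
  proof (intro pointwise_module.intro pointwise_module_axioms.intro module_axioms)
    fix M N assume "M \<in> carrier (Mor (Mat n) y x)" "N \<in> carrier (Mor (Mat n) y x)"
      "\<And>p. p \<in> {..<n} \<times> {..<n} \<Longrightarrow> M p = N p"
    then show "M = N" by (intro matrix_eqI) auto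
  qed (auto simp: matrix_category_simps)
qed

lemma matrix_Mor_module: "\<lbrakk>x \<in> Obj C; y \<in> Obj C\<rbrakk> \<Longrightarrow> module K (Mor (Mat n) y x)"
  by (rule pointwise_module.pointwise_module[OF matrix_pointwise])

lemma matrix_Comp_closed:
  assumes "x \<in> Obj C" "y \<in> Obj C" "z \<in> Obj C"
    and "M \<in> carrier (Mor (Mat n) z y)" "N \<in> carrier (Mor (Mat n) y x)"
  shows "Comp (Mat n) z y x M N \<in> carrier (Mor (Mat n) z x)"
proof -
  interpret zx: module K "Mor C z x" by (intro Mor_module assms)
  show ?thesis
    unfolding matrix_category_simps(6) using assms
    by (intro matrix_closedI zx.finsum_closed) (auto simp: matrix_entry_closed intro!: Comp_closed)
qed

lemma matrix_Ident_closed: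
  assumes "x \<in> Obj C"
  shows "Ident (Mat n) x \<in> carrier (Mor (Mat n) x x)"
proof -
  interpret module K "Mor C x x" by (intro Mor_module assms)
  show ?thesis
    unfolding matrix_category_simps(7) by (intro matrix_closedI) (simp add: Ident_closed assms)
qed

lemma matrix_Comp_bilinear:
  assumes obj: "x \<in> Obj C" "y \<in> Obj C" "z \<in> Obj C"
  shows "bilinear_map K (Mor (Mat n) z y) (Mor (Mat n) y x) (Mor (Mat n) z x) (Comp (Mat n) z y x)"
proof (rule bilinear_mapI)
  interpret zx: module K "Mor C z x" by (intro Mor_module obj)
  note Comp = Comp_bilinear[OF obj]
  note zy_apply = pointwise_module.apply_linear[OF matrix_pointwise[OF obj(2,3)]]
  note yx_apply = pointwise_module.apply_linear[OF matrix_pointwise[OF obj(1,2)]]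
  show "linear_map K (Mor (Mat n) y x) (Mor (Mat n) z x) (Comp (Mat n) z y x M)"
    if M: "M \<in> carrier (Mor (Mat n) z y)" for M
  proof (rule pointwise_module.linear_map_pointwiseI[OF matrix_pointwise[OF obj(1,3)]
        matrix_Mor_module[OF obj(1,2)] matrix_Comp_closed[OF obj M]])
    fix p :: "nat \<times> nat" assume p: "p \<in> {..<n} \<times> {..<n}"
    then have "linear_map K (Mor (Mat n) y x) (Mor C z x)
        (\<lambda>N. \<Oplus>\<^bsub>Mor C z x\<^esub>l\<in>{..<n}. Comp C z y x (M (fst p, l)) (N (l, snd p)))"
      using M by (intro zx.linear_map_finsumI linear_map_compose[OF yx_apply
            bilinear_map_linear_right[OF Comp]]) (auto simp: matrix_entry_closed)
    then show "linear_map K (Mor (Mat n) y x) (Mor C z x) (\<lambda>N. Comp (Mat n) z y x M N p)"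
      using p by (cases p) (simp add: matrix_Comp_apply)
  qed
  show "linear_map K (Mor (Mat n) z y) (Mor (Mat n) z x) (\<lambda>M. Comp (Mat n) z y x M N)"
    if N: "N \<in> carrier (Mor (Mat n) y x)" for N
  proof (rule pointwise_module.linear_map_pointwiseI[OF matrix_pointwise[OF obj(1,3)]
        matrix_Mor_module[OF obj(2,3)] matrix_Comp_closed[OF obj _ N]])
    fix p :: "nat \<times> nat" assume p: "p \<in> {..<n} \<times> {..<n}"
    then have "linear_map K (Mor (Mat n) z y) (Mor C z x)
        (\<lambda>M. \<Oplus>\<^bsub>Mor C z x\<^esub>l\<in>{..<n}. Comp C z y x (M (fst p, l)) (N (l, snd p)))"
      using N by (intro zx.linear_map_finsumI linear_map_compose[OF zy_apply
            bilinear_map_linear_left[OF Comp]]) (auto simp: matrix_entry_closed)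
    then show "linear_map K (Mor (Mat n) z y) (Mor C z x) (\<lambda>M. Comp (Mat n) z y x M N p)"
      using p by (cases p) (simp add: matrix_Comp_apply)
  qed
qed

lemma matrix_Comp_assoc:
  assumes obj: "w \<in> Obj C" "x \<in> Obj C" "y \<in> Obj C" "z \<in> Obj C"
    and L: "L \<in> carrier (Mor (Mat n) z y)" and M: "M \<in> carrier (Mor (Mat n) y x)"
    and N: "N \<in> carrier (Mor (Mat n) x w)"
  shows "Comp (Mat n) z x w (Comp (Mat n) z y x L M) N =
    Comp (Mat n) z y w L (Comp (Mat n) y x w M N)"
proof (rule matrix_eqI[OF matrix_Comp_closed[OF obj(1,2,4) matrix_Comp_closed[OF obj(2-4) L M] N]
      matrix_Comp_closed[OF obj(1,3,4) L matrix_Comp_closed[OF obj(1-3) M N]]])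
  fix i j assume ij: "i < n" "j < n"
  interpret zw: module K "Mor C z w" by (intro Mor_module obj)
  note entries = matrix_entry_closed[OF _ _ L] matrix_entry_closed[OF _ _ M]
    matrix_entry_closed[OF _ _ N]
  let ?LMN = "\<lambda>k l. Comp C z x w (Comp C z y x (L (i, k)) (M (k, l))) (N (l, j))"
  have LMN: "?LMN k l \<in> carrier (Mor C z w)" if "k < n" "l < n" for k l
    using that ij obj by (intro Comp_closed) (simp_all add: entries)
  have "Comp (Mat n) z x w (Comp (Mat n) z y x L M) N (i, j) =
      (\<Oplus>\<^bsub>Mor C z w\<^esub>l\<in>{..<n}. \<Oplus>\<^bsub>Mor C z w\<^esub>k\<in>{..<n}. ?LMN k l)"
    unfolding matrix_Comp_apply[OF ij] using ij obj LMN
    by (intro zw.finsum_cong' refl)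
      (auto simp: matrix_Comp_apply Comp_finsum_left entries Comp_closed intro!: zw.finsum_closed)
  also have "\<dots> = (\<Oplus>\<^bsub>Mor C z w\<^esub>k\<in>{..<n}. \<Oplus>\<^bsub>Mor C z w\<^esub>l\<in>{..<n}. ?LMN k l)"
    using LMN by (intro zw.finsum_swap) auto
  also have "\<dots> = Comp (Mat n) z y w L (Comp (Mat n) y x w M N) (i, j)"
    unfolding matrix_Comp_apply[OF ij] using ij obj
    by (intro zw.finsum_cong' refl)
      (auto simp: matrix_Comp_apply Comp_finsum_right entries Comp_closed Comp_assoc
        intro!: zw.finsum_closed zw.finsum_cong')
  finally show "Comp (Mat n) z x w (Comp (Mat n) z y x L M) N (i, j) =
      Comp (Mat n) z y w L (Comp (Mat n) y x w M N) (i, j)" .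
qed

lemma matrix_Ident_left:
  assumes obj: "x \<in> Obj C" "y \<in> Obj C" and M: "M \<in> carrier (Mor (Mat n) y x)"
  shows "Comp (Mat n) y y x (Ident (Mat n) y) M = M"
proof (rule matrix_eqI[OF matrix_Comp_closed[OF obj(1,2,2) matrix_Ident_closed[OF obj(2)] M] M])
  interpret yx: module K "Mor C y x" by (intro Mor_module obj)
  fix i j assume ij: "i < n" "j < n"
  have "Comp (Mat n) y y x (Ident (Mat n) y) M (i, j) =
      Comp C y y x (Ident (Mat n) y (i, i)) (M (i, j))"
    unfolding matrix_Comp_apply[OF ij] using ij obj M
    by (intro yx.finsum_eq_single)
      (auto simp: matrix_Ident_apply matrix_entry_closed Comp_zero_left Ident_left)
  then show "Comp (Mat n) y y x (Ident (Mat n) y) M (i, j) = M (i, j)"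
    using ij obj M by (simp add: matrix_Ident_apply matrix_entry_closed Ident_left)
qed

lemma matrix_Ident_right:
  assumes obj: "x \<in> Obj C" "y \<in> Obj C" and M: "M \<in> carrier (Mor (Mat n) y x)"
  shows "Comp (Mat n) y x x M (Ident (Mat n) x) = M"
proof (rule matrix_eqI[OF matrix_Comp_closed[OF obj(1,1,2) M matrix_Ident_closed[OF obj(1)]] M])
  interpret yx: module K "Mor C y x" by (intro Mor_module obj)
  fix i j assume ij: "i < n" "j < n"
  have "Comp (Mat n) y x x M (Ident (Mat n) x) (i, j) =
      Comp C y x x (M (i, j)) (Ident (Mat n) x (j, j))"
    unfolding matrix_Comp_apply[OF ij] using ij obj M
    by (intro yx.finsum_eq_single)
      (auto simp: matrix_Ident_apply matrix_entry_closed Comp_zero_right Ident_right)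
  then show "Comp (Mat n) y x x M (Ident (Mat n) x) (i, j) = M (i, j)"
    using ij obj M by (simp add: matrix_Ident_apply matrix_entry_closed Ident_right)
qed

lemma matrix_k_category: "k_category K (Mat n)"
  by (intro k_category.intro k_category_axioms.intro field_axioms;
      simp only: matrix_category_simps(1))
    (intro matrix_Mor_module matrix_Comp_bilinear matrix_Comp_assoc matrix_Ident_closed
      matrix_Ident_left matrix_Ident_right; assumption)+

end

section \<open>Free modules and quotient modules\<close>

lemma free_module_simps [simp]:
  "\<zero>\<^bsub>free_module K X\<^esub> = (\<lambda>p. \<zero>\<^bsub>K\<^esub>)"
  "u \<oplus>\<^bsub>free_module K X\<^esub> v = (\<lambda>p. u p \<oplus>\<^bsub>K\<^esub> v p)"
  "a \<odot>\<^bsub>free_module K X\<^esub> u = (\<lambda>p. a \<otimes>\<^bsub>K\<^esub> u p)"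
  by (simp_all add: free_module_def)

lemma free_module_carrier:
  "u \<in> carrier (free_module K X) \<longleftrightarrow>
    (\<forall>p. u p \<in> carrier K) \<and> finite {p. u p \<noteq> \<zero>\<^bsub>K\<^esub>} \<and> {p. u p \<noteq> \<zero>\<^bsub>K\<^esub>} \<subseteq> X"
  by (auto simp: free_module_def)

definition free_lift ::
  "('k, 'r) ring_scheme \<Rightarrow> ('k, 'p, 'z) module_scheme \<Rightarrow> ('a \<Rightarrow> 'p) \<Rightarrow> ('a \<Rightarrow> 'k) \<Rightarrow> 'p"
  where "free_lift K P b u = (\<Oplus>\<^bsub>P\<^esub>p\<in>{p. u p \<noteq> \<zero>\<^bsub>K\<^esub>}. u p \<odot>\<^bsub>P\<^esub> b p)"

context cring
begin

lemma free_module_pointwise: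
  fixes X :: "'i set"
  shows "pointwise_module R (regular_module R) (free_module R X) UNIV"
proof -
  have support_add: "{p. u p \<oplus> v p \<noteq> \<zero>} \<subseteq> {p. u p \<noteq> \<zero>} \<union> {p. v p \<noteq> \<zero>}"
    for u v :: "'i \<Rightarrow> 'a" by auto
  have support_smult: "{p. a \<otimes> u p \<noteq> \<zero>} \<subseteq> {p. u p \<noteq> \<zero>}"
    if "a \<in> carrier R" for a and u :: "'i \<Rightarrow> 'a"
    using that by auto
  show ?thesis
  proof (intro pointwise_module.intro pointwise_module_axioms.intro regular_module)
    fix u v assume "u \<in> carrier (free_module R X)" "v \<in> carrier (free_module R X)"
    then show "u \<oplus>\<^bsub>free_module R X\<^esub> v \<in> carrier (free_module R X)"
      using finite_subset[OF support_add[of u v]] support_add[of u v]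
      unfolding free_module_carrier by auto
  next
    fix a u assume "a \<in> carrier R" "u \<in> carrier (free_module R X)"
    then show "a \<odot>\<^bsub>free_module R X\<^esub> u \<in> carrier (free_module R X)"
      using finite_subset[OF support_smult[of a u]] support_smult[of a u]
      unfolding free_module_carrier by auto
  qed (auto simp: free_module_carrier)
qed

lemma free_module: "module R (free_module R X)"
  using free_module_pointwise by (rule pointwise_module.pointwise_module)

lemma single_closed: "q \<in> X \<Longrightarrow> single R q \<in> carrier (free_module R X)"
  by (auto simp: free_module_carrier single_def)

lemma free_module_expansion:
  assumes "u \<in> carrier (free_module R X)"
  shows "(\<Oplus>\<^bsub>free_module R X\<^esub>p\<in>{p. u p \<noteq> \<zero>}. u p \<odot>\<^bsub>free_module R X\<^esub> single R p) = u"
  using assms single_closed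
  by (intro basis_expansion[OF free_module_pointwise]) (auto simp: free_module_carrier single_def)

end

context module
begin

lemma free_lift_superset:
  assumes "u \<in> carrier (free_module R X)" "finite A" "{p. u p \<noteq> \<zero>} \<subseteq> A"
    and "\<And>p. p \<in> A \<Longrightarrow> b p \<in> carrier M"
  shows "free_lift R M b u = (\<Oplus>\<^bsub>M\<^esub>p\<in>A. u p \<odot>\<^bsub>M\<^esub> b p)"
  unfolding free_lift_def using assms
  by (intro add.finprod_mono_neutral_cong_left) (auto simp: free_module_carrier)

lemma free_lift_add:
  assumes b: "\<And>p. p \<in> X \<Longrightarrow> b p \<in> carrier M"
    and u: "u \<in> carrier (free_module R X)" and v: "v \<in> carrier (free_module R X)"
  shows "free_lift R M b (u \<oplus>\<^bsub>free_module R X\<^esub> v) = free_lift R M b u \<oplus>\<^bsub>M\<^esub> free_lift R M b v"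
proof -
  interpret F: module R "free_module R X" by (rule free_module)
  let ?A = "{p. u p \<noteq> \<zero>} \<union> {p. v p \<noteq> \<zero>}"
  have A: "finite ?A" "?A \<subseteq> X" using u v by (auto simp: free_module_carrier)
  have value_closed: "u p \<in> carrier R" "v p \<in> carrier R" for p
    using u v by (simp_all add: free_module_carrier)
  have bA: "b p \<in> carrier M" if "p \<in> ?A" for p using that A b by blast
  note lift = free_lift_superset[OF _ A(1) _ bA]
  have "free_lift R M b (u \<oplus>\<^bsub>free_module R X\<^esub> v) = (\<Oplus>\<^bsub>M\<^esub>p\<in>?A. (u p \<oplus> v p) \<odot>\<^bsub>M\<^esub> b p)"
    using F.a_closed[OF u v] by (subst lift) auto
  also have "\<dots> = (\<Oplus>\<^bsub>M\<^esub>p\<in>?A. u p \<odot>\<^bsub>M\<^esub> b p \<oplus>\<^bsub>M\<^esub> v p \<odot>\<^bsub>M\<^esub> b p)"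
    using value_closed bA by (intro finsum_cong') (auto simp: smult_l_distr)
  also have "\<dots> = (\<Oplus>\<^bsub>M\<^esub>p\<in>?A. u p \<odot>\<^bsub>M\<^esub> b p) \<oplus>\<^bsub>M\<^esub> (\<Oplus>\<^bsub>M\<^esub>p\<in>?A. v p \<odot>\<^bsub>M\<^esub> b p)"
    using value_closed bA by (intro finsum_addf) auto
  also have "\<dots> = free_lift R M b u \<oplus>\<^bsub>M\<^esub> free_lift R M b v"
    using lift[OF u] lift[OF v] by auto
  finally show ?thesis .
qed

lemma free_lift_smult:
  assumes b: "\<And>p. p \<in> X \<Longrightarrow> b p \<in> carrier M"
    and a: "a \<in> carrier R" and u: "u \<in> carrier (free_module R X)"
  shows "free_lift R M b (a \<odot>\<^bsub>free_module R X\<^esub> u) = a \<odot>\<^bsub>M\<^esub> free_lift R M b u"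
proof -
  interpret F: module R "free_module R X" by (rule free_module)
  let ?A = "{p. u p \<noteq> \<zero>}"
  have A: "finite ?A" and value_closed: "\<And>p. u p \<in> carrier R"
    using u by (simp_all add: free_module_carrier)
  have bA: "b p \<in> carrier M" if "p \<in> ?A" for p
    using that u b by (auto simp: free_module_carrier)
  have "free_lift R M b (a \<odot>\<^bsub>free_module R X\<^esub> u) = (\<Oplus>\<^bsub>M\<^esub>p\<in>?A. (a \<otimes> u p) \<odot>\<^bsub>M\<^esub> b p)"
    using F.smult_closed[OF a u] A bA a by (subst free_lift_superset[of _ X ?A]) auto
  also have "\<dots> = (\<Oplus>\<^bsub>M\<^esub>p\<in>?A. a \<odot>\<^bsub>M\<^esub> (u p \<odot>\<^bsub>M\<^esub> b p))"
    using a value_closed bA by (intro finsum_cong') (auto simp: smult_assoc1)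
  also have "\<dots> = a \<odot>\<^bsub>M\<^esub> free_lift R M b u"
    unfolding free_lift_def using a A value_closed bA by (intro finsum_smult_ldistr[symmetric]) auto
  finally show ?thesis .
qed

lemma free_lift_linear:
  assumes "\<And>p. p \<in> X \<Longrightarrow> b p \<in> carrier M"
  shows "linear_map R (free_module R X) M (free_lift R M b)"
proof (rule linear_mapI)
  show "free_lift R M b u \<in> carrier M" if "u \<in> carrier (free_module R X)" for u
    unfolding free_lift_def using that assms
    by (intro finsum_closed) (auto simp: free_module_carrier)
qed (intro free_lift_add free_lift_smult assms; assumption)+

lemma free_lift_single:
  assumes "b p \<in> carrier M"
  shows "free_lift R M b (single R p) = b p"
proof -
  have "free_lift R M b (single R p) = (\<Oplus>\<^bsub>M\<^esub>q\<in>{p}. single R p q \<odot>\<^bsub>M\<^esub> b q)"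
    using assms single_closed[of p UNIV] by (intro free_lift_superset) (auto simp: single_def)
  also have "\<dots> = b p"
    using assms by (simp add: single_def)
  finally show ?thesis .
qed

end

locale module_quotient = V: module K V
  for K :: "('k, 'r) ring_scheme" and V :: "('k, 'v, 'x) module_scheme" +
  fixes N :: "'v set"
  assumes N_submodule: "submodule N K V"
begin

sublocale N: abelian_subgroup N V
  using N_submodule
  by (intro abelian_subgroupI3 additive_subgroupI)
    (auto dest: submodule.axioms intro: V.abelian_group_axioms)

lemma quotient_carrier: "carrier (quotient_module K V N) = (\<lambda>u. N +>\<^bsub>V\<^esub> u) ` carrier V"
  by (auto simp: quotient_module_def A_RCOSETS_def' a_r_coset_def')

lemma coset_add:
  "\<lbrakk>u \<in> carrier V; v \<in> carrier V\<rbrakk> \<Longrightarrow>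
    (N +>\<^bsub>V\<^esub> u) \<oplus>\<^bsub>quotient_module K V N\<^esub> (N +>\<^bsub>V\<^esub> v) = N +>\<^bsub>V\<^esub> (u \<oplus>\<^bsub>V\<^esub> v)"
  using N.a_rcos_sum by (simp add: quotient_module_def)

lemma coset_eqI:
  assumes "u \<in> carrier V" "v \<in> carrier V" "u \<ominus>\<^bsub>V\<^esub> v \<in> N"
  shows "N +>\<^bsub>V\<^esub> u = N +>\<^bsub>V\<^esub> v"
  using N.a_rcos_module_rev[of v u] N.a_repr_independence'[of u v] assms
  by (simp add: a_minus_def)

lemma coset_smult:
  assumes a: "a \<in> carrier K" and v: "v \<in> carrier V"
  shows "a \<odot>\<^bsub>quotient_module K V N\<^esub> (N +>\<^bsub>V\<^esub> v) = N +>\<^bsub>V\<^esub> (a \<odot>\<^bsub>V\<^esub> v)"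
proof -
  have "N +>\<^bsub>V\<^esub> (a \<odot>\<^bsub>V\<^esub> u) = N +>\<^bsub>V\<^esub> (a \<odot>\<^bsub>V\<^esub> v)" if u: "u \<in> N +>\<^bsub>V\<^esub> v" for u
  proof (rule coset_eqI)
    have u_closed: "u \<in> carrier V"
      using N.a_elemrcos_carrier[OF v u] .
    show "a \<odot>\<^bsub>V\<^esub> u \<in> carrier V" "a \<odot>\<^bsub>V\<^esub> v \<in> carrier V"
      using a u_closed v by auto
    have "a \<odot>\<^bsub>V\<^esub> u \<ominus>\<^bsub>V\<^esub> a \<odot>\<^bsub>V\<^esub> v = a \<odot>\<^bsub>V\<^esub> (u \<oplus>\<^bsub>V\<^esub> \<ominus>\<^bsub>V\<^esub> v)"
      using a u_closed v by (simp add: a_minus_def V.smult_r_distr V.smult_r_minus)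
    also have "\<dots> \<in> N"
      using V.submoduleE(4)[OF N_submodule a] N.a_rcos_module_imp[OF v u] by blast
    finally show "a \<odot>\<^bsub>V\<^esub> u \<ominus>\<^bsub>V\<^esub> a \<odot>\<^bsub>V\<^esub> v \<in> N" .
  qed
  moreover have "v \<in> N +>\<^bsub>V\<^esub> v" using N.a_rcos_self[OF v] .
  ultimately have "(\<Union>u\<in>N +>\<^bsub>V\<^esub> v. N +>\<^bsub>V\<^esub> (a \<odot>\<^bsub>V\<^esub> u)) = N +>\<^bsub>V\<^esub> (a \<odot>\<^bsub>V\<^esub> v)" by blast
  then show ?thesis
    by (simp add: quotient_module_def)
qed

lemma quotient_module: "module K (quotient_module K V N)"
proof (rule module_surjective_image[OF V.module_axioms quotient_carrier])
  have "N +>\<^bsub>V\<^esub> \<zero>\<^bsub>V\<^esub> = N" using N.zero_closed by (rule N.a_rcos_const)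
  then show "\<zero>\<^bsub>quotient_module K V N\<^esub> = N +>\<^bsub>V\<^esub> \<zero>\<^bsub>V\<^esub>"
    by (simp add: quotient_module_def)
qed (simp_all add: coset_add coset_smult)

lemma coset_linear: "linear_map K V (quotient_module K V N) (\<lambda>u. N +>\<^bsub>V\<^esub> u)"
  by (rule linear_mapI) (simp_all add: quotient_carrier coset_add coset_smult)

lemma linear_map_constant_on_coset:
  assumes P: "module K P" and L: "linear_map K V P L" and kernel: "\<And>w. w \<in> N \<Longrightarrow> L w = \<zero>\<^bsub>P\<^esub>"
    and u: "u \<in> carrier V" and v: "v \<in> N +>\<^bsub>V\<^esub> u"
  shows "L v = L u"
proof -
  interpret P: module K P by (rule P)
  have v_closed: "v \<in> carrier V" by (rule N.a_elemrcos_carrier[OF u v])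
  have "v \<ominus>\<^bsub>V\<^esub> u \<in> N"
    using N.a_rcos_module_imp[OF u v] by (simp add: a_minus_def)
  then have "L v \<ominus>\<^bsub>P\<^esub> L u = \<zero>\<^bsub>P\<^esub>"
    using linear_map_minus[OF V.module_axioms P L v_closed u] kernel by simp
  then show ?thesis
    using linear_map_closed[OF L] u v_closed P.add.inv_solve_right[of "\<zero>\<^bsub>P\<^esub>" "L v" "L u"]
    by (simp add: a_minus_def)
qed

end

lemma (in module) linear_map_kernel_submodule:
  assumes P: "module R P" and L: "linear_map R M P L"
  shows "submodule {v \<in> carrier M. L v = \<zero>\<^bsub>P\<^esub>} R M"
proof (rule submoduleI)
  interpret P: module R P by (rule P)
  have zero: "L \<zero>\<^bsub>M\<^esub> = \<zero>\<^bsub>P\<^esub>" by (rule linear_map_zero[OF module_axioms P L])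
  then show "\<zero>\<^bsub>M\<^esub> \<in> {v \<in> carrier M. L v = \<zero>\<^bsub>P\<^esub>}" by simp
  show "\<ominus>\<^bsub>M\<^esub> v \<in> {v \<in> carrier M. L v = \<zero>\<^bsub>P\<^esub>}" if "v \<in> {v \<in> carrier M. L v = \<zero>\<^bsub>P\<^esub>}" for v
    using that zero linear_map_minus[OF module_axioms P L, of "\<zero>\<^bsub>M\<^esub>" v]
    by (simp add: a_minus_def)
  show "u \<oplus>\<^bsub>M\<^esub> v \<in> {v \<in> carrier M. L v = \<zero>\<^bsub>P\<^esub>}"
    if "u \<in> {v \<in> carrier M. L v = \<zero>\<^bsub>P\<^esub>}" "v \<in> {v \<in> carrier M. L v = \<zero>\<^bsub>P\<^esub>}" for u v
    using that by (simp add: linear_map_add[OF L])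
  show "a \<odot>\<^bsub>M\<^esub> v \<in> {v \<in> carrier M. L v = \<zero>\<^bsub>P\<^esub>}"
    if "a \<in> carrier R" "v \<in> {v \<in> carrier M. L v = \<zero>\<^bsub>P\<^esub>}" for a v
    using that by (simp add: linear_map_smult[OF L])
qed simp

section \<open>Tensor products\<close>

type_synonym ('v, 'w, 'k) tensor = "('v \<times> 'w \<Rightarrow> 'k) set"

locale tensor_pair = V: module K V + W: module K W
  for K :: "('k, 'r) ring_scheme" and V :: "('k, 'v, 'x) module_scheme"
    and W :: "('k, 'w, 'y) module_scheme"
begin

abbreviation free_pairs where "free_pairs \<equiv> free_module K (carrier V \<times> carrier W)"
abbreviation relations where "relations \<equiv> tensor_relations K V W"
abbreviation tensor_space where "tensor_space \<equiv> tensor_product K V W"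
abbreviation tensor (infixl \<open>\<otimes>\<^sub>t\<close> 72) where "v \<otimes>\<^sub>t w \<equiv> pure_tensor K V W v w"

sublocale free_pairs: module K free_pairs
  by (rule V.free_module)

lemma tensor_generators_subset: "tensor_generators K V W \<subseteq> carrier free_pairs"
  unfolding tensor_generators_def Let_def
  by (auto intro!: V.single_closed free_pairs.minus_closed free_pairs.smult_closed
      free_pairs.a_closed simp del: free_module_simps)

lemma relations_submodule: "submodule relations K free_pairs"
proof (rule free_pairs.submoduleI)
  have "submodule (carrier free_pairs) K free_pairs"
    by (rule free_pairs.carrier_is_submodule)
  then show "relations \<subseteq> carrier free_pairs"
    using tensor_generators_subset unfolding tensor_relations_def by blast
  show "\<zero>\<^bsub>free_pairs\<^esub> \<in> relations" unfolding tensor_relations_def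
    using subgroup.one_closed[OF submodule.axioms(1)] by fastforce
  show "\<ominus>\<^bsub>free_pairs\<^esub> u \<in> relations" if "u \<in> relations" for u
    using that free_pairs.submoduleE(3) unfolding tensor_relations_def by blast
  show "u \<oplus>\<^bsub>free_pairs\<^esub> v \<in> relations" if "u \<in> relations" "v \<in> relations" for u v
    using that free_pairs.submoduleE(5) unfolding tensor_relations_def by blast
  show "a \<odot>\<^bsub>free_pairs\<^esub> u \<in> relations" if "a \<in> carrier K" "u \<in> relations" for a u
    using that free_pairs.submoduleE(4) unfolding tensor_relations_def by blast
qed

lemma tensor_generators_subset_relations: "tensor_generators K V W \<subseteq> relations"
  unfolding tensor_relations_def by blast

lemma tensor_relations_least:
  "\<lbrakk>submodule N K free_pairs; tensor_generators K V W \<subseteq> N\<rbrakk> \<Longrightarrow> relations \<subseteq> N"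
  unfolding tensor_relations_def by blast

sublocale quotient: module_quotient K free_pairs relations
  rewrites "quotient_module K free_pairs relations = tensor_space"
  by (intro module_quotient.intro module_quotient_axioms.intro relations_submodule
      free_pairs.module_axioms) (simp add: tensor_product_def)

lemma tensor_module: "module K tensor_space"
  by (rule quotient.quotient_module)

sublocale tensor_space: module K tensor_space
  by (rule tensor_module)

lemma pure_tensor_closed: "\<lbrakk>v \<in> carrier V; w \<in> carrier W\<rbrakk> \<Longrightarrow> v \<otimes>\<^sub>t w \<in> carrier tensor_space"
  unfolding pure_tensor_def
  by (intro linear_map_closed[OF quotient.coset_linear] V.single_closed) simp

lemma pure_tensor_bilinear: "bilinear_map K V W tensor_space (\<otimes>\<^sub>t)"
proof -
  note [simp del] = free_module_simps
  note [simp] = V.single_closed quotient.coset_add quotient.coset_smult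
  note relation =
    subsetD[OF tensor_generators_subset_relations, unfolded tensor_generators_def Let_def]
  show ?thesis
  proof (intro bilinear_mapI linear_mapI)
    fix v w w' assume "v \<in> carrier V" "w \<in> carrier W" "w' \<in> carrier W"
    then show "v \<otimes>\<^sub>t (w \<oplus>\<^bsub>W\<^esub> w') = v \<otimes>\<^sub>t w \<oplus>\<^bsub>tensor_space\<^esub> v \<otimes>\<^sub>t w'"
      unfolding pure_tensor_def by (simp, intro quotient.coset_eqI relation) (simp_all, blast)
  next
    fix v v' w assume "v \<in> carrier V" "v' \<in> carrier V" "w \<in> carrier W"
    then show "(v \<oplus>\<^bsub>V\<^esub> v') \<otimes>\<^sub>t w = v \<otimes>\<^sub>t w \<oplus>\<^bsub>tensor_space\<^esub> v' \<otimes>\<^sub>t w"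
      unfolding pure_tensor_def by (simp, intro quotient.coset_eqI relation) (simp_all, blast)
  next
    fix a v w assume "v \<in> carrier V" "a \<in> carrier K" "w \<in> carrier W"
    then show "v \<otimes>\<^sub>t (a \<odot>\<^bsub>W\<^esub> w) = a \<odot>\<^bsub>tensor_space\<^esub> (v \<otimes>\<^sub>t w)"
      unfolding pure_tensor_def by (simp, intro quotient.coset_eqI relation) (simp_all, blast)
  next
    fix a v w assume "v \<in> carrier V" "a \<in> carrier K" "w \<in> carrier W"
    then show "(a \<odot>\<^bsub>V\<^esub> v) \<otimes>\<^sub>t w = a \<odot>\<^bsub>tensor_space\<^esub> (v \<otimes>\<^sub>t w)"
      unfolding pure_tensor_def by (simp, intro quotient.coset_eqI relation) (simp_all, blast)
  qed (simp_all add: pure_tensor_closed)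
qed

lemma linear_map_eq_on_pure:
  assumes P: "module K P"
    and f: "linear_map K tensor_space P f" and g: "linear_map K tensor_space P g"
    and t: "t \<in> carrier tensor_space"
    and pure: "\<And>v w. \<lbrakk>v \<in> carrier V; w \<in> carrier W\<rbrakk> \<Longrightarrow> f (v \<otimes>\<^sub>t w) = g (v \<otimes>\<^sub>t w)"
  shows "f t = g t"
proof -
  note [simp del] = free_module_simps
  obtain u where u: "u \<in> carrier free_pairs" "t = relations +>\<^bsub>free_pairs\<^esub> u"
    using t by (auto simp: quotient.quotient_carrier)
  let ?S = "{p. u p \<noteq> \<zero>\<^bsub>K\<^esub>}"
  have S: "u p \<in> carrier K" "p \<in> carrier V \<times> carrier W" "single K p \<in> carrier free_pairs"
    if "p \<in> ?S" for p
    using u(1) that V.single_closed[of p] by (auto simp: free_module_carrier)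
  note coset_lift = linear_map_compose[OF quotient.coset_linear]
  have "f (relations +>\<^bsub>free_pairs\<^esub> (\<Oplus>\<^bsub>free_pairs\<^esub>p\<in>?S. u p \<odot>\<^bsub>free_pairs\<^esub> single K p)) =
      g (relations +>\<^bsub>free_pairs\<^esub> (\<Oplus>\<^bsub>free_pairs\<^esub>p\<in>?S. u p \<odot>\<^bsub>free_pairs\<^esub> single K p))"
  proof (rule linear_map_eq_on_finsum[OF free_pairs.module_axioms P
        coset_lift[OF f] coset_lift[OF g]])
    fix p assume "p \<in> ?S"
    moreover from this obtain v w where "p = (v, w)" "v \<in> carrier V" "w \<in> carrier W"
      using S by blast
    ultimately show "f (relations +>\<^bsub>free_pairs\<^esub> (u p \<odot>\<^bsub>free_pairs\<^esub> single K p)) =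
        g (relations +>\<^bsub>free_pairs\<^esub> (u p \<odot>\<^bsub>free_pairs\<^esub> single K p))"
      using S pure
      by (simp add: linear_map_smult[OF coset_lift[OF f]] linear_map_smult[OF coset_lift[OF g]]
          pure_tensor_def)
  qed (use S in auto)
  then show ?thesis
    unfolding V.free_module_expansion[OF u(1)] u(2) .
qed

context
  fixes P :: "('k, 'p, 'z) module_scheme" and b :: "'v \<Rightarrow> 'w \<Rightarrow> 'p"
  assumes P: "module K P" and b: "bilinear_map K V W P b"
begin

interpretation P: module K P by (rule P)

abbreviation (input) pair_lift where "pair_lift \<equiv> free_lift K P (\<lambda>p. b (fst p) (snd p))"

lemma free_pairs_lift_linear: "linear_map K free_pairs P pair_lift"
  using bilinear_map_closed[OF b] by (intro P.free_lift_linear) auto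

lemma free_pairs_lift_single:
  "\<lbrakk>v \<in> carrier V; w \<in> carrier W\<rbrakk> \<Longrightarrow> pair_lift (single K (v, w)) = b v w"
  using P.free_lift_single[of "\<lambda>p. b (fst p) (snd p)"] bilinear_map_closed[OF b] by simp

lemma free_pairs_lift_relations: "r \<in> relations \<Longrightarrow> pair_lift r = \<zero>\<^bsub>P\<^esub>"
proof -
  note [simp del] = free_module_simps
  have "tensor_generators K V W \<subseteq> {u \<in> carrier free_pairs. pair_lift u = \<zero>\<^bsub>P\<^esub>}"
    using tensor_generators_subset unfolding tensor_generators_def Let_def
    by (auto simp: linear_map_minus[OF free_pairs.module_axioms P free_pairs_lift_linear]
        linear_mapD[OF free_pairs_lift_linear] free_pairs_lift_single V.single_closed
        bilinear_map_closed[OF b] bilinear_map_add_left[OF b] bilinear_map_add_right[OF b]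
        bilinear_map_smult_left[OF b] bilinear_map_smult_right[OF b] P.r_neg a_minus_def[of P])
  then have "relations \<subseteq> {u \<in> carrier free_pairs. pair_lift u = \<zero>\<^bsub>P\<^esub>}"
    by (intro tensor_relations_least free_pairs.linear_map_kernel_submodule P
        free_pairs_lift_linear)
  then show "pair_lift r = \<zero>\<^bsub>P\<^esub>" if "r \<in> relations" using that by blast
qed

lemma tensor_lift_coset:
  assumes "u \<in> carrier free_pairs"
  shows "tensor_lift K P b (relations +>\<^bsub>free_pairs\<^esub> u) = pair_lift u"
proof -
  have "(SOME v. v \<in> relations +>\<^bsub>free_pairs\<^esub> u) \<in> relations +>\<^bsub>free_pairs\<^esub> u"
    using someI[of "\<lambda>v. v \<in> relations +>\<^bsub>free_pairs\<^esub> u", OF quotient.N.a_rcos_self[OF assms]] .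
  then have "pair_lift (SOME v. v \<in> relations +>\<^bsub>free_pairs\<^esub> u) = pair_lift u"
    by (intro quotient.linear_map_constant_on_coset[OF P free_pairs_lift_linear] assms
        free_pairs_lift_relations)
  then show ?thesis
    by (simp add: tensor_lift_def free_lift_def)
qed

lemma tensor_lift_linear: "linear_map K tensor_space P (tensor_lift K P b)"
proof (rule linear_mapI)
  note [simp del] = free_module_simps
  note [simp] = tensor_lift_coset quotient.coset_add quotient.coset_smult
    linear_mapD[OF free_pairs_lift_linear]
  show "tensor_lift K P b t \<in> carrier P" if "t \<in> carrier tensor_space" for t
    using that by (auto simp: quotient.quotient_carrier)
  show "tensor_lift K P b (s \<oplus>\<^bsub>tensor_space\<^esub> t) = tensor_lift K P b s \<oplus>\<^bsub>P\<^esub> tensor_lift K P b t"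
    if "s \<in> carrier tensor_space" "t \<in> carrier tensor_space" for s t
    using that by (auto simp: quotient.quotient_carrier)
  show "tensor_lift K P b (a \<odot>\<^bsub>tensor_space\<^esub> t) = a \<odot>\<^bsub>P\<^esub> tensor_lift K P b t"
    if "a \<in> carrier K" "t \<in> carrier tensor_space" for a t
    using that by (auto simp: quotient.quotient_carrier)
qed

lemma tensor_lift_pure:
  "\<lbrakk>v \<in> carrier V; w \<in> carrier W\<rbrakk> \<Longrightarrow> tensor_lift K P b (v \<otimes>\<^sub>t w) = b v w"
  by (simp add: pure_tensor_def tensor_lift_coset V.single_closed free_pairs_lift_single)

end

lemma tensor_lift_bilinear:
  assumes U: "module K U" and P: "module K P"
    and bilinear: "\<And>x. x \<in> carrier U \<Longrightarrow> bilinear_map K V W P (b x)"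
    and linear: "\<And>v w. \<lbrakk>v \<in> carrier V; w \<in> carrier W\<rbrakk> \<Longrightarrow> linear_map K U P (\<lambda>x. b x v w)"
  shows "bilinear_map K U tensor_space P (\<lambda>x. tensor_lift K P (b x))"
proof (rule bilinear_mapI)
  interpret P: module K P by (rule P)
  fix t assume "t \<in> carrier tensor_space"
  then obtain u where u: "u \<in> carrier free_pairs" "t = relations +>\<^bsub>free_pairs\<^esub> u"
    by (auto simp: quotient.quotient_carrier)
  have "linear_map K U P (\<lambda>x. \<Oplus>\<^bsub>P\<^esub>p\<in>{p. u p \<noteq> \<zero>\<^bsub>K\<^esub>}. u p \<odot>\<^bsub>P\<^esub> b x (fst p) (snd p))"
    using u(1) by (intro P.linear_map_finsumI P.linear_map_smultI linear)
      (auto simp: free_module_carrier)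
  then show "linear_map K U P (\<lambda>x. tensor_lift K P (b x) t)"
    using u by (subst linear_map_cong[OF U])
      (simp_all add: tensor_lift_coset[OF P bilinear] free_lift_def)
qed (intro tensor_lift_linear P bilinear)

end

lemma tensor_product_cong:
  assumes "carrier V = carrier V'" "add V = add V'" "smult V = smult V'"
    and "carrier W = carrier W'" "add W = add W'" "smult W = smult W'"
  shows "tensor_product K V W = tensor_product K V' W'"
    and "pure_tensor K V W = pure_tensor K V' W'"
proof -
  have "tensor_generators K V W = tensor_generators K V' W'"
    by (simp add: tensor_generators_def assms)
  then have "tensor_relations K V W = tensor_relations K V' W'"
    by (simp add: tensor_relations_def assms)
  then show "tensor_product K V W = tensor_product K V' W'"
    and "pure_tensor K V W = pure_tensor K V' W'"
    by (simp_all add: tensor_product_def pure_tensor_def fun_eq_iff assms)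
qed

section \<open>Smash categories\<close>

lemma smash_simps:
  "Obj (smash K H C act) = Obj C"
  "Mor (smash K H C act) y x = tensor_product K (Mor C y x) H"
  "Ident (smash K H C act) x = pure_tensor K (Mor C x x) H (Ident C x) \<one>\<^bsub>H\<^esub>"
  by (simp_all add: smash_def)

text \<open>
  Only the bilinearity of the structure maps is assumed, so that the double smash category can be
  formed before its factors are known to satisfy the category and Hopf algebra axioms.
\<close>

locale smash_data =
  fixes K :: "('k, 'r) ring_scheme" and H :: "('k, 'h, 'z) hopf_scheme"
    and C :: "('o, 'k, 'm) kcat" and act :: "'o \<Rightarrow> 'o \<Rightarrow> 'h \<Rightarrow> 'm \<Rightarrow> 'm"
  assumes Mor_module: "\<lbrakk>x \<in> Obj C; y \<in> Obj C\<rbrakk> \<Longrightarrow> module K (Mor C y x)"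
    and Comp_bilinear: "\<lbrakk>x \<in> Obj C; y \<in> Obj C; z \<in> Obj C\<rbrakk> \<Longrightarrow>
      bilinear_map K (Mor C z y) (Mor C y x) (Mor C z x) (Comp C z y x)"
    and H_module: "module K H"
    and mult_bilinear: "bilinear_map K H H H (mult H)"
    and comult_linear: "linear_map K H (tensor_product K H H) (comult H)"
    and act_bilinear: "\<lbrakk>x \<in> Obj C; y \<in> Obj C\<rbrakk> \<Longrightarrow>
      bilinear_map K H (Mor C y x) (Mor C y x) (act y x)"
begin

sublocale HH: tensor_pair K H H
  by (intro tensor_pair.intro H_module)

lemma Mor_tensor_pair: "\<lbrakk>x \<in> Obj C; y \<in> Obj C\<rbrakk> \<Longrightarrow> tensor_pair K (Mor C y x) H"
  by (intro tensor_pair.intro Mor_module H_module)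

lemma smash_Mor_module: "\<lbrakk>x \<in> Obj C; y \<in> Obj C\<rbrakk> \<Longrightarrow> module K (Mor (smash K H C act) y x)"
  by (simp add: smash_simps tensor_pair.tensor_module[OF Mor_tensor_pair])

context
  fixes x y z assumes obj: "x \<in> Obj C" "y \<in> Obj C" "z \<in> Obj C"
begin

interpretation zx: tensor_pair K "Mor C z x" H by (intro Mor_tensor_pair obj)
interpretation zy: tensor_pair K "Mor C z y" H by (intro Mor_tensor_pair obj)
interpretation yx: tensor_pair K "Mor C y x" H by (intro Mor_tensor_pair obj)

definition smash_term :: "'m \<Rightarrow> 'm \<Rightarrow> 'h \<Rightarrow> 'h \<Rightarrow> 'h \<Rightarrow> ('m, 'h, 'k) tensor"
  where "smash_term \<phi> \<psi> h' h\<^sub>1 h\<^sub>2 = zx.tensor (Comp C z y x \<phi> (act y x h\<^sub>1 \<psi>)) (h\<^sub>2 \<otimes>\<^bsub>H\<^esub> h')"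

definition pure_Comp :: "'m \<Rightarrow> 'h \<Rightarrow> 'm \<Rightarrow> 'h \<Rightarrow> ('m, 'h, 'k) tensor"
  where "pure_Comp \<phi> h \<psi> h' = tensor_lift K zx.tensor_space (smash_term \<phi> \<psi> h') (comult H h)"

definition left_pure_Comp :: "'m \<Rightarrow> 'h \<Rightarrow> ('m, 'h, 'k) tensor \<Rightarrow> ('m, 'h, 'k) tensor"
  where "left_pure_Comp \<phi> h t = tensor_lift K zx.tensor_space (pure_Comp \<phi> h) t"

lemma smash_Comp_eq:
  "Comp (smash K H C act) z y x s t = tensor_lift K zx.tensor_space (\<lambda>\<phi> h. left_pure_Comp \<phi> h t) s"
  by (simp add: smash_def smash_term_def[abs_def] pure_Comp_def[abs_def] left_pure_Comp_def Let_def)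

lemmas structure_closed = bilinear_map_closed[OF mult_bilinear]
  bilinear_map_closed[OF act_bilinear[OF obj(1,2)]] bilinear_map_closed[OF Comp_bilinear[OF obj]]

lemmas structure_linear =
  bilinear_map_linear_left[OF mult_bilinear]
  bilinear_map_linear_right[OF mult_bilinear]
  bilinear_map_linear_left[OF act_bilinear[OF obj(1,2)]]
  bilinear_map_linear_right[OF act_bilinear[OF obj(1,2)]]
  bilinear_map_linear_left[OF Comp_bilinear[OF obj]]
  linear_map_compose[OF _ bilinear_map_linear_right[OF Comp_bilinear[OF obj]]]

lemmas tensor_left_linear =
  linear_map_compose[OF _ bilinear_map_linear_left[OF zx.pure_tensor_bilinear]]
lemmas tensor_right_linear =
  linear_map_compose[OF _ bilinear_map_linear_right[OF zx.pure_tensor_bilinear]]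

lemma smash_term_bilinear:
  assumes "\<phi> \<in> carrier (Mor C z y)" "\<psi> \<in> carrier (Mor C y x)" "h' \<in> carrier H"
  shows "bilinear_map K H H zx.tensor_space (smash_term \<phi> \<psi> h')"
proof (rule bilinear_mapI)
  show "linear_map K H zx.tensor_space (smash_term \<phi> \<psi> h' h\<^sub>1)" if "h\<^sub>1 \<in> carrier H" for h\<^sub>1
    unfolding smash_term_def[abs_def] using assms that
    by (intro tensor_right_linear structure_linear structure_closed)
  show "linear_map K H zx.tensor_space (\<lambda>h\<^sub>1. smash_term \<phi> \<psi> h' h\<^sub>1 h\<^sub>2)"
    if "h\<^sub>2 \<in> carrier H" for h\<^sub>2
    unfolding smash_term_def using assms that
    by (intro tensor_left_linear structure_linear structure_closed)
qed

lemma smash_term_linear: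
  shows "\<lbrakk>\<psi> \<in> carrier (Mor C y x); h' \<in> carrier H; h\<^sub>1 \<in> carrier H; h\<^sub>2 \<in> carrier H\<rbrakk> \<Longrightarrow>
      linear_map K (Mor C z y) zx.tensor_space (\<lambda>\<phi>. smash_term \<phi> \<psi> h' h\<^sub>1 h\<^sub>2)"
    and "\<lbrakk>\<phi> \<in> carrier (Mor C z y); h' \<in> carrier H; h\<^sub>1 \<in> carrier H; h\<^sub>2 \<in> carrier H\<rbrakk> \<Longrightarrow>
      linear_map K (Mor C y x) zx.tensor_space (\<lambda>\<psi>. smash_term \<phi> \<psi> h' h\<^sub>1 h\<^sub>2)"
    and "\<lbrakk>\<phi> \<in> carrier (Mor C z y); \<psi> \<in> carrier (Mor C y x); h\<^sub>1 \<in> carrier H; h\<^sub>2 \<in> carrier H\<rbrakk> \<Longrightarrow>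
      linear_map K H zx.tensor_space (\<lambda>h'. smash_term \<phi> \<psi> h' h\<^sub>1 h\<^sub>2)"
  unfolding smash_term_def
  by (intro tensor_left_linear structure_linear structure_closed; assumption)+
    (intro tensor_right_linear structure_linear structure_closed; assumption)

lemma pure_Comp_bilinear_left:
  assumes "\<psi> \<in> carrier (Mor C y x)" "h' \<in> carrier H"
  shows "bilinear_map K (Mor C z y) H zx.tensor_space (\<lambda>\<phi> h. pure_Comp \<phi> h \<psi> h')"
  unfolding pure_Comp_def using assms
  by (intro bilinear_map_compose_right[OF HH.tensor_lift_bilinear comult_linear]
      zy.V.module_axioms zx.tensor_module smash_term_bilinear smash_term_linear)

lemma pure_Comp_bilinear_right:
  assumes "\<phi> \<in> carrier (Mor C z y)" "h \<in> carrier H"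
  shows "bilinear_map K (Mor C y x) H zx.tensor_space (pure_Comp \<phi> h)"
proof (rule bilinear_mapI)
  show "linear_map K H zx.tensor_space (pure_Comp \<phi> h \<psi>)" if "\<psi> \<in> carrier (Mor C y x)" for \<psi>
    unfolding pure_Comp_def[abs_def] using assms that
    by (intro bilinear_map_linear_left[OF HH.tensor_lift_bilinear] H_module zx.tensor_module
        smash_term_bilinear smash_term_linear linear_map_closed[OF comult_linear])
  show "linear_map K (Mor C y x) zx.tensor_space (\<lambda>\<psi>. pure_Comp \<phi> h \<psi> h')"
    if "h' \<in> carrier H" for h'
    unfolding pure_Comp_def using assms that
    by (intro bilinear_map_linear_left[OF HH.tensor_lift_bilinear] yx.V.module_axioms
        zx.tensor_module smash_term_bilinear smash_term_linear linear_map_closed[OF comult_linear])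
qed

lemma left_pure_Comp_linear:
  "\<lbrakk>\<phi> \<in> carrier (Mor C z y); h \<in> carrier H\<rbrakk> \<Longrightarrow>
    linear_map K yx.tensor_space zx.tensor_space (left_pure_Comp \<phi> h)"
  unfolding left_pure_Comp_def[abs_def]
  by (intro yx.tensor_lift_linear zx.tensor_module pure_Comp_bilinear_right)

lemma left_pure_Comp_bilinear:
  assumes "t \<in> carrier yx.tensor_space"
  shows "bilinear_map K (Mor C z y) H zx.tensor_space (\<lambda>\<phi> h. left_pure_Comp \<phi> h t)"
proof (rule bilinear_mapI)
  show "linear_map K H zx.tensor_space (\<lambda>h. left_pure_Comp \<phi> h t)"
    if "\<phi> \<in> carrier (Mor C z y)" for \<phi>
    unfolding left_pure_Comp_def using assms that
    by (intro bilinear_map_linear_left[OF yx.tensor_lift_bilinear] H_module zx.tensor_module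
        pure_Comp_bilinear_right bilinear_map_linear_right[OF pure_Comp_bilinear_left])
  show "linear_map K (Mor C z y) zx.tensor_space (\<lambda>\<phi>. left_pure_Comp \<phi> h t)"
    if "h \<in> carrier H" for h
    unfolding left_pure_Comp_def using assms that
    by (intro bilinear_map_linear_left[OF yx.tensor_lift_bilinear] zy.V.module_axioms
        zx.tensor_module pure_Comp_bilinear_right
        bilinear_map_linear_left[OF pure_Comp_bilinear_left])
qed

lemma smash_Comp_bilinear:
  "bilinear_map K (Mor (smash K H C act) z y) (Mor (smash K H C act) y x)
    (Mor (smash K H C act) z x) (Comp (smash K H C act) z y x)"
  unfolding smash_simps smash_Comp_eq[abs_def]
  by (intro bilinear_map_flip[OF zy.tensor_lift_bilinear] yx.tensor_module
      zx.tensor_module left_pure_Comp_bilinear left_pure_Comp_linear)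

lemma smash_Comp_pure:
  assumes "\<phi> \<in> carrier (Mor C z y)" "h \<in> carrier H" "\<psi> \<in> carrier (Mor C y x)" "h' \<in> carrier H"
  shows "Comp (smash K H C act) z y x (zy.tensor \<phi> h) (yx.tensor \<psi> h') =
    tensor_lift K zx.tensor_space (smash_term \<phi> \<psi> h') (comult H h)"
proof -
  have "Comp (smash K H C act) z y x (zy.tensor \<phi> h) (yx.tensor \<psi> h') =
      left_pure_Comp \<phi> h (yx.tensor \<psi> h')"
    unfolding smash_Comp_eq using assms
    by (intro zy.tensor_lift_pure zx.tensor_module left_pure_Comp_bilinear
        yx.pure_tensor_closed)
  also have "\<dots> = pure_Comp \<phi> h \<psi> h'"
    unfolding left_pure_Comp_def using assms
    by (intro yx.tensor_lift_pure zx.tensor_module pure_Comp_bilinear_right)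
  finally show ?thesis by (simp add: pure_Comp_def)
qed

end

end

section \<open>Finite direct sums\<close>

locale finite_direct_sum = module K V
  for K :: "('k, 'r) ring_scheme" and V :: "('k, 'v, 'x) module_scheme" +
  fixes I :: "'i set" and N :: "'i \<Rightarrow> 'v set"
  assumes direct_sum: "internal_direct_sum K V I N" and finite_I: "finite I"
begin

abbreviation proj where "proj \<equiv> projection V I N"

lemma component_submodule: "i \<in> I \<Longrightarrow> submodule (N i) K V"
  using direct_sum by (simp add: internal_direct_sum_def)

lemma component_closed: "\<lbrakk>i \<in> I; v \<in> N i\<rbrakk> \<Longrightarrow> v \<in> carrier V"
  using submoduleE(1)[OF component_submodule] by blast

lemma component_zero: "i \<in> I \<Longrightarrow> \<zero>\<^bsub>V\<^esub> \<in> N i"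
  using subgroup.one_closed[OF submodule.axioms(1)[OF component_submodule]] by fastforce

lemma finsum_support:
  assumes "\<And>i. i \<in> I \<Longrightarrow> c i \<in> carrier V"
  shows "(\<Oplus>\<^bsub>V\<^esub>i\<in>{i \<in> I. c i \<noteq> \<zero>\<^bsub>V\<^esub>}. c i) = (\<Oplus>\<^bsub>V\<^esub>i\<in>I. c i)"
  using assms finite_I by (intro add.finprod_mono_neutral_cong_left) auto

lemma projection_decomposition:
  assumes "v \<in> carrier V"
  shows "is_decomposition V I N v (THE c. is_decomposition V I N v c)"
  using theI'[of "is_decomposition V I N v"] assms direct_sum
  by (simp add: internal_direct_sum_def)

lemma proj_component: "\<lbrakk>v \<in> carrier V; i \<in> I\<rbrakk> \<Longrightarrow> proj i v \<in> N i"
  using projection_decomposition[of v] by (auto simp: projection_def is_decomposition_def)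

lemma proj_closed: "\<lbrakk>v \<in> carrier V; i \<in> I\<rbrakk> \<Longrightarrow> proj i v \<in> carrier V"
  using proj_component component_closed by blast

lemma sum_proj:
  assumes "v \<in> carrier V"
  shows "(\<Oplus>\<^bsub>V\<^esub>i\<in>I. proj i v) = v"
  using projection_decomposition[OF assms] finsum_support[of "\<lambda>i. proj i v"] proj_closed[OF assms]
  by (simp add: projection_def is_decomposition_def)

lemma proj_sum:
  assumes c: "\<And>i. i \<in> I \<Longrightarrow> c i \<in> N i" and j: "j \<in> I"
  shows "proj j (\<Oplus>\<^bsub>V\<^esub>i\<in>I. c i) = c j"
proof -
  let ?c = "restrict c I"
  have c_closed: "c i \<in> carrier V" if "i \<in> I" for i using c component_closed that by blast
  have "(\<Oplus>\<^bsub>V\<^esub>i\<in>I. c i) = (\<Oplus>\<^bsub>V\<^esub>i\<in>I. ?c i)" using c_closed by (intro finsum_cong') auto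
  then have "is_decomposition V I N (\<Oplus>\<^bsub>V\<^esub>i\<in>I. c i) ?c"
    using c finite_I finsum_support[of ?c] c_closed by (auto simp: is_decomposition_def)
  moreover have "(\<Oplus>\<^bsub>V\<^esub>i\<in>I. c i) \<in> carrier V"
    using c_closed by (intro finsum_closed) auto
  ultimately have "(THE d. is_decomposition V I N (\<Oplus>\<^bsub>V\<^esub>i\<in>I. c i) d) = ?c"
    using direct_sum by (intro the1_equality) (simp_all add: internal_direct_sum_def)
  then show ?thesis using j by (simp add: projection_def)
qed

lemma proj_homogeneous:
  assumes "v \<in> N i" "i \<in> I" "j \<in> I"
  shows "proj j v = (if j = i then v else \<zero>\<^bsub>V\<^esub>)"
proof -
  have "(\<Oplus>\<^bsub>V\<^esub>j\<in>I. if j = i then v else \<zero>\<^bsub>V\<^esub>) = v"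
    using finsum_eq_single[of I i "\<lambda>j. if j = i then v else \<zero>\<^bsub>V\<^esub>"] finite_I assms component_closed
    by simp
  then show ?thesis
    using proj_sum[of "\<lambda>j. if j = i then v else \<zero>\<^bsub>V\<^esub>" j] assms component_zero by auto
qed

lemma proj_linear:
  assumes j: "j \<in> I"
  shows "linear_map K V V (proj j)"
proof (rule linear_mapI)
  show "proj j v \<in> carrier V" if "v \<in> carrier V" for v using that j by (rule proj_closed)
  show "proj j (u \<oplus>\<^bsub>V\<^esub> v) = proj j u \<oplus>\<^bsub>V\<^esub> proj j v" if "u \<in> carrier V" "v \<in> carrier V" for u v
  proof -
    have "(\<Oplus>\<^bsub>V\<^esub>i\<in>I. proj i u \<oplus>\<^bsub>V\<^esub> proj i v) = u \<oplus>\<^bsub>V\<^esub> v"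
      using that by (subst finsum_addf) (auto simp: proj_closed sum_proj)
    then show ?thesis
      using proj_sum[of "\<lambda>i. proj i u \<oplus>\<^bsub>V\<^esub> proj i v" j] that j
      by (simp add: submoduleE(5)[OF component_submodule] proj_component)
  qed
  show "proj j (a \<odot>\<^bsub>V\<^esub> v) = a \<odot>\<^bsub>V\<^esub> proj j v" if "a \<in> carrier K" "v \<in> carrier V" for a v
  proof -
    have "(\<Oplus>\<^bsub>V\<^esub>i\<in>I. a \<odot>\<^bsub>V\<^esub> proj i v) = a \<odot>\<^bsub>V\<^esub> v"
      using that finite_I
      by (subst finsum_smult_ldistr[symmetric]) (auto simp: proj_closed sum_proj)
    then show ?thesis
      using proj_sum[of "\<lambda>i. a \<odot>\<^bsub>V\<^esub> proj i v" j] that j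
      by (simp add: submoduleE(4)[OF component_submodule] proj_component)
  qed
qed

lemma linear_map_eq_on_homogeneous:
  assumes "module K P" "linear_map K V P f" "linear_map K V P g" "v \<in> carrier V"
    and "\<And>i v. \<lbrakk>i \<in> I; v \<in> N i\<rbrakk> \<Longrightarrow> f v = g v"
  shows "f v = g v"
  using linear_map_eq_on_finsum[OF module_axioms assms(1-3), of "\<lambda>i. proj i v" I] assms(4,5)
  by (simp add: proj_closed proj_component sum_proj Pi_def)

end

section \<open>Functions on a finite set\<close>

locale function_space = K: cring K
  for K :: "('k, 'r) ring_scheme" and G :: "('g, 's) monoid_scheme"
    and H :: "('k, 'g \<Rightarrow> 'k, 'z) module_scheme" +
  assumes finite_G: "finite (carrier G)"
    and H_carrier: "carrier H = carrier G \<rightarrow>\<^sub>E carrier K"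
    and H_zero: "\<zero>\<^bsub>H\<^esub> = (\<lambda>s\<in>carrier G. \<zero>\<^bsub>K\<^esub>)"
    and H_add: "add H = (\<lambda>a b. \<lambda>s\<in>carrier G. a s \<oplus>\<^bsub>K\<^esub> b s)"
    and H_smult: "smult H = (\<lambda>c a. \<lambda>s\<in>carrier G. c \<otimes>\<^bsub>K\<^esub> a s)"
begin

lemma restrict_closed:
  "(\<And>s. s \<in> carrier G \<Longrightarrow> f s \<in> carrier K) \<Longrightarrow> restrict f (carrier G) \<in> carrier H"
  by (simp add: H_carrier)

sublocale pointwise: pointwise_module K "regular_module K" H "carrier G"
  by (intro pointwise_module.intro pointwise_module_axioms.intro K.regular_module)
    (auto simp: H_carrier H_zero H_add H_smult intro: PiE_ext)

lemmas H_module = pointwise.pointwise_module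

lemma apply_closed: "\<lbrakk>a \<in> carrier H; s \<in> carrier G\<rbrakk> \<Longrightarrow> a s \<in> carrier K"
  using pointwise.apply_closed by simp

lemma delta_closed: "delta K G s \<in> carrier H"
  by (auto simp: H_carrier delta_def)

lemma delta_apply: "u \<in> carrier G \<Longrightarrow> delta K G s u = (if u = s then \<one>\<^bsub>K\<^esub> else \<zero>\<^bsub>K\<^esub>)"
  by (simp add: delta_def)

lemma delta_expansion:
  "a \<in> carrier H \<Longrightarrow> (\<Oplus>\<^bsub>H\<^esub>s\<in>carrier G. a s \<odot>\<^bsub>H\<^esub> delta K G s) = a"
  using finite_G delta_closed
  by (intro basis_expansion[OF pointwise.pointwise_module_axioms]) (auto simp: delta_apply)

lemma linear_map_eq_on_delta:
  assumes P: "module K P" and f: "linear_map K H P f" and g: "linear_map K H P g"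
    and a: "a \<in> carrier H"
    and delta: "\<And>s. s \<in> carrier G \<Longrightarrow> f (delta K G s) = g (delta K G s)"
  shows "f a = g a"
proof -
  have "f (\<Oplus>\<^bsub>H\<^esub>s\<in>carrier G. a s \<odot>\<^bsub>H\<^esub> delta K G s) = g (\<Oplus>\<^bsub>H\<^esub>s\<in>carrier G. a s \<odot>\<^bsub>H\<^esub> delta K G s)"
    using a by (intro linear_map_eq_on_finsum[OF H_module P f g])
      (auto simp: linear_map_smult[OF f] linear_map_smult[OF g] delta delta_closed apply_closed)
  then show ?thesis using a by (simp add: delta_expansion)
qed

lemma linear_combination_linear:
  assumes "module K P" "\<And>s. s \<in> A \<Longrightarrow> f s \<in> carrier G" "\<And>s. s \<in> A \<Longrightarrow> x s \<in> carrier P" "finite A"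
  shows "linear_map K H P (\<lambda>a. \<Oplus>\<^bsub>P\<^esub>s\<in>A. a (f s) \<odot>\<^bsub>P\<^esub> x s)"
proof -
  interpret P: module K P by fact
  show ?thesis
    using assms(2-4)
    by (intro P.linear_map_finsumI
        linear_map_compose[OF pointwise.apply_linear P.smult_scalar_linear])
qed

lemma linear_combination_delta:
  assumes "module K P" "\<And>s. s \<in> carrier G \<Longrightarrow> x s \<in> carrier P" "u \<in> carrier G"
  shows "(\<Oplus>\<^bsub>P\<^esub>s\<in>carrier G. delta K G u s \<odot>\<^bsub>P\<^esub> x s) = x u"
proof -
  interpret P: module K P by fact
  show ?thesis
    using assms(2,3) finite_G
    by (subst P.finsum_eq_single[of _ u]) (auto simp: delta_apply)
qed

end

locale function_tensor = function_space K G H + V: module K V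
  for K :: "('k, 'r) ring_scheme" and G :: "('g, 's) monoid_scheme"
    and H :: "('k, 'g \<Rightarrow> 'k, 'z) module_scheme" and V :: "('k, 'v, 'x) module_scheme"
begin

sublocale tensor_pair K V H
  by (intro tensor_pair.intro V.module_axioms H_module)

notation tensor (infixl \<open>\<otimes>\<^sub>t\<close> 72)

abbreviation coordinate where "coordinate s \<equiv> tensor_lift K V (\<lambda>v a. a s \<odot>\<^bsub>V\<^esub> v)"

lemma coordinate_bilinear:
  assumes s: "s \<in> carrier G"
  shows "bilinear_map K V H V (\<lambda>v a. a s \<odot>\<^bsub>V\<^esub> v)"
proof (rule bilinear_mapI)
  show "linear_map K H V (\<lambda>a. a s \<odot>\<^bsub>V\<^esub> v)" if "v \<in> carrier V" for v
    by (rule linear_map_compose[OF pointwise.apply_linear[OF s] V.smult_scalar_linear[OF that]])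
  show "linear_map K V V (\<lambda>v. a s \<odot>\<^bsub>V\<^esub> v)" if "a \<in> carrier H" for a
    by (rule V.linear_map_smultI[OF linear_map_ident apply_closed[OF that s]])
qed

lemma coordinate_linear: "s \<in> carrier G \<Longrightarrow> linear_map K tensor_space V (coordinate s)"
  by (intro tensor_lift_linear V.module_axioms coordinate_bilinear)

lemma coordinate_pure:
  "\<lbrakk>s \<in> carrier G; v \<in> carrier V; a \<in> carrier H\<rbrakk> \<Longrightarrow> coordinate s (v \<otimes>\<^sub>t a) = a s \<odot>\<^bsub>V\<^esub> v"
  by (intro tensor_lift_pure V.module_axioms coordinate_bilinear)

lemma linear_map_eq_on_delta_tensors:
  assumes P: "module K P"
    and f: "linear_map K tensor_space P f" and g: "linear_map K tensor_space P g"
    and t: "t \<in> carrier tensor_space"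
    and delta: "\<And>v s. \<lbrakk>v \<in> carrier V; s \<in> carrier G\<rbrakk> \<Longrightarrow>
      f (v \<otimes>\<^sub>t delta K G s) = g (v \<otimes>\<^sub>t delta K G s)"
  shows "f t = g t"
proof (rule linear_map_eq_on_pure[OF P f g t])
  fix v a assume v: "v \<in> carrier V" and a: "a \<in> carrier H"
  note right_linear = linear_map_compose[OF bilinear_map_linear_right[OF pure_tensor_bilinear v]]
  show "f (v \<otimes>\<^sub>t a) = g (v \<otimes>\<^sub>t a)"
    by (rule linear_map_eq_on_delta[OF P right_linear[OF f] right_linear[OF g] a delta[OF v]])
qed

end

section \<open>The Hopf algebras of a finite group\<close>

locale finite_group_algebras = K: field K + G: group G
  for K :: "('k, 'r) ring_scheme" and G :: "('g, 's) monoid_scheme" +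
  assumes finite_G: "finite (carrier G)"
begin

abbreviation Fun where "Fun \<equiv> function_hopf K G"
abbreviation Grp where "Grp \<equiv> group_hopf K G"
abbreviation \<delta> where "\<delta> \<equiv> delta K G"

lemmas Fun_defs =
  function_hopf_def function_algebra_def module.extend_def hopf.fields_def Let_def
lemmas Grp_defs =
  group_hopf_def group_algebra_def function_algebra_def module.extend_def hopf.fields_def Let_def

sublocale regular: module K "regular_module K"
  by (rule K.regular_module)

sublocale Fun: function_space K G Fun
  by (intro function_space.intro function_space_axioms.intro K.cring_axioms finite_G)
    (simp_all add: Fun_defs)

sublocale Grp: function_space K G Grp
  by (intro function_space.intro function_space_axioms.intro K.cring_axioms finite_G)
    (simp_all add: Grp_defs)

sublocale FunFun: tensor_pair K Fun Fun
  by (intro tensor_pair.intro Fun.H_module)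

sublocale GrpGrp: tensor_pair K Grp Grp
  by (intro tensor_pair.intro Grp.H_module)

lemma Fun_mult: "mult Fun = (\<lambda>a b. \<lambda>s\<in>carrier G. a s \<otimes>\<^bsub>K\<^esub> b s)"
  and Fun_one: "\<one>\<^bsub>Fun\<^esub> = (\<lambda>s\<in>carrier G. \<one>\<^bsub>K\<^esub>)"
  by (simp_all add: Fun_defs)

lemma Grp_mult: "mult Grp =
    (\<lambda>a b. \<lambda>s\<in>carrier G. \<Oplus>\<^bsub>K\<^esub>u\<in>carrier G. a u \<otimes>\<^bsub>K\<^esub> b (inv\<^bsub>G\<^esub> u \<otimes>\<^bsub>G\<^esub> s))"
  and Grp_one: "\<one>\<^bsub>Grp\<^esub> = \<delta> \<one>\<^bsub>G\<^esub>"
  by (simp_all add: Grp_defs)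

lemma Fun_comult: "comult Fun = (\<lambda>a. \<Oplus>\<^bsub>FunFun.tensor_space\<^esub>p\<in>carrier G \<times> carrier G.
    a (fst p \<otimes>\<^bsub>G\<^esub> snd p) \<odot>\<^bsub>FunFun.tensor_space\<^esub> FunFun.tensor (\<delta> (fst p)) (\<delta> (snd p)))"
proof -
  let ?A = "function_algebra K G"
  have eqs: "carrier ?A = carrier Fun" "add ?A = add Fun" "smult ?A = smult Fun"
    by (simp_all add: Fun_defs)
  have "comult Fun = (\<lambda>a. \<Oplus>\<^bsub>tensor_product K ?A ?A\<^esub>p\<in>carrier G \<times> carrier G.
      a (fst p \<otimes>\<^bsub>G\<^esub> snd p) \<odot>\<^bsub>tensor_product K ?A ?A\<^esub>
        pure_tensor K ?A ?A (\<delta> (fst p)) (\<delta> (snd p)))"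
    by (simp add: function_hopf_def module.extend_def hopf.fields_def Let_def)
  then show ?thesis unfolding tensor_product_cong[OF eqs eqs] .
qed

lemma Grp_comult: "comult Grp = (\<lambda>a. \<Oplus>\<^bsub>GrpGrp.tensor_space\<^esub>s\<in>carrier G.
    a s \<odot>\<^bsub>GrpGrp.tensor_space\<^esub> GrpGrp.tensor (\<delta> s) (\<delta> s))"
proof -
  let ?A = "group_algebra K G"
  have eqs: "carrier ?A = carrier Grp" "add ?A = add Grp" "smult ?A = smult Grp"
    by (simp_all add: group_hopf_def module.extend_def hopf.fields_def Let_def)
  have "comult Grp = (\<lambda>a. \<Oplus>\<^bsub>tensor_product K ?A ?A\<^esub>s\<in>carrier G.
      a s \<odot>\<^bsub>tensor_product K ?A ?A\<^esub> pure_tensor K ?A ?A (\<delta> s) (\<delta> s))"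
    by (simp add: group_hopf_def module.extend_def hopf.fields_def Let_def)
  then show ?thesis unfolding tensor_product_cong[OF eqs eqs] .
qed

lemma Fun_comult_linear: "linear_map K Fun FunFun.tensor_space (comult Fun)"
  unfolding Fun_comult using finite_G
  by (intro Fun.linear_combination_linear FunFun.tensor_module FunFun.pure_tensor_closed
      Fun.delta_closed) auto

lemma Grp_comult_linear: "linear_map K Grp GrpGrp.tensor_space (comult Grp)"
  unfolding Grp_comult using finite_G
  by (intro Grp.linear_combination_linear GrpGrp.tensor_module GrpGrp.pure_tensor_closed
      Grp.delta_closed) auto

lemma Fun_comult_delta:
  assumes s: "s \<in> carrier G"
  shows "comult Fun (\<delta> s) =
    (\<Oplus>\<^bsub>FunFun.tensor_space\<^esub>v\<in>carrier G. FunFun.tensor (\<delta> (s \<otimes>\<^bsub>G\<^esub> inv\<^bsub>G\<^esub> v)) (\<delta> v))"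
proof -
  let ?factor = "\<lambda>v. (s \<otimes>\<^bsub>G\<^esub> inv\<^bsub>G\<^esub> v, v)"
  let ?d = "\<lambda>p. FunFun.tensor (\<delta> (fst p)) (\<delta> (snd p))"
  have d: "?d p \<in> carrier FunFun.tensor_space" for p
    by (intro FunFun.pure_tensor_closed Fun.delta_closed)
  have factor: "p \<in> ?factor ` carrier G \<longleftrightarrow> fst p \<otimes>\<^bsub>G\<^esub> snd p = s"
    if p: "p \<in> carrier G \<times> carrier G" for p
  proof
    assume "fst p \<otimes>\<^bsub>G\<^esub> snd p = s"
    then have "p = ?factor (snd p)" using p by (auto simp: G.m_assoc)
    then show "p \<in> ?factor ` carrier G" using p by auto
  qed (use s in \<open>auto simp: G.m_assoc\<close>)
  have "comult Fun (\<delta> s) = (\<Oplus>\<^bsub>FunFun.tensor_space\<^esub>p\<in>?factor ` carrier G. ?d p)"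
    unfolding Fun_comult using s finite_G d factor
    by (intro FunFun.tensor_space.add.finprod_mono_neutral_cong_right)
      (auto simp: Fun.delta_apply G.m_assoc)
  also have "\<dots> = (\<Oplus>\<^bsub>FunFun.tensor_space\<^esub>v\<in>carrier G. ?d (?factor v))"
    using d by (intro FunFun.tensor_space.finsum_reindex) (auto intro: inj_onI)
  finally show ?thesis by simp
qed

lemma Grp_comult_delta: "s \<in> carrier G \<Longrightarrow> comult Grp (\<delta> s) = GrpGrp.tensor (\<delta> s) (\<delta> s)"
  unfolding Grp_comult
  by (intro Grp.linear_combination_delta GrpGrp.tensor_module GrpGrp.pure_tensor_closed
      Grp.delta_closed)

lemma Fun_mult_bilinear: "bilinear_map K Fun Fun Fun (mult Fun)"
proof -
  have closed: "a \<otimes>\<^bsub>Fun\<^esub> b \<in> carrier Fun" if "a \<in> carrier Fun" "b \<in> carrier Fun" for a b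
    unfolding Fun_mult using that by (intro Fun.restrict_closed) (simp add: Fun.apply_closed)
  have product_apply: "(a \<otimes>\<^bsub>Fun\<^esub> b) s = a s \<otimes>\<^bsub>K\<^esub> b s" if "s \<in> carrier G" for a b s
    using that by (simp add: Fun_mult)
  show ?thesis
    by (intro bilinear_mapI Fun.pointwise.linear_map_pointwiseI Fun.H_module linear_mapI)
      (auto simp: closed product_apply Fun.apply_closed Fun.pointwise.pointwise_apply
        K.l_distr K.r_distr K.m_ac)
qed

lemma Fun_mult_delta:
  "\<lbrakk>s \<in> carrier G; t \<in> carrier G\<rbrakk> \<Longrightarrow> \<delta> s \<otimes>\<^bsub>Fun\<^esub> \<delta> t = (if s = t then \<delta> t else \<zero>\<^bsub>Fun\<^esub>)"
  by (auto simp: Fun_mult Fun.H_zero delta_def fun_eq_iff)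

lemma Fun_one_expansion: "\<one>\<^bsub>Fun\<^esub> = (\<Oplus>\<^bsub>Fun\<^esub>s\<in>carrier G. \<delta> s)"
proof -
  have "\<one>\<^bsub>Fun\<^esub> = (\<Oplus>\<^bsub>Fun\<^esub>s\<in>carrier G. \<one>\<^bsub>Fun\<^esub> s \<odot>\<^bsub>Fun\<^esub> \<delta> s)"
    by (rule Fun.delta_expansion[symmetric]) (simp add: Fun_one Fun.restrict_closed)
  also have "\<dots> = (\<Oplus>\<^bsub>Fun\<^esub>s\<in>carrier G. \<delta> s)"
    by (intro Fun.pointwise.W.finsum_cong') (auto simp: Fun_one Fun.delta_closed)
  finally show ?thesis .
qed

lemma Grp_mult_bilinear: "bilinear_map K Grp Grp Grp (mult Grp)"
proof -
  have closed: "a \<otimes>\<^bsub>Grp\<^esub> b \<in> carrier Grp" if "a \<in> carrier Grp" "b \<in> carrier Grp" for a b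
    unfolding Grp_mult using that
    by (intro Grp.restrict_closed K.finsum_closed) (auto simp: Grp.apply_closed)
  have product_apply: "(a \<otimes>\<^bsub>Grp\<^esub> b) s =
      (\<Oplus>\<^bsub>regular_module K\<^esub>u\<in>carrier G. a u \<odot>\<^bsub>regular_module K\<^esub> b (inv\<^bsub>G\<^esub> u \<otimes>\<^bsub>G\<^esub> s))"
    if "s \<in> carrier G" for a b s
    using that by (simp add: Grp_mult regular_module_finsum)
  show ?thesis
  proof (intro bilinear_mapI Grp.pointwise.linear_map_pointwiseI Grp.H_module closed)
    fix a s assume "a \<in> carrier Grp" "s \<in> carrier G"
    then show "linear_map K Grp (regular_module K) (\<lambda>b. (a \<otimes>\<^bsub>Grp\<^esub> b) s)"
      unfolding product_apply[OF \<open>s \<in> _\<close>]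
      by (intro regular.linear_map_finsumI regular.linear_map_smultI Grp.pointwise.apply_linear
          Grp.apply_closed finite_G G.m_closed G.inv_closed)
  next
    fix b s assume b: "b \<in> carrier Grp" and s: "s \<in> carrier G"
    show "linear_map K Grp (regular_module K) (\<lambda>a. (a \<otimes>\<^bsub>Grp\<^esub> b) s)"
      unfolding product_apply[OF s]
      by (intro Grp.linear_combination_linear K.regular_module finite_G)
        (use b s in \<open>simp_all add: Grp.apply_closed\<close>)
  qed
qed

lemma Grp_mult_delta:
  assumes "s \<in> carrier G" "t \<in> carrier G"
  shows "\<delta> s \<otimes>\<^bsub>Grp\<^esub> \<delta> t = \<delta> (s \<otimes>\<^bsub>G\<^esub> t)"
proof (rule Grp.pointwise.pointwise_eqI)
  show "\<delta> s \<otimes>\<^bsub>Grp\<^esub> \<delta> t \<in> carrier Grp"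
    by (intro bilinear_map_closed[OF Grp_mult_bilinear] Grp.delta_closed)
  fix r assume r: "r \<in> carrier G"
  have "(\<delta> s \<otimes>\<^bsub>Grp\<^esub> \<delta> t) r =
      (\<Oplus>\<^bsub>K\<^esub>u\<in>carrier G. if s = u then \<delta> t (inv\<^bsub>G\<^esub> u \<otimes>\<^bsub>G\<^esub> r) else \<zero>\<^bsub>K\<^esub>)"
    using r by (auto simp: Grp_mult delta_def intro!: K.finsum_cong')
  also have "\<dots> = \<delta> t (inv\<^bsub>G\<^esub> s \<otimes>\<^bsub>G\<^esub> r)"
    using finite_G assms r by (intro K.finsum_singleton) (auto simp: delta_def)
  also have "\<dots> = \<delta> (s \<otimes>\<^bsub>G\<^esub> t) r"
    using assms r G.inv_solve_left[of t s r] by (auto simp: delta_def)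
  finally show "(\<delta> s \<otimes>\<^bsub>Grp\<^esub> \<delta> t) r = \<delta> (s \<otimes>\<^bsub>G\<^esub> t) r" .
qed (rule Grp.delta_closed)

lemma smash_Fun_Comp_delta:
  assumes "smash_data K Fun C act" and obj: "x \<in> Obj C" "y \<in> Obj C" "z \<in> Obj C"
    and \<phi>: "\<phi> \<in> carrier (Mor C z y)" and \<psi>: "\<psi> \<in> carrier (Mor C y x)"
    and s: "s \<in> carrier G" and t: "t \<in> carrier G"
  shows "Comp (smash K Fun C act) z y x
      (pure_tensor K (Mor C z y) Fun \<phi> (\<delta> s)) (pure_tensor K (Mor C y x) Fun \<psi> (\<delta> t)) =
    pure_tensor K (Mor C z x) Fun (Comp C z y x \<phi> (act y x (\<delta> (s \<otimes>\<^bsub>G\<^esub> inv\<^bsub>G\<^esub> t)) \<psi>)) (\<delta> t)"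
proof -
  interpret smash_data K Fun C act by fact
  interpret zx: tensor_pair K "Mor C z x" Fun by (intro Mor_tensor_pair obj)
  let ?b = "smash_term x y z \<phi> \<psi> (\<delta> t)"
  have bilinear: "bilinear_map K Fun Fun zx.tensor_space ?b"
    by (intro smash_term_bilinear obj \<phi> \<psi> Fun.delta_closed)
  have b_delta: "?b (\<delta> u) (\<delta> v) =
      (if v = t then zx.tensor (Comp C z y x \<phi> (act y x (\<delta> u) \<psi>)) (\<delta> t) else \<zero>\<^bsub>zx.tensor_space\<^esub>)"
    if "u \<in> carrier G" "v \<in> carrier G" for u v
    using that t bilinear_map_closed[OF act_bilinear[OF obj(1,2)] Fun.delta_closed \<psi>]
      bilinear_map_closed[OF Comp_bilinear[OF obj] \<phi>]
      bilinear_map_zero_right[OF zx.V.module_axioms Fun.H_module zx.tensor_module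
        zx.pure_tensor_bilinear]
    by (simp add: smash_term_def[OF obj] Fun_mult_delta)
  have "Comp (smash K Fun C act) z y x
      (pure_tensor K (Mor C z y) Fun \<phi> (\<delta> s)) (pure_tensor K (Mor C y x) Fun \<psi> (\<delta> t)) =
      tensor_lift K zx.tensor_space ?b (comult Fun (\<delta> s))"
    by (intro smash_Comp_pure obj \<phi> \<psi> Fun.delta_closed)
  also have "\<dots> = (\<Oplus>\<^bsub>zx.tensor_space\<^esub>v\<in>carrier G.
      tensor_lift K zx.tensor_space ?b (FunFun.tensor (\<delta> (s \<otimes>\<^bsub>G\<^esub> inv\<^bsub>G\<^esub> v)) (\<delta> v)))"
    unfolding Fun_comult_delta[OF s]
    by (intro linear_map_finsum[OF FunFun.tensor_module zx.tensor_module]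
        FunFun.tensor_lift_linear zx.tensor_module bilinear)
      (auto intro!: FunFun.pure_tensor_closed Fun.delta_closed)
  also have "\<dots> = (\<Oplus>\<^bsub>zx.tensor_space\<^esub>v\<in>carrier G. ?b (\<delta> (s \<otimes>\<^bsub>G\<^esub> inv\<^bsub>G\<^esub> v)) (\<delta> v))"
    by (simp add: FunFun.tensor_lift_pure[OF zx.tensor_module bilinear] Fun.delta_closed)
  also have "\<dots> = ?b (\<delta> (s \<otimes>\<^bsub>G\<^esub> inv\<^bsub>G\<^esub> t)) (\<delta> t)"
    by (intro zx.tensor_space.finsum_eq_single finite_G t
        bilinear_map_closed[OF bilinear Fun.delta_closed Fun.delta_closed])
      (simp add: b_delta s)
  finally show ?thesis
    using s t by (simp add: b_delta)
qed

lemma smash_Grp_Comp_delta: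
  assumes "smash_data K Grp C act" and obj: "x \<in> Obj C" "y \<in> Obj C" "z \<in> Obj C"
    and \<phi>: "\<phi> \<in> carrier (Mor C z y)" and \<psi>: "\<psi> \<in> carrier (Mor C y x)"
    and u: "u \<in> carrier G" and v: "v \<in> carrier G"
  shows "Comp (smash K Grp C act) z y x
      (pure_tensor K (Mor C z y) Grp \<phi> (\<delta> u)) (pure_tensor K (Mor C y x) Grp \<psi> (\<delta> v)) =
    pure_tensor K (Mor C z x) Grp (Comp C z y x \<phi> (act y x (\<delta> u) \<psi>)) (\<delta> (u \<otimes>\<^bsub>G\<^esub> v))"
proof -
  interpret smash_data K Grp C act by fact
  interpret zx: tensor_pair K "Mor C z x" Grp by (intro Mor_tensor_pair obj)
  have "Comp (smash K Grp C act) z y x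
      (pure_tensor K (Mor C z y) Grp \<phi> (\<delta> u)) (pure_tensor K (Mor C y x) Grp \<psi> (\<delta> v)) =
      tensor_lift K zx.tensor_space (smash_term x y z \<phi> \<psi> (\<delta> v)) (comult Grp (\<delta> u))"
    by (intro smash_Comp_pure obj \<phi> \<psi> Grp.delta_closed)
  also have "\<dots> = smash_term x y z \<phi> \<psi> (\<delta> v) (\<delta> u) (\<delta> u)"
    unfolding Grp_comult_delta[OF u]
    by (intro GrpGrp.tensor_lift_pure zx.tensor_module smash_term_bilinear obj \<phi> \<psi> Grp.delta_closed)
  finally show ?thesis
    using u v by (simp add: smash_term_def[OF obj] Grp_mult_delta)
qed

end

section \<open>The double smash category of a graded category\<close>

locale finite_grading = finite_group_algebras K G
  for K :: "('k, 'r) ring_scheme" and G :: "('g, 's) monoid_scheme" +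
  fixes B :: "('o, 'k, 'm) kcat" and E :: "'o \<Rightarrow> 'o \<Rightarrow> 'g \<Rightarrow> 'm set"
  assumes graded: "graded_k_category K G B E"
begin

sublocale B: graded_k_category K G B E
  by (rule graded)

abbreviation BFun where "BFun \<equiv> graded_smash K G B E"
abbreviation BFunGrp where "BFunGrp \<equiv> smash K Grp BFun (translation_action K G B)"
abbreviation proj where "proj y x \<equiv> projection (Mor B y x) (carrier G) (E y x)"

lemma Mor_direct_sum:
  "\<lbrakk>x \<in> Obj B; y \<in> Obj B\<rbrakk> \<Longrightarrow> finite_direct_sum K (Mor B y x) (carrier G) (E y x)"
  using finite_G
  by (intro finite_direct_sum.intro finite_direct_sum_axioms.intro B.Mor_module B.grading)

lemma Mor_tensor: "\<lbrakk>x \<in> Obj B; y \<in> Obj B\<rbrakk> \<Longrightarrow> function_tensor K G Fun (Mor B y x)"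
  by (intro function_tensor.intro B.Mor_module Fun.function_space_axioms)

lemma proj_Comp_homogeneous:
  assumes obj: "x \<in> Obj B" "y \<in> Obj B" "z \<in> Obj B"
    and t: "t \<in> carrier G" and f: "f \<in> E z y t"
    and s: "s \<in> carrier G" and g: "g \<in> carrier (Mor B y x)"
  shows "proj z x (t \<otimes>\<^bsub>G\<^esub> s) (Comp B z y x f g) = Comp B z y x f (proj y x s g)"
proof -
  interpret zx: finite_direct_sum K "Mor B z x" "carrier G" "E z x" by (intro Mor_direct_sum obj)
  interpret zy: finite_direct_sum K "Mor B z y" "carrier G" "E z y" by (intro Mor_direct_sum obj)
  interpret yx: finite_direct_sum K "Mor B y x" "carrier G" "E y x" by (intro Mor_direct_sum obj)
  have f_closed: "f \<in> carrier (Mor B z y)" by (rule zy.component_closed[OF t f])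
  define c where "c r = Comp B z y x f (proj y x (inv\<^bsub>G\<^esub> t \<otimes>\<^bsub>G\<^esub> r) g)" for r
  have c: "c r \<in> E z x r" if r: "r \<in> carrier G" for r
  proof -
    have "c r \<in> E z x (t \<otimes>\<^bsub>G\<^esub> (inv\<^bsub>G\<^esub> t \<otimes>\<^bsub>G\<^esub> r))"
      unfolding c_def using t r by (intro B.grading_Comp obj f yx.proj_component g) auto
    then show ?thesis using t r by (simp add: G.m_assoc[symmetric])
  qed
  have "Comp B z y x f g = Comp B z y x f (\<Oplus>\<^bsub>Mor B y x\<^esub>s\<in>carrier G. proj y x s g)"
    using g by (simp add: yx.sum_proj)
  also have "\<dots> = (\<Oplus>\<^bsub>Mor B z x\<^esub>s\<in>carrier G. Comp B z y x f (proj y x s g))"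
    using g by (intro B.Comp_finsum_right obj f_closed) (auto intro: yx.proj_closed)
  also have "\<dots> = (\<Oplus>\<^bsub>Mor B z x\<^esub>s\<in>(\<lambda>r. inv\<^bsub>G\<^esub> t \<otimes>\<^bsub>G\<^esub> r) ` carrier G. Comp B z y x f (proj y x s g))"
    using G.surj_const_mult[of "inv\<^bsub>G\<^esub> t"] t by simp
  also have "\<dots> = (\<Oplus>\<^bsub>Mor B z x\<^esub>r\<in>carrier G. c r)"
    unfolding c_def using t G.inj_on_cmult[of "inv\<^bsub>G\<^esub> t"]
    by (intro zx.finsum_reindex) (auto intro!: B.Comp_closed obj f_closed yx.proj_closed g)
  finally have "proj z x (t \<otimes>\<^bsub>G\<^esub> s) (Comp B z y x f g) = c (t \<otimes>\<^bsub>G\<^esub> s)"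
    using zx.proj_sum[of c "t \<otimes>\<^bsub>G\<^esub> s"] c s t by simp
  then show ?thesis using s t by (simp add: c_def G.m_assoc[symmetric])
qed

text \<open>The component of degree \<open>1\<close> of an identity is a right unit for homogeneous morphisms.\<close>

lemma Ident_homogeneous:
  assumes x: "x \<in> Obj B"
  shows "Ident B x \<in> E x x \<one>\<^bsub>G\<^esub>"
proof -
  interpret xx: finite_direct_sum K "Mor B x x" "carrier G" "E x x" by (intro Mor_direct_sum x)
  note I = B.Ident_closed[OF x]
  define I\<^sub>1 where "I\<^sub>1 = proj x x \<one>\<^bsub>G\<^esub> (Ident B x)"
  have I\<^sub>1: "I\<^sub>1 \<in> E x x \<one>\<^bsub>G\<^esub>" "I\<^sub>1 \<in> carrier (Mor B x x)"
    unfolding I\<^sub>1_def by (simp_all add: xx.proj_component xx.proj_closed I)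
  have "Comp B x x x (Ident B x) I\<^sub>1 = Ident B x"
  proof (rule xx.linear_map_eq_on_homogeneous[OF xx.module_axioms _ linear_map_ident I])
    show "linear_map K (Mor B x x) (Mor B x x) (\<lambda>f. Comp B x x x f I\<^sub>1)"
      by (rule bilinear_map_linear_left[OF B.Comp_bilinear[OF x x x] I\<^sub>1(2)])
    fix t f assume t: "t \<in> carrier G" and f: "f \<in> E x x t"
    have "Comp B x x x f I\<^sub>1 = proj x x (t \<otimes>\<^bsub>G\<^esub> \<one>\<^bsub>G\<^esub>) (Comp B x x x f (Ident B x))"
      unfolding I\<^sub>1_def by (rule proj_Comp_homogeneous[symmetric]) (simp_all add: x t f I)
    also have "\<dots> = f"
      using x t f xx.component_closed[OF t f] by (simp add: B.Ident_right xx.proj_homogeneous)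
    finally show "Comp B x x x f I\<^sub>1 = f" .
  qed
  then show ?thesis using I\<^sub>1 x by (simp add: B.Ident_left)
qed

lemma grading_action_bilinear:
  assumes "x \<in> Obj B" "y \<in> Obj B"
  shows "bilinear_map K Fun (Mor B y x) (Mor B y x) (grading_action G B E y x)"
proof (rule bilinear_mapI)
  interpret yx: finite_direct_sum K "Mor B y x" "carrier G" "E y x" by (intro Mor_direct_sum assms)
  show "linear_map K Fun (Mor B y x) (\<lambda>a. grading_action G B E y x a f)"
    if "f \<in> carrier (Mor B y x)" for f
    unfolding grading_action_def using that
    by (intro Fun.linear_combination_linear yx.module_axioms finite_G yx.proj_closed)
  show "linear_map K (Mor B y x) (Mor B y x) (grading_action G B E y x a)"
    if "a \<in> carrier Fun" for a
    unfolding grading_action_def[abs_def] using that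
    by (intro yx.linear_map_finsumI yx.linear_map_smultI yx.proj_linear finite_G Fun.apply_closed)
qed

lemma grading_action_delta:
  assumes "x \<in> Obj B" "y \<in> Obj B" "f \<in> carrier (Mor B y x)" "s \<in> carrier G"
  shows "grading_action G B E y x (\<delta> s) f = proj y x s f"
proof -
  interpret yx: finite_direct_sum K "Mor B y x" "carrier G" "E y x" by (intro Mor_direct_sum assms)
  show ?thesis
    unfolding grading_action_def using assms
    by (intro Fun.linear_combination_delta yx.module_axioms yx.proj_closed)
qed

sublocale inner_smash: smash_data K Fun B "grading_action G B E"
  by (intro smash_data.intro B.Mor_module B.Comp_bilinear Fun.H_module grading_action_bilinear
      Fun_mult_bilinear Fun_comult_linear)

lemma BFun_simps:
  "Obj BFun = Obj B"
  "Mor BFun y x = tensor_product K (Mor B y x) Fun"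
  "Ident BFun x = pure_tensor K (Mor B x x) Fun (Ident B x) \<one>\<^bsub>Fun\<^esub>"
  by (simp_all add: graded_smash_def smash_simps)

lemma BFun_Mor_module: "\<lbrakk>x \<in> Obj B; y \<in> Obj B\<rbrakk> \<Longrightarrow> module K (Mor BFun y x)"
  unfolding graded_smash_def by (rule inner_smash.smash_Mor_module)

lemma BFun_Mor_tensor: "\<lbrakk>x \<in> Obj B; y \<in> Obj B\<rbrakk> \<Longrightarrow> function_tensor K G Grp (Mor BFun y x)"
  by (intro function_tensor.intro BFun_Mor_module Grp.function_space_axioms)

lemma BFun_Comp_bilinear:
  "\<lbrakk>x \<in> Obj B; y \<in> Obj B; z \<in> Obj B\<rbrakk> \<Longrightarrow>
    bilinear_map K (Mor BFun z y) (Mor BFun y x) (Mor BFun z x) (Comp BFun z y x)"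
  unfolding graded_smash_def by (rule inner_smash.smash_Comp_bilinear)

lemma BFun_Comp_delta:
  assumes "x \<in> Obj B" "y \<in> Obj B" "z \<in> Obj B"
    and "f \<in> carrier (Mor B z y)" "g \<in> carrier (Mor B y x)" "s \<in> carrier G" "t \<in> carrier G"
  shows "Comp BFun z y x
      (pure_tensor K (Mor B z y) Fun f (\<delta> s)) (pure_tensor K (Mor B y x) Fun g (\<delta> t)) =
    pure_tensor K (Mor B z x) Fun (Comp B z y x f (proj y x (s \<otimes>\<^bsub>G\<^esub> inv\<^bsub>G\<^esub> t) g)) (\<delta> t)"
  using assms smash_Fun_Comp_delta[OF inner_smash.smash_data_axioms assms]
  by (simp add: graded_smash_def grading_action_delta)

context
  fixes x y assumes obj: "x \<in> Obj B" "y \<in> Obj B"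
begin

interpretation yx: function_tensor K G Fun "Mor B y x" by (intro Mor_tensor obj)

definition pure_translate :: "'g \<Rightarrow> 'm \<Rightarrow> ('g \<Rightarrow> 'k) \<Rightarrow> ('m, 'g \<Rightarrow> 'k, 'k) tensor"
  where "pure_translate t f b = (\<Oplus>\<^bsub>yx.tensor_space\<^esub>s\<in>carrier G.
    b s \<odot>\<^bsub>yx.tensor_space\<^esub> yx.tensor f (\<delta> (s \<otimes>\<^bsub>G\<^esub> inv\<^bsub>G\<^esub> t)))"

definition translate :: "'g \<Rightarrow> ('m, 'g \<Rightarrow> 'k, 'k) tensor \<Rightarrow> ('m, 'g \<Rightarrow> 'k, 'k) tensor"
  where "translate t = tensor_lift K yx.tensor_space (pure_translate t)"

lemma translation_action_eq:
  "translation_action K G B y x a T =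
    (\<Oplus>\<^bsub>yx.tensor_space\<^esub>t\<in>carrier G. a t \<odot>\<^bsub>yx.tensor_space\<^esub> translate t T)"
  by (simp add: translation_action_def translate_def pure_translate_def[abs_def] Let_def)

lemma pure_translate_bilinear: "bilinear_map K (Mor B y x) Fun yx.tensor_space (pure_translate t)"
proof (rule bilinear_mapI)
  show "linear_map K Fun yx.tensor_space (pure_translate t f)" if "f \<in> carrier (Mor B y x)" for f
    unfolding pure_translate_def[abs_def] using that
    by (intro Fun.linear_combination_linear yx.tensor_module yx.pure_tensor_closed Fun.delta_closed
        finite_G)
  show "linear_map K (Mor B y x) yx.tensor_space (\<lambda>f. pure_translate t f b)"
    if "b \<in> carrier Fun" for b
    unfolding pure_translate_def using that
    by (intro yx.tensor_space.linear_map_finsumI yx.tensor_space.linear_map_smultI finite_G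
        Fun.apply_closed Fun.delta_closed bilinear_map_linear_left[OF yx.pure_tensor_bilinear])
qed

lemma translate_linear: "linear_map K yx.tensor_space yx.tensor_space (translate t)"
  unfolding translate_def
  by (intro yx.tensor_lift_linear yx.tensor_module pure_translate_bilinear)

lemma translate_delta:
  assumes "f \<in> carrier (Mor B y x)" "s \<in> carrier G"
  shows "translate t (yx.tensor f (\<delta> s)) = yx.tensor f (\<delta> (s \<otimes>\<^bsub>G\<^esub> inv\<^bsub>G\<^esub> t))"
proof -
  have "translate t (yx.tensor f (\<delta> s)) = pure_translate t f (\<delta> s)"
    unfolding translate_def using assms
    by (intro yx.tensor_lift_pure pure_translate_bilinear yx.tensor_module Fun.delta_closed)
  also have "\<dots> = yx.tensor f (\<delta> (s \<otimes>\<^bsub>G\<^esub> inv\<^bsub>G\<^esub> t))"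
    unfolding pure_translate_def using assms
    by (intro Fun.linear_combination_delta yx.tensor_module yx.pure_tensor_closed Fun.delta_closed)
  finally show ?thesis .
qed

lemma translation_action_bilinear:
  "bilinear_map K Grp (Mor BFun y x) (Mor BFun y x) (translation_action K G B y x)"
  unfolding BFun_simps
proof (rule bilinear_mapI)
  fix T assume "T \<in> carrier yx.tensor_space"
  then show "linear_map K Grp yx.tensor_space (\<lambda>a. translation_action K G B y x a T)"
    unfolding translation_action_eq
    by (intro Grp.linear_combination_linear yx.tensor_module linear_map_closed[OF translate_linear]
        finite_G)
next
  fix a assume "a \<in> carrier Grp"
  then show "linear_map K yx.tensor_space yx.tensor_space (translation_action K G B y x a)"
    unfolding translation_action_eq[abs_def]
    by (intro yx.tensor_space.linear_map_finsumI yx.tensor_space.linear_map_smultI finite_G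
        Grp.apply_closed translate_linear)
qed

lemma translation_action_delta:
  assumes "f \<in> carrier (Mor B y x)" "s \<in> carrier G" "t \<in> carrier G"
  shows "translation_action K G B y x (\<delta> t) (yx.tensor f (\<delta> s)) =
    yx.tensor f (\<delta> (s \<otimes>\<^bsub>G\<^esub> inv\<^bsub>G\<^esub> t))"
proof -
  have "translation_action K G B y x (\<delta> t) (yx.tensor f (\<delta> s)) = translate t (yx.tensor f (\<delta> s))"
    unfolding translation_action_eq using assms
    by (intro Grp.linear_combination_delta yx.tensor_module linear_map_closed[OF translate_linear]
        yx.pure_tensor_closed Fun.delta_closed)
  then show ?thesis using assms by (simp add: translate_delta)
qed

end

sublocale outer_smash: smash_data K Grp BFun "translation_action K G B"
  using Grp_mult_bilinear Grp_comult_linear Grp.H_module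
  by (intro smash_data.intro; simp only: BFun_simps(1))
    (auto intro: BFun_Mor_module BFun_Comp_bilinear translation_action_bilinear)

lemma BFunGrp_simps:
  "Obj BFunGrp = Obj B"
  "Mor BFunGrp y x = tensor_product K (Mor BFun y x) Grp"
  "Ident BFunGrp x = pure_tensor K (Mor BFun x x) Grp (Ident BFun x) \<one>\<^bsub>Grp\<^esub>"
  by (simp_all add: smash_simps BFun_simps(1))

lemma BFunGrp_Mor_module: "\<lbrakk>x \<in> Obj B; y \<in> Obj B\<rbrakk> \<Longrightarrow> module K (Mor BFunGrp y x)"
  using outer_smash.smash_Mor_module by (simp only: BFun_simps(1))

lemma BFunGrp_Comp_bilinear:
  "\<lbrakk>x \<in> Obj B; y \<in> Obj B; z \<in> Obj B\<rbrakk> \<Longrightarrow>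
    bilinear_map K (Mor BFunGrp z y) (Mor BFunGrp y x) (Mor BFunGrp z x) (Comp BFunGrp z y x)"
  using outer_smash.smash_Comp_bilinear by (simp only: BFun_simps(1))

definition double_tensor ::
  "'o \<Rightarrow> 'o \<Rightarrow> 'm \<Rightarrow> 'g \<Rightarrow> 'g \<Rightarrow> (('m, 'g \<Rightarrow> 'k, 'k) tensor, 'g \<Rightarrow> 'k, 'k) tensor"
  where "double_tensor y x f s u =
    pure_tensor K (Mor BFun y x) Grp (pure_tensor K (Mor B y x) Fun f (\<delta> s)) (\<delta> u)"

lemma BFun_tensor_delta_closed:
  assumes "x \<in> Obj B" "y \<in> Obj B" "f \<in> carrier (Mor B y x)"
  shows "pure_tensor K (Mor B y x) Fun f (\<delta> s) \<in> carrier (Mor BFun y x)"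
proof -
  interpret yx: function_tensor K G Fun "Mor B y x" by (intro Mor_tensor assms)
  show ?thesis using assms by (simp add: BFun_simps yx.pure_tensor_closed Fun.delta_closed)
qed

lemma double_tensor_linear:
  assumes obj: "x \<in> Obj B" "y \<in> Obj B"
  shows "linear_map K (Mor B y x) (Mor BFunGrp y x) (\<lambda>f. double_tensor y x f s u)"
proof -
  interpret inner: function_tensor K G Fun "Mor B y x" by (intro Mor_tensor obj)
  interpret outer: function_tensor K G Grp "Mor BFun y x" by (intro BFun_Mor_tensor obj)
  have "linear_map K (Mor B y x) (Mor BFun y x) (\<lambda>f. inner.tensor f (\<delta> s))"
    unfolding BFun_simps
    by (rule bilinear_map_linear_left[OF inner.pure_tensor_bilinear Fun.delta_closed])
  then show ?thesis
    unfolding double_tensor_def BFunGrp_simps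
    by (rule linear_map_compose)
      (rule bilinear_map_linear_left[OF outer.pure_tensor_bilinear Grp.delta_closed])
qed

lemma double_tensor_zero:
  "\<lbrakk>x \<in> Obj B; y \<in> Obj B\<rbrakk> \<Longrightarrow> double_tensor y x \<zero>\<^bsub>Mor B y x\<^esub> s u = \<zero>\<^bsub>Mor BFunGrp y x\<^esub>"
  by (rule linear_map_zero[OF B.Mor_module BFunGrp_Mor_module double_tensor_linear])

lemma double_tensor_Comp:
  assumes obj: "x \<in> Obj B" "y \<in> Obj B" "z \<in> Obj B"
    and f: "f \<in> carrier (Mor B z y)" and g: "g \<in> carrier (Mor B y x)"
    and G: "s \<in> carrier G" "u \<in> carrier G" "t \<in> carrier G" "v \<in> carrier G"
  shows "Comp BFunGrp z y x (double_tensor z y f s u) (double_tensor y x g t v) =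
    double_tensor z x (Comp B z y x f (proj y x (s \<otimes>\<^bsub>G\<^esub> u \<otimes>\<^bsub>G\<^esub> inv\<^bsub>G\<^esub> t) g))
      (t \<otimes>\<^bsub>G\<^esub> inv\<^bsub>G\<^esub> u) (u \<otimes>\<^bsub>G\<^esub> v)"
proof -
  have degree: "s \<otimes>\<^bsub>G\<^esub> inv\<^bsub>G\<^esub> (t \<otimes>\<^bsub>G\<^esub> inv\<^bsub>G\<^esub> u) = s \<otimes>\<^bsub>G\<^esub> u \<otimes>\<^bsub>G\<^esub> inv\<^bsub>G\<^esub> t"
    using G by (simp add: G.inv_mult_group G.m_assoc)
  have "Comp BFunGrp z y x (double_tensor z y f s u) (double_tensor y x g t v) =
      pure_tensor K (Mor BFun z x) Grp
        (Comp BFun z y x (pure_tensor K (Mor B z y) Fun f (\<delta> s))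
          (translation_action K G B y x (\<delta> u) (pure_tensor K (Mor B y x) Fun g (\<delta> t))))
        (\<delta> (u \<otimes>\<^bsub>G\<^esub> v))"
    unfolding double_tensor_def
    by (intro smash_Grp_Comp_delta[OF outer_smash.smash_data_axioms])
      (simp_all add: BFun_simps(1) obj G BFun_tensor_delta_closed f g)
  then show ?thesis
    using obj f g G by (simp add: translation_action_delta BFun_Comp_delta degree double_tensor_def)
qed

lemma Ident_BFunGrp_closed:
  assumes x: "x \<in> Obj B"
  shows "Ident BFunGrp x \<in> carrier (Mor BFunGrp x x)"
proof -
  interpret inner: function_tensor K G Fun "Mor B x x" by (intro Mor_tensor x)
  interpret outer: function_tensor K G Grp "Mor BFun x x" by (intro BFun_Mor_tensor x)
  have "Ident BFun x \<in> carrier (Mor BFun x x)"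
    unfolding BFun_simps Fun_one
    by (intro inner.pure_tensor_closed B.Ident_closed x Fun.restrict_closed K.one_closed)
  then show ?thesis
    unfolding BFunGrp_simps Grp_one by (intro outer.pure_tensor_closed Grp.delta_closed)
qed

section \<open>Matrix units\<close>

text \<open>
  \<open>f \<otimes> \<delta>\<^sub>s \<otimes> u\<close> with \<open>f\<close> of degree \<open>d\<close> is the matrix unit in row \<open>p = ds\<close> and column \<open>q = su\<close>;
  solving for \<open>s\<close> and \<open>u\<close> gives the definition.
\<close>

definition matrix_unit ::
  "'o \<Rightarrow> 'o \<Rightarrow> 'g \<Rightarrow> 'g \<Rightarrow> 'g \<Rightarrow> 'm \<Rightarrow> (('m, 'g \<Rightarrow> 'k, 'k) tensor, 'g \<Rightarrow> 'k, 'k) tensor"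
  where "matrix_unit y x d p q f = double_tensor y x f (inv\<^bsub>G\<^esub> d \<otimes>\<^bsub>G\<^esub> p) (inv\<^bsub>G\<^esub> p \<otimes>\<^bsub>G\<^esub> d \<otimes>\<^bsub>G\<^esub> q)"

lemma G_cancel_left:
  "\<lbrakk>a \<in> carrier G; b \<in> carrier G\<rbrakk> \<Longrightarrow> a \<otimes>\<^bsub>G\<^esub> (inv\<^bsub>G\<^esub> a \<otimes>\<^bsub>G\<^esub> b) = b"
  "\<lbrakk>a \<in> carrier G; b \<in> carrier G\<rbrakk> \<Longrightarrow> inv\<^bsub>G\<^esub> a \<otimes>\<^bsub>G\<^esub> (a \<otimes>\<^bsub>G\<^esub> b) = b"
  by (simp_all add: G.m_assoc[symmetric])

lemma double_tensor_eq_matrix_unit: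
  "\<lbrakk>d \<in> carrier G; s \<in> carrier G; u \<in> carrier G\<rbrakk> \<Longrightarrow>
    double_tensor y x f s u = matrix_unit y x d (d \<otimes>\<^bsub>G\<^esub> s) (s \<otimes>\<^bsub>G\<^esub> u) f"
  by (simp add: matrix_unit_def G.inv_mult_group G.m_assoc G_cancel_left)

lemma matrix_unit_linear:
  "\<lbrakk>x \<in> Obj B; y \<in> Obj B\<rbrakk> \<Longrightarrow> linear_map K (Mor B y x) (Mor BFunGrp y x) (matrix_unit y x d p q)"
  unfolding matrix_unit_def[abs_def] by (rule double_tensor_linear)

lemmas matrix_unit_closed = linear_map_closed[OF matrix_unit_linear]

lemma matrix_unit_Comp:
  assumes obj: "x \<in> Obj B" "y \<in> Obj B" "z \<in> Obj B"
    and d: "d \<in> carrier G" and f: "f \<in> E z y d" and e: "e \<in> carrier G" and g: "g \<in> E y x e"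
    and G: "p \<in> carrier G" "r \<in> carrier G" "r' \<in> carrier G" "q \<in> carrier G"
  shows "Comp BFunGrp z y x (matrix_unit z y d p r f) (matrix_unit y x e r' q g) =
    (if r = r' then matrix_unit z x (d \<otimes>\<^bsub>G\<^esub> e) p q (Comp B z y x f g) else \<zero>\<^bsub>Mor BFunGrp z x\<^esub>)"
proof -
  interpret zy: finite_direct_sum K "Mor B z y" "carrier G" "E z y" by (intro Mor_direct_sum obj)
  interpret yx: finite_direct_sum K "Mor B y x" "carrier G" "E y x" by (intro Mor_direct_sum obj)
  have f_closed: "f \<in> carrier (Mor B z y)" and g_closed: "g \<in> carrier (Mor B y x)"
    using zy.component_closed[OF d f] yx.component_closed[OF e g] .
  let ?s = "inv\<^bsub>G\<^esub> d \<otimes>\<^bsub>G\<^esub> p" and ?u = "inv\<^bsub>G\<^esub> p \<otimes>\<^bsub>G\<^esub> d \<otimes>\<^bsub>G\<^esub> r"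
  let ?t = "inv\<^bsub>G\<^esub> e \<otimes>\<^bsub>G\<^esub> r'" and ?v = "inv\<^bsub>G\<^esub> r' \<otimes>\<^bsub>G\<^esub> e \<otimes>\<^bsub>G\<^esub> q"
  have degree: "?s \<otimes>\<^bsub>G\<^esub> ?u \<otimes>\<^bsub>G\<^esub> inv\<^bsub>G\<^esub> ?t = r \<otimes>\<^bsub>G\<^esub> inv\<^bsub>G\<^esub> r' \<otimes>\<^bsub>G\<^esub> e"
    using d e G by (simp add: G.inv_mult_group G.m_assoc G_cancel_left)
  have degree_iff: "r \<otimes>\<^bsub>G\<^esub> inv\<^bsub>G\<^esub> r' \<otimes>\<^bsub>G\<^esub> e = e \<longleftrightarrow> r = r'"
    using e G G.inv_solve_right[of "\<one>\<^bsub>G\<^esub>" r r'] by (auto simp: G.r_cancel_one)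
  have product: "Comp BFunGrp z y x (matrix_unit z y d p r f) (matrix_unit y x e r' q g) =
      double_tensor z x (Comp B z y x f (if r = r' then g else \<zero>\<^bsub>Mor B y x\<^esub>))
        (?t \<otimes>\<^bsub>G\<^esub> inv\<^bsub>G\<^esub> ?u) (?u \<otimes>\<^bsub>G\<^esub> ?v)"
    unfolding matrix_unit_def using d e g G
    by (subst double_tensor_Comp[OF obj f_closed g_closed])
      (simp_all add: degree degree_iff yx.proj_homogeneous)
  show ?thesis
  proof (cases "r = r'")
    case True
    then show ?thesis
      unfolding product using d e G
      by (simp add: matrix_unit_def G.inv_mult_group G.m_assoc G_cancel_left)
  next
    case False
    then show ?thesis
      unfolding product using obj f_closed by (simp add: B.Comp_zero_right double_tensor_zero)
  qed
qed

lemma Ident_BFunGrp: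
  assumes x: "x \<in> Obj B"
  shows "Ident BFunGrp x =
    (\<Oplus>\<^bsub>Mor BFunGrp x x\<^esub>s\<in>carrier G. matrix_unit x x \<one>\<^bsub>G\<^esub> s s (Ident B x))"
proof -
  interpret inner: function_tensor K G Fun "Mor B x x" by (intro Mor_tensor x)
  interpret outer: function_tensor K G Grp "Mor BFun x x" by (intro BFun_Mor_tensor x)
  note I = B.Ident_closed[OF x]
  have tensor_linear: "linear_map K Fun (Mor BFunGrp x x)
      (\<lambda>a. outer.tensor (inner.tensor (Ident B x) a) (\<delta> \<one>\<^bsub>G\<^esub>))"
    unfolding BFunGrp_simps
    by (rule linear_map_compose[OF _
          bilinear_map_linear_left[OF outer.pure_tensor_bilinear Grp.delta_closed]])
      (simp only: BFun_simps, rule bilinear_map_linear_right[OF inner.pure_tensor_bilinear I])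
  have "Ident BFunGrp x =
      outer.tensor (inner.tensor (Ident B x) (\<Oplus>\<^bsub>Fun\<^esub>s\<in>carrier G. \<delta> s)) (\<delta> \<one>\<^bsub>G\<^esub>)"
    by (simp add: BFunGrp_simps BFun_simps Grp_one Fun_one_expansion)
  also have "\<dots> = (\<Oplus>\<^bsub>Mor BFunGrp x x\<^esub>s\<in>carrier G.
      outer.tensor (inner.tensor (Ident B x) (\<delta> s)) (\<delta> \<one>\<^bsub>G\<^esub>))"
    by (intro linear_map_finsum[OF Fun.H_module BFunGrp_Mor_module tensor_linear] x)
      (simp add: Fun.delta_closed)
  also have "\<dots> = (\<Oplus>\<^bsub>Mor BFunGrp x x\<^esub>s\<in>carrier G. matrix_unit x x \<one>\<^bsub>G\<^esub> s s (Ident B x))"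
  proof -
    interpret module K "Mor BFunGrp x x" by (intro BFunGrp_Mor_module x)
    have "outer.tensor (inner.tensor (Ident B x) (\<delta> s)) (\<delta> \<one>\<^bsub>G\<^esub>) =
        matrix_unit x x \<one>\<^bsub>G\<^esub> s s (Ident B x)" if "s \<in> carrier G" for s
      using that by (simp add: matrix_unit_def double_tensor_def)
    then show ?thesis by (intro finsum_cong') (auto intro: matrix_unit_closed x I)
  qed
  finally show ?thesis .
qed

section \<open>Matrix entries\<close>

definition coefficient ::
  "'o \<Rightarrow> 'o \<Rightarrow> 'g \<Rightarrow> 'g \<Rightarrow> (('m, 'g \<Rightarrow> 'k, 'k) tensor, 'g \<Rightarrow> 'k, 'k) tensor \<Rightarrow> 'm"
  where "coefficient y x s u t = tensor_lift K (Mor B y x) (\<lambda>v a. a s \<odot>\<^bsub>Mor B y x\<^esub> v)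
    (tensor_lift K (Mor BFun y x) (\<lambda>v a. a u \<odot>\<^bsub>Mor BFun y x\<^esub> v) t)"

definition entry :: "'o \<Rightarrow> 'o \<Rightarrow> 'g \<Rightarrow> 'g \<Rightarrow> (('m, 'g \<Rightarrow> 'k, 'k) tensor, 'g \<Rightarrow> 'k, 'k) tensor \<Rightarrow> 'm"
  where "entry y x p q t = (\<Oplus>\<^bsub>Mor B y x\<^esub>d\<in>carrier G.
    proj y x d (coefficient y x (inv\<^bsub>G\<^esub> d \<otimes>\<^bsub>G\<^esub> p) (inv\<^bsub>G\<^esub> p \<otimes>\<^bsub>G\<^esub> d \<otimes>\<^bsub>G\<^esub> q) t))"

definition elementary_matrix ::
  "'o \<Rightarrow> 'o \<Rightarrow> 'g \<Rightarrow> 'g \<Rightarrow> 'm \<Rightarrow> (('m, 'g \<Rightarrow> 'k, 'k) tensor, 'g \<Rightarrow> 'k, 'k) tensor"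
  where "elementary_matrix y x p q f =
    (\<Oplus>\<^bsub>Mor BFunGrp y x\<^esub>d\<in>carrier G. matrix_unit y x d p q (proj y x d f))"

definition from_entries ::
  "'o \<Rightarrow> 'o \<Rightarrow> ('g \<Rightarrow> 'g \<Rightarrow> 'm) \<Rightarrow> (('m, 'g \<Rightarrow> 'k, 'k) tensor, 'g \<Rightarrow> 'k, 'k) tensor"
  where "from_entries y x M = (\<Oplus>\<^bsub>Mor BFunGrp y x\<^esub>i\<in>carrier G \<times> carrier G.
    elementary_matrix y x (fst i) (snd i) (M (fst i) (snd i)))"

context
  fixes x y assumes obj: "x \<in> Obj B" "y \<in> Obj B"
begin

interpretation yx: finite_direct_sum K "Mor B y x" "carrier G" "E y x" by (intro Mor_direct_sum obj)
interpretation inner: function_tensor K G Fun "Mor B y x" by (intro Mor_tensor obj)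
interpretation outer: function_tensor K G Grp "Mor BFun y x" by (intro BFun_Mor_tensor obj)
interpretation Mor: module K "Mor BFunGrp y x" by (intro BFunGrp_Mor_module obj)

lemma linear_map_eq_on_matrix_units:
  assumes P: "module K P"
    and g: "linear_map K (Mor BFunGrp y x) P g" and h: "linear_map K (Mor BFunGrp y x) P h"
    and t: "t \<in> carrier (Mor BFunGrp y x)"
    and matrix_units: "\<And>d p q f. \<lbrakk>d \<in> carrier G; p \<in> carrier G; q \<in> carrier G; f \<in> E y x d\<rbrakk> \<Longrightarrow>
      g (matrix_unit y x d p q f) = h (matrix_unit y x d p q f)"
  shows "g t = h t"
proof -
  note inner_eq = inner.linear_map_eq_on_delta_tensors[folded BFun_simps(2), OF P]
  note outer_eq = outer.linear_map_eq_on_delta_tensors[folded BFunGrp_simps(2), OF P g h t]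
  note outer_linear = linear_map_compose[OF bilinear_map_linear_left[OF
        outer.pure_tensor_bilinear Grp.delta_closed, folded BFunGrp_simps(2)]]
  note double_linear = linear_map_compose[OF double_tensor_linear[OF obj]]
  show ?thesis
  proof (rule outer_eq)
    fix \<phi> u assume \<phi>: "\<phi> \<in> carrier (Mor BFun y x)" and u: "u \<in> carrier G"
    show "g (outer.tensor \<phi> (\<delta> u)) = h (outer.tensor \<phi> (\<delta> u))"
    proof (rule inner_eq[OF outer_linear[OF g] outer_linear[OF h] \<phi>])
      fix f s assume f: "f \<in> carrier (Mor B y x)" and s: "s \<in> carrier G"
      show "g (outer.tensor (inner.tensor f (\<delta> s)) (\<delta> u)) =
          h (outer.tensor (inner.tensor f (\<delta> s)) (\<delta> u))"
        unfolding double_tensor_def[symmetric]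
      proof (rule yx.linear_map_eq_on_homogeneous[OF P double_linear[OF g] double_linear[OF h] f])
        fix d f assume "d \<in> carrier G" "f \<in> E y x d"
        then show "g (double_tensor y x f s u) = h (double_tensor y x f s u)"
          using s u by (simp add: double_tensor_eq_matrix_unit[of d] matrix_units)
      qed
    qed
  qed
qed

lemma coefficient_linear:
  "\<lbrakk>s \<in> carrier G; u \<in> carrier G\<rbrakk> \<Longrightarrow>
    linear_map K (Mor BFunGrp y x) (Mor B y x) (coefficient y x s u)"
  unfolding coefficient_def[abs_def] BFunGrp_simps
  by (intro linear_map_compose[OF outer.coordinate_linear])
    (simp_all only: BFun_simps inner.coordinate_linear)

lemma coefficient_double_tensor:
  assumes "s \<in> carrier G" "u \<in> carrier G" "f \<in> carrier (Mor B y x)"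
  shows "coefficient y x s u (double_tensor y x f s' u') =
    (if s = s' \<and> u = u' then f else \<zero>\<^bsub>Mor B y x\<^esub>)"
proof -
  have tensor: "inner.tensor f (\<delta> s') \<in> carrier (Mor BFun y x)"
    by (rule BFun_tensor_delta_closed[OF obj assms(3)])
  have "coefficient y x s u (double_tensor y x f s' u') =
      inner.coordinate s (\<delta> u' u \<odot>\<^bsub>Mor BFun y x\<^esub> inner.tensor f (\<delta> s'))"
    using assms tensor
    by (simp add: coefficient_def double_tensor_def outer.coordinate_pure Grp.delta_closed)
  also have "\<dots> = \<delta> u' u \<odot>\<^bsub>Mor B y x\<^esub> inner.coordinate s (inner.tensor f (\<delta> s'))"
    using assms tensor unfolding BFun_simps
    by (intro linear_map_smult[OF inner.coordinate_linear] Grp.apply_closed Grp.delta_closed)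
  also have "\<dots> = (if s = s' \<and> u = u' then f else \<zero>\<^bsub>Mor B y x\<^esub>)"
    using assms by (simp add: inner.coordinate_pure Fun.delta_closed Fun.delta_apply)
  finally show ?thesis .
qed

lemma entry_linear:
  assumes "p \<in> carrier G" "q \<in> carrier G"
  shows "linear_map K (Mor BFunGrp y x) (Mor B y x) (entry y x p q)"
  unfolding entry_def[abs_def] using assms
  by (intro yx.linear_map_finsumI linear_map_compose[OF coefficient_linear] yx.proj_linear finite_G
      G.m_closed G.inv_closed)

lemmas entry_closed = linear_map_closed[OF entry_linear]

lemma entry_matrix_unit:
  assumes d: "d \<in> carrier G" and f: "f \<in> E y x d"
    and G: "p \<in> carrier G" "q \<in> carrier G" "p' \<in> carrier G" "q' \<in> carrier G"
  shows "entry y x p' q' (matrix_unit y x d p q f) =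
    (if p' = p \<and> q' = q then f else \<zero>\<^bsub>Mor B y x\<^esub>)"
proof -
  have f_closed: "f \<in> carrier (Mor B y x)" by (rule yx.component_closed[OF d f])
  have proj_zero: "proj y x c \<zero>\<^bsub>Mor B y x\<^esub> = \<zero>\<^bsub>Mor B y x\<^esub>" if "c \<in> carrier G" for c
    by (rule linear_map_zero[OF yx.module_axioms yx.module_axioms yx.proj_linear[OF that]])
  let ?part = "\<lambda>c. proj y x c (coefficient y x (inv\<^bsub>G\<^esub> c \<otimes>\<^bsub>G\<^esub> p') (inv\<^bsub>G\<^esub> p' \<otimes>\<^bsub>G\<^esub> c \<otimes>\<^bsub>G\<^esub> q')
    (matrix_unit y x d p q f))"
  have part: "?part c = (if c = d \<and> p' = p \<and> q' = q then f else \<zero>\<^bsub>Mor B y x\<^esub>)"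
    if c: "c \<in> carrier G" for c
  proof (cases "c = d")
    case True
    then show ?thesis
      using d f f_closed G
      by (auto simp: matrix_unit_def coefficient_double_tensor proj_zero yx.proj_homogeneous)
  next
    case False
    then show ?thesis
      using c d f f_closed G
      by (simp add: matrix_unit_def coefficient_double_tensor proj_zero yx.proj_homogeneous[OF f d])
  qed
  have "entry y x p' q' (matrix_unit y x d p q f) = ?part d"
    unfolding entry_def using d f_closed
    by (intro yx.finsum_eq_single finite_G) (simp_all add: part)
  then show ?thesis using part[OF d] by simp
qed

lemma elementary_matrix_linear:
  "linear_map K (Mor B y x) (Mor BFunGrp y x) (elementary_matrix y x p q)"
  unfolding elementary_matrix_def[abs_def]
  by (intro Mor.linear_map_finsumI linear_map_compose[OF yx.proj_linear matrix_unit_linear] obj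
      finite_G)

lemmas elementary_matrix_closed = linear_map_closed[OF elementary_matrix_linear]

lemma elementary_matrix_homogeneous:
  assumes "d \<in> carrier G" "f \<in> E y x d"
  shows "elementary_matrix y x p q f = matrix_unit y x d p q f"
proof -
  have f_closed: "f \<in> carrier (Mor B y x)" by (rule yx.component_closed[OF assms])
  have matrix_unit_zero: "matrix_unit y x c p q \<zero>\<^bsub>Mor B y x\<^esub> = \<zero>\<^bsub>Mor BFunGrp y x\<^esub>" for c
    by (rule linear_map_zero[OF yx.module_axioms Mor.module_axioms matrix_unit_linear[OF obj]])
  have "elementary_matrix y x p q f = matrix_unit y x d p q (proj y x d f)"
    unfolding elementary_matrix_def using assms f_closed
    by (intro Mor.finsum_eq_single finite_G matrix_unit_closed obj yx.proj_closed)
      (simp_all add: yx.proj_homogeneous[OF assms(2,1)] matrix_unit_zero)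
  then show ?thesis using assms by (simp add: yx.proj_homogeneous)
qed

lemma entry_elementary_matrix:
  assumes f: "f \<in> carrier (Mor B y x)"
    and G: "p \<in> carrier G" "q \<in> carrier G" "p' \<in> carrier G" "q' \<in> carrier G"
  shows "entry y x p' q' (elementary_matrix y x p q f) =
    (if p' = p \<and> q' = q then f else \<zero>\<^bsub>Mor B y x\<^esub>)"
proof (rule yx.linear_map_eq_on_homogeneous[OF yx.module_axioms _ _ f])
  show "linear_map K (Mor B y x) (Mor B y x) (\<lambda>f. entry y x p' q' (elementary_matrix y x p q f))"
    by (rule linear_map_compose[OF elementary_matrix_linear entry_linear[OF G(3,4)]])
  show "linear_map K (Mor B y x) (Mor B y x) (\<lambda>f. if p' = p \<and> q' = q then f else \<zero>\<^bsub>Mor B y x\<^esub>)"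
    by (rule linear_mapI) auto
  show "entry y x p' q' (elementary_matrix y x p q f) =
      (if p' = p \<and> q' = q then f else \<zero>\<^bsub>Mor B y x\<^esub>)"
    if "d \<in> carrier G" "f \<in> E y x d" for d f
    using that G by (simp add: elementary_matrix_homogeneous[of d] entry_matrix_unit)
qed

lemma from_entries_closed:
  "(\<And>p q. \<lbrakk>p \<in> carrier G; q \<in> carrier G\<rbrakk> \<Longrightarrow> M p q \<in> carrier (Mor B y x)) \<Longrightarrow>
    from_entries y x M \<in> carrier (Mor BFunGrp y x)"
  unfolding from_entries_def by (intro Mor.finsum_closed) (auto intro: elementary_matrix_closed)

lemma from_entries_cong:
  assumes "\<And>p q. \<lbrakk>p \<in> carrier G; q \<in> carrier G\<rbrakk> \<Longrightarrow> M p q = N p q"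
    and "\<And>p q. \<lbrakk>p \<in> carrier G; q \<in> carrier G\<rbrakk> \<Longrightarrow> N p q \<in> carrier (Mor B y x)"
  shows "from_entries y x M = from_entries y x N"
  unfolding from_entries_def using assms
  by (intro Mor.finsum_cong') (auto intro!: elementary_matrix_closed)

lemma entry_from_entries:
  assumes M: "\<And>p q. \<lbrakk>p \<in> carrier G; q \<in> carrier G\<rbrakk> \<Longrightarrow> M p q \<in> carrier (Mor B y x)"
    and pq: "p \<in> carrier G" "q \<in> carrier G"
  shows "entry y x p q (from_entries y x M) = M p q"
proof -
  let ?e = "\<lambda>i. entry y x p q (elementary_matrix y x (fst i) (snd i) (M (fst i) (snd i)))"
  have e: "?e i = (if i = (p, q) then M p q else \<zero>\<^bsub>Mor B y x\<^esub>)" if "i \<in> carrier G \<times> carrier G" for i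
    using that pq M by (cases i) (auto simp: entry_elementary_matrix split: if_splits)
  have "entry y x p q (from_entries y x M) = (\<Oplus>\<^bsub>Mor B y x\<^esub>i\<in>carrier G \<times> carrier G. ?e i)"
    unfolding from_entries_def using M
    by (intro linear_map_finsum[OF Mor.module_axioms yx.module_axioms entry_linear[OF pq]])
      (auto intro: elementary_matrix_closed)
  also have "\<dots> = ?e (p, q)"
    using e pq M finite_G by (intro yx.finsum_eq_single) auto
  also have "\<dots> = M p q" using e[of "(p, q)"] pq by simp
  finally show ?thesis .
qed

lemma from_entries_entry:
  assumes t: "t \<in> carrier (Mor BFunGrp y x)"
  shows "from_entries y x (\<lambda>p q. entry y x p q t) = t"
proof (rule linear_map_eq_on_matrix_units[OF Mor.module_axioms _ linear_map_ident t])
  show "linear_map K (Mor BFunGrp y x) (Mor BFunGrp y x)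
      (\<lambda>t. from_entries y x (\<lambda>p q. entry y x p q t))"
    unfolding from_entries_def using finite_G
    by (intro Mor.linear_map_finsumI linear_map_compose[OF entry_linear elementary_matrix_linear])
      auto
  fix d p q f assume d: "d \<in> carrier G" and pq: "p \<in> carrier G" "q \<in> carrier G" and f: "f \<in> E y x d"
  note f_closed = yx.component_closed[OF d f]
  let ?t = "matrix_unit y x d p q f"
  have elementary_zero: "elementary_matrix y x p q \<zero>\<^bsub>Mor B y x\<^esub> = \<zero>\<^bsub>Mor BFunGrp y x\<^esub>" for p q
    by (rule linear_map_zero[OF yx.module_axioms Mor.module_axioms elementary_matrix_linear])
  let ?e = "\<lambda>i. elementary_matrix y x (fst i) (snd i) (entry y x (fst i) (snd i) ?t)"
  have e: "?e i = (if i = (p, q) then ?t else \<zero>\<^bsub>Mor BFunGrp y x\<^esub>)"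
    if "i \<in> carrier G \<times> carrier G" for i
  proof (cases "i = (p, q)")
    case True
    then show ?thesis using pq d f by (simp add: entry_matrix_unit elementary_matrix_homogeneous)
  next
    case False
    then have "\<not> (fst i = p \<and> snd i = q)" by (cases i) simp
    then have "entry y x (fst i) (snd i) ?t = \<zero>\<^bsub>Mor B y x\<^esub>"
      using that pq d f by (simp only: entry_matrix_unit mem_Times_iff if_False)
    then show ?thesis using False by (simp add: elementary_zero)
  qed
  have "from_entries y x (\<lambda>p q. entry y x p q ?t) = ?e (p, q)"
    unfolding from_entries_def using pq e finite_G f_closed
    by (intro Mor.finsum_eq_single) (auto intro!: matrix_unit_closed obj)
  also have "\<dots> = ?t" using e[of "(p, q)"] pq by simp
  finally show "from_entries y x (\<lambda>p q. entry y x p q ?t) = ?t" .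
qed

end

lemma entry_Comp_matrix_units:
  assumes obj: "x \<in> Obj B" "y \<in> Obj B" "z \<in> Obj B"
    and d: "d \<in> carrier G" and f: "f \<in> E z y d" and e: "e \<in> carrier G" and g: "g \<in> E y x e"
    and G: "p \<in> carrier G" "r \<in> carrier G" "r' \<in> carrier G" "q \<in> carrier G"
      "i \<in> carrier G" "j \<in> carrier G"
  shows "entry z x i j (Comp BFunGrp z y x (matrix_unit z y d p r f) (matrix_unit y x e r' q g)) =
    (\<Oplus>\<^bsub>Mor B z x\<^esub>l\<in>carrier G. Comp B z y x
      (entry z y i l (matrix_unit z y d p r f)) (entry y x l j (matrix_unit y x e r' q g)))"
proof -
  interpret zx: module K "Mor B z x" by (intro B.Mor_module obj)
  interpret zy: finite_direct_sum K "Mor B z y" "carrier G" "E z y" by (intro Mor_direct_sum obj)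
  interpret yx: finite_direct_sum K "Mor B y x" "carrier G" "E y x" by (intro Mor_direct_sum obj)
  have f_closed: "f \<in> carrier (Mor B z y)" and g_closed: "g \<in> carrier (Mor B y x)"
    using zy.component_closed[OF d f] yx.component_closed[OF e g] .
  have fg: "Comp B z y x f g \<in> E z x (d \<otimes>\<^bsub>G\<^esub> e)" by (intro B.grading_Comp obj d e f g)
  have entry_zero: "entry z x i j \<zero>\<^bsub>Mor BFunGrp z x\<^esub> = \<zero>\<^bsub>Mor B z x\<^esub>"
    by (intro linear_map_zero[OF BFunGrp_Mor_module zx.module_axioms entry_linear] obj G)
  let ?R = "if i = p \<and> r = r' \<and> j = q then Comp B z y x f g else \<zero>\<^bsub>Mor B z x\<^esub>"
  let ?h = "\<lambda>l. Comp B z y x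
    (entry z y i l (matrix_unit z y d p r f)) (entry y x l j (matrix_unit y x e r' q g))"
  have h: "?h l = (if l = r then ?R else \<zero>\<^bsub>Mor B z x\<^esub>)" if "l \<in> carrier G" for l
    using that obj d e f g G f_closed g_closed
    by (auto simp: entry_matrix_unit B.Comp_zero_left B.Comp_zero_right)
  have "entry z x i j
      (Comp BFunGrp z y x (matrix_unit z y d p r f) (matrix_unit y x e r' q g)) = ?R"
    using obj d e f g G fg
    by (auto simp: matrix_unit_Comp entry_matrix_unit[of x z "d \<otimes>\<^bsub>G\<^esub> e"] entry_zero)
  also have "\<dots> = ?h r" using G h by simp
  also have "\<dots> = (\<Oplus>\<^bsub>Mor B z x\<^esub>l\<in>carrier G. ?h l)"
    using G h finite_G B.Comp_closed[OF obj f_closed g_closed]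
    by (intro zx.finsum_eq_single[symmetric]) auto
  finally show ?thesis .
qed

lemma bilinear_map_eq_on_matrix_units:
  assumes obj: "x \<in> Obj B" "y \<in> Obj B" "z \<in> Obj B" and P: "module K P"
    and b: "bilinear_map K (Mor BFunGrp z y) (Mor BFunGrp y x) P b"
    and b': "bilinear_map K (Mor BFunGrp z y) (Mor BFunGrp y x) P b'"
    and S: "S \<in> carrier (Mor BFunGrp z y)" and T: "T \<in> carrier (Mor BFunGrp y x)"
    and matrix_units: "\<And>d p r f e r' q g.
      \<lbrakk>d \<in> carrier G; p \<in> carrier G; r \<in> carrier G; f \<in> E z y d;
        e \<in> carrier G; r' \<in> carrier G; q \<in> carrier G; g \<in> E y x e\<rbrakk> \<Longrightarrow>
      b (matrix_unit z y d p r f) (matrix_unit y x e r' q g) =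
      b' (matrix_unit z y d p r f) (matrix_unit y x e r' q g)"
  shows "b S T = b' S T"
proof (rule linear_map_eq_on_matrix_units[OF obj(2,3) P
      bilinear_map_linear_left[OF b T] bilinear_map_linear_left[OF b' T] S])
  fix d p r f
  assume f: "d \<in> carrier G" "p \<in> carrier G" "r \<in> carrier G" "f \<in> E z y d"
  have unit: "matrix_unit z y d p r f \<in> carrier (Mor BFunGrp z y)"
    by (intro matrix_unit_closed obj
        finite_direct_sum.component_closed[OF Mor_direct_sum[OF obj(2,3)] f(1,4)])
  show "b (matrix_unit z y d p r f) T = b' (matrix_unit z y d p r f) T"
    by (rule linear_map_eq_on_matrix_units[OF obj(1,2) P
          bilinear_map_linear_right[OF b unit] bilinear_map_linear_right[OF b' unit] T])
      (rule matrix_units[OF f])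
qed

lemma entry_Comp:
  assumes obj: "x \<in> Obj B" "y \<in> Obj B" "z \<in> Obj B"
    and i: "i \<in> carrier G" and j: "j \<in> carrier G"
    and S: "S \<in> carrier (Mor BFunGrp z y)" and T: "T \<in> carrier (Mor BFunGrp y x)"
  shows "entry z x i j (Comp BFunGrp z y x S T) =
    (\<Oplus>\<^bsub>Mor B z x\<^esub>l\<in>carrier G. Comp B z y x (entry z y i l S) (entry y x l j T))"
proof -
  interpret zx: module K "Mor B z x" by (intro B.Mor_module obj)
  note entry = entry_linear[OF obj(1,3) i j]
  note Comp = B.Comp_bilinear[OF obj] and double_Comp = BFunGrp_Comp_bilinear[OF obj]
  have entry_of_Comp: "bilinear_map K (Mor BFunGrp z y) (Mor BFunGrp y x) (Mor B z x)
      (\<lambda>S T. entry z x i j (Comp BFunGrp z y x S T))"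
    by (intro bilinear_mapI linear_map_compose[OF bilinear_map_linear_right[OF double_Comp] entry]
        linear_map_compose[OF bilinear_map_linear_left[OF double_Comp] entry])
  have matrix_product: "bilinear_map K (Mor BFunGrp z y) (Mor BFunGrp y x) (Mor B z x)
      (\<lambda>S T. \<Oplus>\<^bsub>Mor B z x\<^esub>l\<in>carrier G. Comp B z y x (entry z y i l S) (entry y x l j T))"
  proof (rule bilinear_mapI; rule zx.linear_map_finsumI[OF _ finite_G])
    fix l S assume l: "l \<in> carrier G" and S: "S \<in> carrier (Mor BFunGrp z y)"
    show "linear_map K (Mor BFunGrp y x) (Mor B z x)
        (\<lambda>T. Comp B z y x (entry z y i l S) (entry y x l j T))"
      by (rule linear_map_compose[OF entry_linear[OF obj(1,2) l j]
            bilinear_map_linear_right[OF Comp entry_closed[OF obj(2,3) i l S]]])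
  next
    fix l T assume l: "l \<in> carrier G" and T: "T \<in> carrier (Mor BFunGrp y x)"
    show "linear_map K (Mor BFunGrp z y) (Mor B z x)
        (\<lambda>S. Comp B z y x (entry z y i l S) (entry y x l j T))"
      by (rule linear_map_compose[OF entry_linear[OF obj(2,3) i l]
            bilinear_map_linear_left[OF Comp entry_closed[OF obj(1,2) l j T]]])
  qed
  show ?thesis
    by (rule bilinear_map_eq_on_matrix_units[OF obj zx.module_axioms entry_of_Comp matrix_product
          S T])
      (intro entry_Comp_matrix_units obj i j; assumption)
qed

lemma entry_Ident:
  assumes x: "x \<in> Obj B" and i: "i \<in> carrier G" and j: "j \<in> carrier G"
  shows "entry x x i j (Ident BFunGrp x) = (if i = j then Ident B x else \<zero>\<^bsub>Mor B x x\<^esub>)"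
proof -
  interpret xx: module K "Mor B x x" by (intro B.Mor_module x)
  note I = B.Ident_closed[OF x]
  have unit: "entry x x i j (matrix_unit x x \<one>\<^bsub>G\<^esub> s s (Ident B x)) =
      (if i = s \<and> j = s then Ident B x else \<zero>\<^bsub>Mor B x x\<^esub>)" if "s \<in> carrier G" for s
    using that i j by (simp add: entry_matrix_unit x Ident_homogeneous)
  have "entry x x i j (Ident BFunGrp x) = (\<Oplus>\<^bsub>Mor B x x\<^esub>s\<in>carrier G.
      entry x x i j (matrix_unit x x \<one>\<^bsub>G\<^esub> s s (Ident B x)))"
    unfolding Ident_BFunGrp[OF x]
    by (intro linear_map_finsum[OF BFunGrp_Mor_module xx.module_axioms entry_linear] x i j)
      (auto intro: matrix_unit_closed x I)
  also have "\<dots> = entry x x i j (matrix_unit x x \<one>\<^bsub>G\<^esub> i i (Ident B x))"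
    using i unit I finite_G by (intro xx.finsum_eq_single) auto
  finally show ?thesis using unit[OF i] by auto
qed

section \<open>The isomorphism\<close>

context
  fixes n :: nat and enum :: "nat \<Rightarrow> 'g"
  assumes enum: "bij_betw enum {..<n} (carrier G)"
begin

definition entry_matrix ::
  "'o \<Rightarrow> 'o \<Rightarrow> (('m, 'g \<Rightarrow> 'k, 'k) tensor, 'g \<Rightarrow> 'k, 'k) tensor \<Rightarrow> nat \<times> nat \<Rightarrow> 'm"
  where "entry_matrix y x t = (\<lambda>ij\<in>{..<n} \<times> {..<n}. entry y x (enum (fst ij)) (enum (snd ij)) t)"

lemma enum_closed: "i < n \<Longrightarrow> enum i \<in> carrier G"
  using bij_betwE[OF enum] by auto

lemma enum_eq_iff: "\<lbrakk>i < n; j < n\<rbrakk> \<Longrightarrow> enum i = enum j \<longleftrightarrow> i = j"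
  using enum by (auto simp: bij_betw_def dest: inj_onD)

lemma entry_matrix_apply:
  "\<lbrakk>i < n; j < n\<rbrakk> \<Longrightarrow> entry_matrix y x t (i, j) = entry y x (enum i) (enum j) t"
  by (simp add: entry_matrix_def)

lemma entry_matrix_closed:
  "\<lbrakk>x \<in> Obj B; y \<in> Obj B; t \<in> carrier (Mor BFunGrp y x)\<rbrakk> \<Longrightarrow>
    entry_matrix y x t \<in> carrier (Mor (B.Mat n) y x)"
  unfolding entry_matrix_def by (intro matrix_closedI) (simp add: entry_closed enum_closed)

lemma entry_matrix_linear:
  assumes "x \<in> Obj B" "y \<in> Obj B"
  shows "linear_map K (Mor BFunGrp y x) (Mor (B.Mat n) y x) (entry_matrix y x)"
proof (rule pointwise_module.linear_map_pointwiseI[OF B.matrix_pointwise[OF assms]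
      BFunGrp_Mor_module[OF assms] entry_matrix_closed[OF assms]])
  fix ij :: "nat \<times> nat" assume "ij \<in> {..<n} \<times> {..<n}"
  then show "linear_map K (Mor BFunGrp y x) (Mor B y x) (\<lambda>t. entry_matrix y x t ij)"
    using assms by (auto simp: entry_matrix_apply entry_linear enum_closed)
qed

lemma entry_matrix_bij:
  assumes obj: "x \<in> Obj B" "y \<in> Obj B"
  shows "bij_betw (entry_matrix y x) (carrier (Mor BFunGrp y x))
    (carrier (Mor (B.Mat n) y x))"
proof -
  define index where "index = inv_into {..<n} enum"
  have index: "index p < n" "enum (index p) = p" if "p \<in> carrier G" for p
    using enum that inv_into_into[of p enum "{..<n}"]
    by (auto simp: index_def bij_betw_def f_inv_into_f)
  have index_enum: "index (enum i) = i" if "i < n" for i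
    using enum that by (auto simp: index_def bij_betw_def inv_into_f_f)
  let ?of_matrix = "\<lambda>N. from_entries y x (\<lambda>p q. N (index p, index q))"
  have of_matrix_closed: "?of_matrix N \<in> carrier (Mor BFunGrp y x)"
    if "N \<in> carrier (Mor (B.Mat n) y x)" for N
    using index by (intro from_entries_closed obj) (simp add: matrix_entry_closed[OF _ _ that])
  have "?of_matrix (entry_matrix y x t) = t" if "t \<in> carrier (Mor BFunGrp y x)" for t
  proof -
    have "?of_matrix (entry_matrix y x t) = from_entries y x (\<lambda>p q. entry y x p q t)"
      using that
      by (intro from_entries_cong obj) (simp_all add: entry_matrix_apply index entry_closed obj)
    then show ?thesis using from_entries_entry[OF obj that] by simp
  qed
  moreover have "entry_matrix y x (?of_matrix N) = N"
    if N: "N \<in> carrier (Mor (B.Mat n) y x)" for N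
    by (rule matrix_eqI[OF entry_matrix_closed[OF obj of_matrix_closed[OF N]] N])
      (simp add: entry_matrix_apply entry_from_entries obj matrix_entry_closed[OF _ _ N] index
        index_enum enum_closed)
  ultimately show ?thesis
    by (intro bij_betw_byWitness[where f' = ?of_matrix])
      (auto intro: entry_matrix_closed obj of_matrix_closed)
qed

lemma entry_matrix_Comp:
  assumes obj: "x \<in> Obj B" "y \<in> Obj B" "z \<in> Obj B"
    and S: "S \<in> carrier (Mor BFunGrp z y)" and T: "T \<in> carrier (Mor BFunGrp y x)"
  shows "entry_matrix z x (Comp BFunGrp z y x S T) =
    Comp (B.Mat n) z y x (entry_matrix z y S) (entry_matrix y x T)"
proof (rule matrix_eqI[OF
      entry_matrix_closed[OF obj(1,3) bilinear_map_closed[OF BFunGrp_Comp_bilinear[OF obj] S T]]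
      B.matrix_Comp_closed[OF obj
        entry_matrix_closed[OF obj(2,3) S] entry_matrix_closed[OF obj(1,2) T]]])
  interpret zx: module K "Mor B z x" by (intro B.Mor_module obj)
  fix i j assume ij: "i < n" "j < n"
  let ?h = "\<lambda>r. Comp B z y x (entry z y (enum i) r S) (entry y x r (enum j) T)"
  have h: "?h r \<in> carrier (Mor B z x)" if "r \<in> carrier G" for r
    using that ij obj S T by (intro B.Comp_closed entry_closed enum_closed)
  have "entry_matrix z x (Comp BFunGrp z y x S T) (i, j) = (\<Oplus>\<^bsub>Mor B z x\<^esub>r\<in>carrier G. ?h r)"
    using ij obj S T by (simp add: entry_matrix_apply entry_Comp enum_closed)
  also have "carrier G = enum ` {..<n}" using enum by (simp add: bij_betw_def)
  also have "(\<Oplus>\<^bsub>Mor B z x\<^esub>r\<in>enum ` {..<n}. ?h r) = (\<Oplus>\<^bsub>Mor B z x\<^esub>l\<in>{..<n}. ?h (enum l))"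
    using enum h enum_closed by (intro zx.finsum_reindex) (auto simp: bij_betw_def)
  also have "\<dots> = Comp (B.Mat n) z y x (entry_matrix z y S) (entry_matrix y x T) (i, j)"
    unfolding matrix_Comp_apply[OF ij] using ij h enum_closed
    by (intro zx.finsum_cong') (auto simp: entry_matrix_apply)
  finally show "entry_matrix z x (Comp BFunGrp z y x S T) (i, j) =
      Comp (B.Mat n) z y x (entry_matrix z y S) (entry_matrix y x T) (i, j)" .
qed

lemma entry_matrix_Ident:
  assumes "x \<in> Obj B"
  shows "entry_matrix x x (Ident BFunGrp x) = Ident (B.Mat n) x"
  using assms
  by (intro matrix_eqI[OF entry_matrix_closed B.matrix_Ident_closed] Ident_BFunGrp_closed)
    (simp_all add: entry_matrix_apply matrix_Ident_apply entry_Ident enum_closed enum_eq_iff)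

lemma double_smash_transport: "k_category_transport K BFunGrp (B.Mat n) entry_matrix"
  by (intro k_category_transport.intro k_category_transport_axioms.intro B.matrix_k_category
      BFunGrp_simps(1)[folded matrix_category_simps(1)[of n B]];
      simp only: matrix_category_simps(1))
    (intro BFunGrp_Mor_module entry_matrix_linear entry_matrix_bij entry_matrix_Comp
      entry_matrix_Ident bilinear_map_closed[OF BFunGrp_Comp_bilinear] Ident_BFunGrp_closed;
      assumption)+

end

end

theorem lemma4p3:
  fixes K :: "('k, 'r) ring_scheme" and G :: "('g, 's) monoid_scheme" and n :: nat
    and B :: "('o, 'k, 'm) kcat" and E :: "'o \<Rightarrow> 'o \<Rightarrow> 'g \<Rightarrow> 'm set"
  assumes "field K"
    and "group G" and "finite (carrier G)" and "order G = n"
    and "graded_k_category K G B E"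
  shows "isomorphic_k_categories K
    (smash K (group_hopf K G) (graded_smash K G B E) (translation_action K G B))
    (matrix_category n B)"
proof -
  interpret finite_grading K G B E
    using assms by (intro finite_grading.intro finite_grading_axioms.intro
        finite_group_algebras.intro finite_group_algebras_axioms.intro)
  obtain e where "bij_betw e {..<n} (carrier G)"
    using ex_bij_betw_nat_finite[OF assms(3)] assms(4) by (auto simp: order_def atLeast0LessThan)
  then show ?thesis
    by (rule k_category_transport.isomorphic[OF double_smash_transport])
qed

end
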